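(* Let $u$, $w$, $\rho$, $x_0$ be as in the context, let $\varphi$ be the function on $[0,1]$ determined by $w$ and $\rho$ as in the context, and let $\delta$ be the concave envelope of $\varphi$ on $[0,1]$, i.e. $$\delta(x)=\sup_{0\le a\le x\le b\le 1}\frac{(b-x)\varphi(a)+(x-a)\varphi(b)}{b-a},\qquad x\in[0,1].$$ (1) For $\lambda>0$, the problem $$\sup_{Q\in\mathcal G}\int_0^1\bigl(u(Q(x))-\lambda Q(x)\varphi'(x)\bigr)\,dx$$ admits a unique optimal solution, namely $x\mapsto (u')^{-1}(\lambda\delta'(x))$, $x\in(0,1)$. (2) The problem $$\sup_{Q\in\mathcal Q}\int_0^1 u(Q(x))\,dx,\qquad \mathcal Q:=\Bigl\{Q\in\mathcal G:\ \int_0^1Q(x)\varphi'(x)\,dx=x_0\Bigr\},$$ admits an optimal solution if and only if the equation $$\int_0^1 (u')^{-1}(\lambda\delta'(x))\,\varphi'(x)\,dx=x_0$$ admits a solution $\lambda>0$, in which case $x\mapsto (u')^{-1}(\lambda\delta'(x))$, $x\in(0,1)$, is the unique optimal solution to this problem.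
   Context: Standing setting. $\mathbb R^+=[0,\infty)$. The utility function $u$ is strictly increasing and twice differentiable on $\mathbb R^+$ with $u''<0$ (derivatives are understood on $(0,\infty)$, and $u(0)=\lim_{y\downarrow0}u(y)$). $(u')^{-1}$ is the inverse function of $u'$; $(u')^{-1}(p)$ is identified with the maximizer of $y\mapsto u(y)-py$ over $y\in\mathbb R^+$, and it is implicit in the notation that it is defined at the values $p=\lambda\delta'(x)$ used. The probability weighting function $w:[0,1]\to[0,1]$ is differentiable and strictly increasing with $w(0)=0$, $w(1)=1$. The pricing kernel $\rho>0$ is a random variable with $\mathbf E[\rho]<\infty$, and it is atomless, meaning that its cumulative distribution function $F_\rho$ is continuous. The number $x_0>0$ is the initial endowment. The quantile function of a real random variable with distribution function $F$ is its right-continuous inverse $x\mapsto\sup\{t\in\mathbb R:F(t)\le x\}$, $x\in(0,1)$; $F_\rho^{-1}$ denotes the quantile function of $\rho$. $\mathcal G$ denotes the set of all functions $(0,1)\to\mathbb R^+$ that are increasing (in the weak sense) and right-continuous with left limits. Put $\nu(x):=1-w^{-1}(1-x)$, $x\in[0,1]$; $\nu$ is the inverse of $x\mapsto1-w(1-x)$ and is also differentiable and strictly increasing on $[0,1]$. Define $$\varphi(x):=-\int_x^1F_\rho^{-1}(1-\nu(y))\,\nu'(y)\,dy=-\int_0^{w^{-1}(1-x)}F_\rho^{-1}(y)\,dy,\qquad x\in[0,1],$$ so that $\varphi'(x)=F_\rho^{-1}(1-\nu(x))\,\nu'(x)$; $\varphi$ is differentiable and strictly increasing with $\varphi(0)=-\mathbf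 E[\rho]$ and $\varphi(1)=0$. $\delta'$ denotes the derivative of the concave function $\delta$, taken in its right-continuous version. An optimal solution is an admissible function attaining the supremum.
   Formalization: Added: the supremum is assumed finite in (1) and in (2), since uniqueness fails when it is +∞ (e.g. u=2√y, w=id, E[1/ρ]=∞); in (1) the objective integral at (u')^{-1}(λδ'(x)) is also assumed well defined (not ∞−∞). *)

theory Defs
  imports "HOL-Probability.Probability"
begin

(* Lebesgue integral over (0,1) with values in [-\<infinity>,\<infinity>]. If positive and negative part
   both have infinite integral, the value is -\<infinity> by convention, so that such functions never
   contribute to the supremum in a maximization problem. (Plain ereal subtraction would give
   \<infinity> - \<infinity> = \<infinity>.) *)

definition integral_defined :: "(real \<Rightarrow> ereal) \<Rightarrow> bool" where
  "integral_defined f \<longleftrightarrow>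
     (\<integral>\<^sup>+x\<in>{0<..<1}. e2ennreal (f x) \<partial>lborel) < \<infinity> \<or>
     (\<integral>\<^sup>+x\<in>{0<..<1}. e2ennreal (- f x) \<partial>lborel) < \<infinity>"

definition ext_integral :: "(real \<Rightarrow> ereal) \<Rightarrow> ereal" where
  "ext_integral f =
     (if integral_defined f
      then enn2ereal (\<integral>\<^sup>+x\<in>{0<..<1}. e2ennreal (f x) \<partial>lborel)
         - enn2ereal (\<integral>\<^sup>+x\<in>{0<..<1}. e2ennreal (- f x) \<partial>lborel)
      else -\<infinity>)"

definition optimal :: "'q set \<Rightarrow> ('q \<Rightarrow> ereal) \<Rightarrow> 'q \<Rightarrow> bool" where
  "optimal A J q \<longleftrightarrow> q \<in> A \<and> J q = (SUP r\<in>A. J r)"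

definition well_posed :: "'q set \<Rightarrow> ('q \<Rightarrow> ereal) \<Rightarrow> bool" where
  "well_posed A J \<longleftrightarrow> (SUP r\<in>A. J r) < \<infinity>"

(* A utility function is given by its values on (0,\<infinity>); its value at 0 is the limit from the
   right, which may be -\<infinity> (for example for ln). *)

definition util :: "(real \<Rightarrow> real) \<Rightarrow> real \<Rightarrow> ereal" where
  "util u y = (if y > 0 then ereal (u y) else Lim (at_right 0) (\<lambda>z. ereal (u z)))"

definition is_maximizer :: "(real \<Rightarrow> real) \<Rightarrow> real \<Rightarrow> real \<Rightarrow> bool" where
  "is_maximizer u p y \<longleftrightarrow>
     0 \<le> y \<and> (\<forall>z\<ge>0. util u z - ereal (p * z) \<le> util u y - ereal (p * y))"

(* The inverse of u', extended by 0 to prices p \<ge> u'(0+). By strict concavity there is at most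
   one maximizer; there is none if p is at most the limit of u' at infinity. *)

definition inv_marginal_defined :: "(real \<Rightarrow> real) \<Rightarrow> real \<Rightarrow> bool" where
  "inv_marginal_defined u p \<longleftrightarrow> (\<exists>y. is_maximizer u p y)"

definition inv_marginal :: "(real \<Rightarrow> real) \<Rightarrow> real \<Rightarrow> real" where
  "inv_marginal u p = (THE y. is_maximizer u p y)"

definition quantile :: "(real \<Rightarrow> real) \<Rightarrow> real \<Rightarrow> real" where
  "quantile F x = Sup {t. F t \<le> x}"

(* Elements of \<G> are functions on (0,1); their values outside (0,1) are irrelevant. *)

definition \<G> :: "(real \<Rightarrow> real) set" where
  "\<G> = {Q. (\<forall>x\<in>{0<..<1}. 0 \<le> Q x) \<and> mono_on {0<..<1} Q \<and>
           (\<forall>x\<in>{0<..<1}. continuous (at_right x) Q \<and> (\<exists>l. (Q \<longlongrightarrow> l) (at_left x)))}"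

definition \<nu> :: "(real \<Rightarrow> real) \<Rightarrow> real \<Rightarrow> real" where
  "\<nu> w x = 1 - inv_into {0..1} w (1 - x)"

(* F is the distribution function of the pricing kernel. phi' is the density in the definition
   of phi; it is the derivative of phi at almost every point, but not at points
   where the quantile function jumps. *)

definition phi' :: "(real \<Rightarrow> real) \<Rightarrow> (real \<Rightarrow> real) \<Rightarrow> real \<Rightarrow> real" where
  "phi' F w x = quantile F (1 - \<nu> w x) * deriv (\<nu> w) x"

definition phi :: "(real \<Rightarrow> real) \<Rightarrow> (real \<Rightarrow> real) \<Rightarrow> real \<Rightarrow> real" where
  "phi F w x = - (LBINT y:{x<..<1}. phi' F w y)"

(* a < b excludes only a = x = b, where the quotient is the undefined 0/0; the value f x is still
   attained, with a = x < b or a < x = b. *)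

definition concave_envelope :: "(real \<Rightarrow> real) \<Rightarrow> real \<Rightarrow> real" where
  "concave_envelope f x =
     Sup {((b - x) * f a + (x - a) * f b) / (b - a) | a b.
            0 \<le> a \<and> a \<le> x \<and> x \<le> b \<and> b \<le> 1 \<and> a < b}"

(* The right-continuous version of the derivative of a concave function is its right derivative. *)

definition delta' :: "(real \<Rightarrow> real) \<Rightarrow> (real \<Rightarrow> real) \<Rightarrow> real \<Rightarrow> real" where
  "delta' F w x = vector_derivative (concave_envelope (phi F w)) (at_right x)"

definition candidate ::
    "(real \<Rightarrow> real) \<Rightarrow> (real \<Rightarrow> real) \<Rightarrow> (real \<Rightarrow> real) \<Rightarrow> real \<Rightarrow> real \<Rightarrow> real" where
  "candidate u F w l x = inv_marginal u (l * delta' F w x)"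

definition candidate_defined ::
    "(real \<Rightarrow> real) \<Rightarrow> (real \<Rightarrow> real) \<Rightarrow> (real \<Rightarrow> real) \<Rightarrow> real \<Rightarrow> bool" where
  "candidate_defined u F w l \<longleftrightarrow> (\<forall>x\<in>{0<..<1}. inv_marginal_defined u (l * delta' F w x))"

definition penalized_integrand ::
    "(real \<Rightarrow> real) \<Rightarrow> (real \<Rightarrow> real) \<Rightarrow> (real \<Rightarrow> real) \<Rightarrow> real \<Rightarrow> (real \<Rightarrow> real) \<Rightarrow> real \<Rightarrow> ereal" where
  "penalized_integrand u F w l Q x = util u (Q x) - ereal (l * Q x * phi' F w x)"

definition penalized_objective ::
    "(real \<Rightarrow> real) \<Rightarrow> (real \<Rightarrow> real) \<Rightarrow> (real \<Rightarrow> real) \<Rightarrow> real \<Rightarrow> (real \<Rightarrow> real) \<Rightarrow> ereal" where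
  "penalized_objective u F w l Q = ext_integral (penalized_integrand u F w l Q)"

definition expected_utility :: "(real \<Rightarrow> real) \<Rightarrow> (real \<Rightarrow> real) \<Rightarrow> ereal" where
  "expected_utility u Q = ext_integral (\<lambda>x. util u (Q x))"

definition cost :: "(real \<Rightarrow> real) \<Rightarrow> (real \<Rightarrow> real) \<Rightarrow> (real \<Rightarrow> real) \<Rightarrow> ereal" where
  "cost F w Q = ext_integral (\<lambda>x. ereal (Q x * phi' F w x))"

definition \<Q> :: "(real \<Rightarrow> real) \<Rightarrow> (real \<Rightarrow> real) \<Rightarrow> real \<Rightarrow> (real \<Rightarrow> real) set" where
  "\<Q> F w x0 = {Q \<in> \<G>. cost F w Q = ereal x0}"

end

theory Submission
  imports Defs
begin

text \<open>
  Write \<open>\<psi>\<close> for the density of \<open>\<phi>\<close>, \<open>\<delta>\<close> for the concave envelope and \<open>D\<close> for its right derivative.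
  An increasing quantile \<open>Q\<close> is a superposition of indicators of up-sets of \<open>(0,1)\<close>, and the
  up-set starting at \<open>a\<close> has \<open>\<psi>\<close>-integral \<open>- \<phi>(a)\<close> and \<open>D\<close>-integral \<open>- \<delta>(a)\<close>. Hence
  \<open>\<integral>Q D \<le> \<integral>Q \<psi>\<close>, with equality if \<open>Q\<close> is a function of \<open>D\<close>, because then its level sets start
  at points where \<open>\<phi>\<close> and \<open>\<delta>\<close> touch. So \<open>\<psi>\<close> may be replaced by the decreasing function \<open>D\<close>, for
  which pointwise maximization of \<open>u(y) - \<lambda> D(x) y\<close> yields an increasing function of \<open>x\<close>. As \<open>Q \<psi>\<close>
  need not be integrable, the comparison passes through maximization over \<open>[0,m]\<close> with \<open>m \<rightarrow> \<infinity>\<close>.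
  Uniqueness follows from strict concavity of \<open>u\<close> at midpoints. For the budget problem, concavity of
  the value function provides a multiplier \<open>\<lambda>\<close>; comparing an optimal \<open>Q\<close> with the maximizers over
  \<open>[0,m]\<close> shows that \<open>Q(x)\<close> maximizes \<open>u(y) - \<lambda> D(x) y\<close> over all \<open>y \<ge> 0\<close>, first almost everywhere
  and then everywhere by right-continuity.
\<close>

text \<open>The right derivative \<open>D\<close> may jump, so its integral is matched with the
  increments of the envelope by comparing increments, not through the fundamental theorem of
  calculus. Contact is forced as follows: where the envelope lies strictly above \<phi>, compactness
  makes some chord attain it, and along that chord the envelope is affine. \<open>D\<close> is
  constant there, and so is every function of \<open>D\<close>, so no up-set of such a function can
  start there. The main obstacle is integrability. u(Q) - \<lambda> Q \<psi> can be integrable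
  although neither term is, so \<integral>Q D and \<integral>Q \<psi> are exchanged only for bounded
  quantiles: maximizers over [0,m], min Q n, and n times the indicator of {Q > n}. The last two
  remain functions of \<open>D\<close> if Q is one. Finiteness of the supremum bounds the truncated
  values uniformly, so by Fatou u(Q) - \<lambda> Q D is integrable for the pointwise maximizer Q.
  Passing back to \<psi> requires an integrable positive part of the true integrand; it comes from
  the hypothesis that its integral is defined.\<close>

section \<open>The concave envelope on the unit interval\<close>

text \<open>Over n + 1 equal pieces the bounds telescope to (p a - p b) * (b - a) / (n + 1), which
  tends to 0. With \<open>p = D\<close> this replaces differentiability, which may fail at the jumps
  of \<open>D\<close>.\<close>

lemma eq_of_increment_bound:
  fixes H p :: "real \<Rightarrow> real"
  assumes "a \<le> b"
    and bound: "\<And>x y. a \<le> x \<Longrightarrow> x < y \<Longrightarrow> y \<le> b \<Longrightarrow> \<bar>H y - H x\<bar> \<le> (p x - p y) * (y - x)"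
  shows "H a = H b"
proof (cases "a = b")
  case False
  with assms(1) have ab: "a < b" by simp
  have le: "\<bar>H b - H a\<bar> \<le> (p a - p b) * (b - a) * (1 / real (Suc n))" for n
  proof -
    define t where "t k = a + real k * ((b - a) / real (Suc n))" for k
    have t0: "t 0 = a" and tn: "t (Suc n) = b" unfolding t_def by (auto simp: field_simps)
    have step: "t (Suc k) - t k = (b - a) / real (Suc n)" for k
      unfolding t_def by (simp add: algebra_simps add_divide_distrib diff_divide_distrib)
    have pos: "(b - a) / real (Suc n) > 0" using ab by simp
    have mono: "t i \<le> t j" if "i \<le> j" for i j
      unfolding t_def using that pos by (intro add_left_mono mult_right_mono) auto
    have "\<bar>H b - H a\<bar> = \<bar>\<Sum>k<Suc n. H (t (Suc k)) - H (t k)\<bar>"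
      by (subst sum_lessThan_telescope) (simp add: t0 tn)
    also have "\<dots> \<le> (\<Sum>k<Suc n. \<bar>H (t (Suc k)) - H (t k)\<bar>)" by (rule sum_abs)
    also have "\<dots> \<le> (\<Sum>k<Suc n. (p (t k) - p (t (Suc k))) * ((b - a) / real (Suc n)))"
    proof (rule sum_mono)
      fix k assume k: "k \<in> {..<Suc n}"
      have "a \<le> t k" using mono[of 0 k] t0 by simp
      moreover have "t (Suc k) \<le> b" using mono[of "Suc k" "Suc n"] tn k by simp
      moreover have "t k < t (Suc k)" using step[of k] pos by linarith
      ultimately show "\<bar>H (t (Suc k)) - H (t k)\<bar> \<le> (p (t k) - p (t (Suc k))) * ((b - a) / real (Suc n))"
        using bound[of "t k" "t (Suc k)"] step[of k] by simp
    qed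
    also have "\<dots> = (\<Sum>k<Suc n. p (t k) - p (t (Suc k))) * ((b - a) / real (Suc n))"
      by (rule sum_distrib_right[symmetric])
    also have "(\<Sum>k<Suc n. p (t k) - p (t (Suc k))) = p a - p b"
      by (subst sum_lessThan_telescope') (simp add: t0 tn)
    finally show ?thesis by simp
  qed
  have "(\<lambda>n. (p a - p b) * (b - a) * (1 / real (Suc n))) \<longlonglongrightarrow> (p a - p b) * (b - a) * 0"
    by (intro tendsto_mult_left lim_inverse_n'[THEN LIMSEQ_Suc])
  then have "\<bar>H b - H a\<bar> \<le> 0"
    using LIMSEQ_le_const[of _ "(p a - p b) * (b - a) * 0" "\<bar>H b - H a\<bar>"] le by fastforce
  then show ?thesis by simp
qed simp

locale envelope =
  fixes \<phi> :: "real \<Rightarrow> real"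
  assumes cont: "continuous_on {0..1} \<phi>"
    and nonpos: "\<And>x. x \<in> {0..1} \<Longrightarrow> \<phi> x \<le> 0"
    and end_zero: "\<phi> 1 = 0"
begin

definition chord where "chord x a b = ((b - x) * \<phi> a + (x - a) * \<phi> b) / (b - a)"

abbreviation \<delta> where "\<delta> \<equiv> concave_envelope \<phi>"

definition slope where "slope x y = (\<delta> y - \<delta> x) / (y - x)"

definition D where "D x = (SUP y\<in>{x<..1}. slope x y)"

lemma chord_le_affine:
  assumes "0 \<le> a" "a \<le> x" "x \<le> b" "b \<le> 1" "a < b"
    and maj: "\<And>y. 0 \<le> y \<Longrightarrow> y \<le> 1 \<Longrightarrow> \<phi> y \<le> c + m * (y - z)"
  shows "chord x a b \<le> c + m * (x - z)"
proof -
  have "(b - x) * \<phi> a + (x - a) * \<phi> b \<le> (b - x) * (c + m * (a - z)) + (x - a) * (c + m * (b - z))"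
    using assms by (intro add_mono mult_left_mono maj) auto
  also have "\<dots> = (c + m * (x - z)) * (b - a)" by (simp add: algebra_simps)
  finally show ?thesis using assms by (simp add: chord_def pos_divide_le_eq)
qed

lemma env_def: "\<delta> x = Sup {chord x a b | a b. 0 \<le> a \<and> a \<le> x \<and> x \<le> b \<and> b \<le> 1 \<and> a < b}"
  unfolding concave_envelope_def chord_def ..

lemma chord_nonpos: "0 \<le> a \<Longrightarrow> a \<le> x \<Longrightarrow> x \<le> b \<Longrightarrow> b \<le> 1 \<Longrightarrow> a < b \<Longrightarrow> chord x a b \<le> 0"
  using chord_le_affine[of a x b 0 0 0] nonpos by simp

lemma chord_le_env:
  assumes "0 \<le> a" "a \<le> x" "x \<le> b" "b \<le> 1" "a < b"
  shows "chord x a b \<le> \<delta> x"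
  unfolding env_def using assms by (intro cSup_upper bdd_aboveI[where M = 0]) (auto intro: chord_nonpos)

lemma env_le:
  assumes "0 \<le> x" "x \<le> 1" "\<And>a b. 0 \<le> a \<Longrightarrow> a \<le> x \<Longrightarrow> x \<le> b \<Longrightarrow> b \<le> 1 \<Longrightarrow> a < b \<Longrightarrow> chord x a b \<le> c"
  shows "\<delta> x \<le> c"
proof -
  have "chord x 0 1 \<in> {chord x a b | a b. 0 \<le> a \<and> a \<le> x \<and> x \<le> b \<and> b \<le> 1 \<and> a < b}"
    using assms(1,2) by (intro CollectI exI[of _ 0] exI[of _ 1]) auto
  then show ?thesis unfolding env_def using assms(3) by (intro cSup_least) auto
qed

lemma env_le_affine:
  assumes "0 \<le> x" "x \<le> 1" "\<And>y. 0 \<le> y \<Longrightarrow> y \<le> 1 \<Longrightarrow> \<phi> y \<le> c + m * (y - z)"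
  shows "\<delta> x \<le> c + m * (x - z)"
  using assms by (intro env_le chord_le_affine) auto

lemma le_env:
  assumes "0 \<le> x" "x \<le> 1"
  shows "\<phi> x \<le> \<delta> x"
proof (cases "x < 1")
  case True
  then show ?thesis using chord_le_env[of x x 1] assms by (simp add: chord_def)
next
  case False
  then show ?thesis using chord_le_env[of 0 x x] assms by (simp add: chord_def)
qed

lemma env_nonpos: "0 \<le> x \<Longrightarrow> x \<le> 1 \<Longrightarrow> \<delta> x \<le> 0"
  by (intro env_le chord_nonpos) auto

lemma env_1: "\<delta> 1 = 0"
  using env_nonpos[of 1] le_env[of 1] end_zero by simp

lemma env_0: "\<delta> 0 = \<phi> 0"
proof (rule antisym)
  show "\<delta> 0 \<le> \<phi> 0"
  proof (rule env_le)
    fix a b :: real assume "0 \<le> a" "a \<le> 0" "a < b"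
    then have "a = 0" by simp
    then show "chord 0 a b \<le> \<phi> 0" using \<open>a < b\<close> by (simp add: chord_def)
  qed auto
qed (rule le_env, auto)

text \<open>The chord condition at \<open>z\<close> separates the slopes to the left from those to the right.\<close>

lemma supporting_line:
  assumes z: "0 < z" "z < 1"
  obtains m where "\<And>y. 0 \<le> y \<Longrightarrow> y \<le> 1 \<Longrightarrow> \<phi> y \<le> \<delta> z + m * (y - z)"
    and "\<And>y. 0 \<le> y \<Longrightarrow> y \<le> 1 \<Longrightarrow> \<delta> y \<le> \<delta> z + m * (y - z)"
proof -
  define R where "R = (\<lambda>b. (\<phi> b - \<delta> z) / (b - z)) ` {z<..1}"
  have cross: "(\<phi> b - \<delta> z) / (b - z) \<le> (\<delta> z - \<phi> a) / (z - a)" if "0 \<le> a" "a < z" "z < b" "b \<le> 1" for a b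
  proof -
    have "chord z a b \<le> \<delta> z" using that by (intro chord_le_env) auto
    then have "(b - z) * \<phi> a + (z - a) * \<phi> b \<le> \<delta> z * (b - a)"
      using that by (simp add: chord_def pos_divide_le_eq)
    then show ?thesis using that by (simp add: frac_le_eq divide_le_0_iff) (simp add: algebra_simps)
  qed
  have ne: "R \<noteq> {}" unfolding R_def using z by auto
  have bdd: "bdd_above R" unfolding R_def using cross[of 0] z by (auto intro!: bdd_aboveI)
  define m where "m = Sup R"
  have maj: "\<phi> y \<le> \<delta> z + m * (y - z)" if y: "0 \<le> y" "y \<le> 1" for y
  proof (cases y z rule: linorder_cases)
    case less
    have "m \<le> (\<delta> z - \<phi> y) / (z - y)"
      unfolding m_def using ne cross[of y] y less by (intro cSup_least) (auto simp: R_def)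
    then show ?thesis using less by (simp add: pos_le_divide_eq algebra_simps)
  next
    case greater
    have "(\<phi> y - \<delta> z) / (y - z) \<le> m"
      unfolding m_def using bdd greater y by (intro cSup_upper) (auto simp: R_def)
    then show ?thesis using greater by (simp add: pos_divide_le_eq algebra_simps)
  qed (use le_env y in auto)
  show ?thesis using that[OF maj env_le_affine[OF _ _ maj]] by blast
qed

text \<open>The supporting line at the middle point separates the slopes: its slope \<open>m\<close>
  is at most that of the left chord and at least that of the right chord. The three comparisons are
  rearrangements of the resulting inequality.\<close>

lemma slope_antimono:
  assumes "0 \<le> x" "x < y" "y < z" "z \<le> 1"
  shows "slope x z \<le> slope x y" "slope y z \<le> slope x z" "slope y z \<le> slope x y"
proof -
  obtain m where m: "\<And>t. 0 \<le> t \<Longrightarrow> t \<le> 1 \<Longrightarrow> \<delta> t \<le> \<delta> y + m * (t - y)"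
    by (rule supporting_line[of y]) (use assms in auto)
  have 1: "m * (y - x) \<le> \<delta> y - \<delta> x" and 2: "\<delta> z - \<delta> y \<le> m * (z - y)"
    using m[of x] m[of z] assms by (auto simp: algebra_simps)
  have a: "(\<delta> z - \<delta> y) * (y - x) \<le> m * (z - y) * (y - x)"
    using 2 assms by (intro mult_right_mono) auto
  have b: "m * (y - x) * (z - y) \<le> (\<delta> y - \<delta> x) * (z - y)"
    using 1 assms by (intro mult_right_mono) auto
  have "(\<delta> z - \<delta> y) * (y - x) \<le> (\<delta> y - \<delta> x) * (z - y)"
    using a b by (simp add: algebra_simps)
  then show "slope x z \<le> slope x y" "slope y z \<le> slope x z" "slope y z \<le> slope x y"
    using assms by (simp_all add: slope_def divide_le_eq pos_le_divide_eq) (simp_all add: algebra_simps)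
qed

text \<open>For x > 0 the slope from 0 to x bounds all slopes to the right of x. At 0 itself no such
  bound is available: the envelope may have a vertical tangent.\<close>

lemma
  assumes "0 < x" "x < y" "y \<le> 1"
  shows slope_le_D: "slope x y \<le> D x" and bdd_slope: "bdd_above (slope x ` {x<..1})"
proof -
  show b: "bdd_above (slope x ` {x<..1})"
    using slope_antimono(3)[of 0 x] assms by (auto intro!: bdd_aboveI[where M = "slope 0 x"])
  show "slope x y \<le> D x" unfolding D_def using assms b by (intro cSUP_upper) auto
qed

lemma D_le_slope:
  assumes "0 \<le> x" "x < y" "y < 1"
  shows "D y \<le> slope x y"
  unfolding D_def using slope_antimono(3)[of x y] assms by (intro cSUP_least) auto

lemma D_antimono: "0 < x \<Longrightarrow> x \<le> y \<Longrightarrow> y < 1 \<Longrightarrow> D y \<le> D x"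
  using D_le_slope[of x y] slope_le_D[of x y] by (cases "x = y") auto

lemma D_nonneg: "0 < x \<Longrightarrow> x < 1 \<Longrightarrow> 0 \<le> D x"
  using slope_le_D[of x 1] env_nonpos[of x] env_1 divide_nonpos_pos[of "\<delta> x" "1 - x"] by (simp add: slope_def)

lemma D_bounds:
  assumes "0 < x" "x < y" "y < 1"
  shows "D y * (y - x) \<le> \<delta> y - \<delta> x" "\<delta> y - \<delta> x \<le> D x * (y - x)"
  using D_le_slope[of x y] slope_le_D[of x y] assms
  by (auto simp: slope_def pos_le_divide_eq pos_divide_le_eq)

text \<open>Slopes from x grow as the right end decreases to x, so their limit is their
  supremum.\<close>

lemma slope_tendsto_D:
  assumes "0 < x" "x < 1"
  shows "(slope x \<longlongrightarrow> D x) (at_right x)"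
proof (rule order_tendstoI)
  fix a assume "a < D x"
  then obtain y where y: "x < y" "y \<le> 1" "a < slope x y"
    unfolding D_def using less_cSUP_iff[OF _ bdd_slope[of x 1]] assms by auto
  have "\<forall>\<^sub>F t in at_right x. t \<in> {x<..<y}" using y by (intro eventually_at_right_real) auto
  then show "\<forall>\<^sub>F t in at_right x. a < slope x t"
    by eventually_elim (use slope_antimono(1)[of x _ y] y assms in fastforce)
next
  fix a assume "D x < a"
  have "\<forall>\<^sub>F t in at_right x. t \<in> {x<..<1}" using assms by (intro eventually_at_right_real) auto
  then show "\<forall>\<^sub>F t in at_right x. slope x t < a"
    by eventually_elim (use slope_le_D[of x] \<open>D x < a\<close> assms in fastforce)
qed

lemma right_derivative_eq:
  assumes "0 < x" "x < 1"
  shows "vector_derivative \<delta> (at_right x) = D x"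
proof (rule vector_derivative_within)
  show "(\<delta> has_vector_derivative D x) (at_right x)"
    unfolding has_real_derivative_iff_has_vector_derivative[symmetric] has_field_derivative_iff
    using slope_tendsto_D[OF assms] unfolding slope_def .
qed simp

text \<open>Continuity from convexity works on the open interval; the ends are left to
  \<open>env_tendsto_0\<close> and \<open>env_tendsto_1\<close>, which use the continuity of
  \<phi>.\<close>

lemma env_continuous_at:
  assumes "0 < x" "x < 1"
  shows "isCont \<delta> x"
proof -
  have "convex_on {0<..<1} (\<lambda>x. - \<delta> x)"
  proof (rule convex_onI)
    fix t x y :: real assume t: "0 < t" "t < 1" and xy: "x \<in> {0<..<1}" "y \<in> {0<..<1}"
    let ?z = "(1 - t) *\<^sub>R x + t *\<^sub>R y"
    have z: "?z \<in> {0<..<1}" using convexD[OF convex_real_interval(8)[of 0 1], of x y "1-t" t] xy t by simp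
    obtain m where m: "\<And>s. 0 \<le> s \<Longrightarrow> s \<le> 1 \<Longrightarrow> \<delta> s \<le> \<delta> ?z + m * (s - ?z)"
      by (rule supporting_line[of ?z]) (use z in auto)
    have "(1 - t) * \<delta> x + t * \<delta> y \<le> (1 - t) * (\<delta> ?z + m * (x - ?z)) + t * (\<delta> ?z + m * (y - ?z))"
      using m[of x] m[of y] t xy by (intro add_mono mult_left_mono) auto
    also have "\<dots> = \<delta> ?z" by (simp add: algebra_simps)
    finally show "- \<delta> ?z \<le> (1 - t) * - \<delta> x + t * - \<delta> y" by simp
  qed simp
  then have "continuous_on {0<..<1} (\<lambda>x. - \<delta> x)" by (rule convex_on_continuous[rotated]) simp
  from continuous_on_minus[OF this] have "continuous_on {0<..<1} \<delta>" by simp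
  then show ?thesis using assms by (auto simp: continuous_on_eq_continuous_at)
qed

lemma D_right_continuous:
  assumes "0 < x" "x < 1"
  shows "(D \<longlongrightarrow> D x) (at_right x)"
proof (rule order_tendstoI)
  fix a assume "a < D x"
  then obtain y where y: "x < y" "y \<le> 1" "a < slope x y"
    unfolding D_def using less_cSUP_iff[OF _ bdd_slope[of x 1]] assms by auto
  \<comment> \<open>The right end y stays fixed while the base point t moves: by continuity
    \<open>slope t y\<close> still exceeds a, and it is at most \<open>D t\<close>.\<close>
  have "((\<lambda>t. slope t y) \<longlongrightarrow> slope x y) (at x)"
    unfolding slope_def using env_continuous_at[OF assms] y
    by (intro tendsto_intros) (auto simp: isCont_def)
  then have "\<forall>\<^sub>F t in at x. a < slope t y" using y by (intro order_tendstoD)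
  then have "\<forall>\<^sub>F t in at_right x. a < slope t y" using filter_leD[OF at_le[of "{x<..}" UNIV x]] by auto
  moreover have "\<forall>\<^sub>F t in at_right x. t \<in> {x<..<y}" using y by (intro eventually_at_right_real) auto
  ultimately show "\<forall>\<^sub>F t in at_right x. a < D t"
  proof eventually_elim
    case (elim t)
    with slope_le_D[of t y] y assms show ?case by auto
  qed
next
  fix a assume "D x < a"
  have "\<forall>\<^sub>F t in at_right x. t \<in> {x<..<1}" using assms by (intro eventually_at_right_real) auto
  then show "\<forall>\<^sub>F t in at_right x. D t < a"
  proof eventually_elim
    case (elim t)
    with D_antimono[of x t] \<open>D x < a\<close> assms show ?case by auto
  qed
qed

lemma env_tendsto_1: "(\<delta> \<longlongrightarrow> 0) (at_left 1)"
proof (rule tendsto_sandwich)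
  have "(\<phi> \<longlongrightarrow> \<phi> 1) (at 1 within {0..1})" using cont by (auto simp: continuous_on)
  then show "(\<phi> \<longlongrightarrow> 0) (at_left 1)" by (simp add: at_within_Icc_at_left end_zero)
  have ev: "\<forall>\<^sub>F x::real in at_left 1. x \<in> {0<..<1}" by (intro eventually_at_left_real) simp
  show "\<forall>\<^sub>F x in at_left 1. \<phi> x \<le> \<delta> x" "\<forall>\<^sub>F x in at_left 1. \<delta> x \<le> 0"
    using ev by (eventually_elim, auto intro: le_env env_nonpos)+
qed simp

lemma env_tendsto_0: "(\<delta> \<longlongrightarrow> \<delta> 0) (at_right 0)"
proof (rule order_tendstoI)
  have ev: "\<forall>\<^sub>F x::real in at_right 0. x \<in> {0<..<1}" by (intro eventually_at_right_real) simp
  have "(\<phi> \<longlongrightarrow> \<phi> 0) (at 0 within {0..1})" using cont by (auto simp: continuous_on)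
  then have lim: "(\<phi> \<longlongrightarrow> \<phi> 0) (at_right 0)" by (simp add: at_within_Icc_at_right)
  {
    fix a assume "a < \<delta> 0"
    then have "\<forall>\<^sub>F x in at_right 0. a < \<phi> x" using order_tendstoD(1)[OF lim] env_0 by simp
    with ev show "\<forall>\<^sub>F x in at_right 0. a < \<delta> x"
    proof eventually_elim
      case (elim x)
      with le_env[of x] show ?case by auto
    qed
  next
    fix a assume "\<delta> 0 < a"
    define e where "e = (a - \<phi> 0) / 2"
    have e: "e > 0" "\<phi> 0 + e < a" using \<open>\<delta> 0 < a\<close> env_0 by (auto simp: e_def field_simps)
    have "\<forall>\<^sub>F x in at_right 0. \<phi> x < \<phi> 0 + e" using order_tendstoD(2)[OF lim] e by simp
    then obtain b where b: "b > 0" "\<And>y. 0 < y \<Longrightarrow> y < b \<Longrightarrow> \<phi> y < \<phi> 0 + e"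
      unfolding eventually_at_right_field by auto
    \<comment> \<open>This slope lifts the line to e at b, hence above the nonpositive \<phi> on
      [b,1]; to the left of b the constant part \<phi> 0 + e already suffices.\<close>
    define K where "K = - \<phi> 0 / b"
    have K: "K \<ge> 0" using nonpos[of 0] b by (simp add: K_def divide_nonpos_pos)
    have maj: "\<phi> y \<le> (\<phi> 0 + e) + K * (y - 0)" if "0 \<le> y" "y \<le> 1" for y
    proof (cases "y < b")
      case True
      then have "\<phi> y \<le> \<phi> 0 + e" using b(2)[of y] e that by (cases "y = 0") auto
      then show ?thesis using K that by (simp add: add_increasing2)
    next
      case False
      then have "K * b \<le> K * y" using K by (intro mult_left_mono) auto
      then show ?thesis using nonpos[of y] that b(1) e by (simp add: K_def)
    qed
    have "((\<lambda>x. (\<phi> 0 + e) + K * (x - 0)) \<longlongrightarrow> (\<phi> 0 + e) + K * (0 - 0)) (at_right 0)"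
      by (intro tendsto_intros)
    then have "\<forall>\<^sub>F x in at_right 0. (\<phi> 0 + e) + K * (x - 0) < a"
      using e by (intro order_tendstoD) auto
    with ev show "\<forall>\<^sub>F x in at_right 0. \<delta> x < a"
    proof eventually_elim
      case (elim x)
      with env_le_affine[OF _ _ maj, of x] show ?case by auto
    qed
  }
qed

text \<open>A strict gap at z forces the supremum defining \<delta> z to be attained by a chord with
  ends on both sides of z. The supporting line at z passes through both ends of that chord, so the
  envelope coincides with it in between and \<open>D\<close> is constant.\<close>

lemma env_affine_near:
  assumes z: "0 < z" "z < 1" and gap: "\<phi> z < \<delta> z"
  obtains a b where "0 \<le> a" "a < z" "z < b" "b \<le> 1" "\<And>x. a < x \<Longrightarrow> x < b \<Longrightarrow> D x = D z"
proof -
  have "isCont \<phi> z" using cont z by (simp add: continuous_on_interior)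
  then have "(\<phi> \<longlongrightarrow> \<phi> z) (at z)" by (simp add: isCont_def)
  then have "\<forall>\<^sub>F x in at z. \<phi> x < (\<phi> z + \<delta> z) / 2" using gap by (intro order_tendstoD) auto
  then obtain e where e: "e > 0" and near': "\<And>x. x \<noteq> z \<Longrightarrow> dist x z < e \<Longrightarrow> \<phi> x < (\<phi> z + \<delta> z) / 2"
    unfolding eventually_at by auto
  have near: "\<phi> x < (\<phi> z + \<delta> z) / 2" if "\<bar>x - z\<bar> < e" for x
    using near'[of x] that gap by (cases "x = z") (auto simp: dist_real_def)
  \<comment> \<open>Chords shorter than e are cut off so that the denominator stays away from 0 and
    the set of pairs is compact. Nothing is lost: short chords have both ends near z and stay below
    the mean of \<phi> z and \<delta> z.\<close>
  define K where "K = {p \<in> {0..z} \<times> {z..1}. e \<le> snd p - fst p}"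
  have small: "chord z a b \<le> (\<phi> z + \<delta> z) / 2" if "a \<le> z" "z \<le> b" "a < b" "b - a < e" for a b
  proof -
    have "\<phi> a \<le> (\<phi> z + \<delta> z) / 2" "\<phi> b \<le> (\<phi> z + \<delta> z) / 2"
      using near[of a] near[of b] that by auto
    then have "(b - z) * \<phi> a + (z - a) * \<phi> b \<le> (b - z) * ((\<phi> z + \<delta> z) / 2) + (z - a) * ((\<phi> z + \<delta> z) / 2)"
      using that by (intro add_mono mult_left_mono) auto
    moreover have "(b - z) * c + (z - a) * c = c * (b - a)" for c by (simp add: algebra_simps)
    ultimately have "(b - z) * \<phi> a + (z - a) * \<phi> b \<le> ((\<phi> z + \<delta> z) / 2) * (b - a)" by metis
    then show ?thesis using that by (simp add: chord_def pos_divide_le_eq)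
  qed
  have "K = ({0..z} \<times> {z..1}) \<inter> {p. e \<le> snd p - fst p}" unfolding K_def by auto
  moreover have "closed {p :: real \<times> real. e \<le> snd p - fst p}"
    by (intro closed_Collect_le continuous_intros)
  ultimately have comp: "compact K" by (simp add: compact_Times compact_Int_closed)
  have ne: "K \<noteq> {}"
  proof
    assume "K = {}"
    have "\<delta> z \<le> (\<phi> z + \<delta> z) / 2"
    proof (rule env_le)
      fix a b assume ab: "0 \<le> a" "a \<le> z" "z \<le> b" "b \<le> 1" "a < b"
      then have "(a, b) \<notin> K" using \<open>K = {}\<close> by simp
      then show "chord z a b \<le> (\<phi> z + \<delta> z) / 2" using ab by (intro small) (auto simp: K_def)
    qed (use z in auto)
    then show False using gap by simp
  qed
  have "continuous_on K (\<lambda>p. chord z (fst p) (snd p))"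
    unfolding chord_def
    by (intro continuous_intros continuous_on_compose2[OF cont]) (use z e in \<open>auto simp: K_def\<close>)
  from continuous_attains_sup[OF comp ne this] obtain a b where ab: "(a, b) \<in> K"
    and sup: "\<And>a' b'. (a', b') \<in> K \<Longrightarrow> chord z a' b' \<le> chord z a b" by fastforce
  from ab e have ab': "0 \<le> a" "a \<le> z" "z \<le> b" "b \<le> 1" "a < b" by (auto simp: K_def)
  have "\<delta> z \<le> max (chord z a b) ((\<phi> z + \<delta> z) / 2)"
  proof (rule env_le)
    fix a' b' assume *: "0 \<le> a'" "a' \<le> z" "z \<le> b'" "b' \<le> 1" "a' < b'"
    show "chord z a' b' \<le> max (chord z a b) ((\<phi> z + \<delta> z) / 2)"
    proof (cases "(a', b') \<in> K")
      case False
      with * have "b' - a' < e" by (auto simp: K_def)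
      with small[of a' b'] * show ?thesis by linarith
    qed (use sup[of a' b'] in linarith)
  qed (use z in auto)
  with gap chord_le_env[OF ab'] have ch: "chord z a b = \<delta> z" by (auto simp: max_def split: if_splits)
  have "a \<noteq> z" "z \<noteq> b" using ch gap ab' by (auto simp: chord_def)
  with ab' have str: "a < z" "z < b" by auto
  obtain m where m\<phi>: "\<And>y. 0 \<le> y \<Longrightarrow> y \<le> 1 \<Longrightarrow> \<phi> y \<le> \<delta> z + m * (y - z)"
    and m\<delta>: "\<And>y. 0 \<le> y \<Longrightarrow> y \<le> 1 \<Longrightarrow> \<delta> y \<le> \<delta> z + m * (y - z)"
    using supporting_line[OF z] by blast
  have \<phi>ab: "\<phi> a \<le> \<delta> z + m * (a - z)" "\<phi> b \<le> \<delta> z + m * (b - z)" using m\<phi> ab' by auto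
  have "(b - z) * \<phi> a + (z - a) * \<phi> b = \<delta> z * (b - a)"
    using ch ab' by (simp add: chord_def field_simps)
  \<comment> \<open>Both brackets are nonnegative gaps below the supporting line, taken with
    positive weights; as the weighted sum vanishes, both ends lie on the line.\<close>
  then have sum0: "(b - z) * ((\<delta> z + m * (a - z)) - \<phi> a) + (z - a) * ((\<delta> z + m * (b - z)) - \<phi> b) = 0"
    by (simp add: algebra_simps)
  have "(b - z) * ((\<delta> z + m * (a - z)) - \<phi> a) \<ge> 0" "(z - a) * ((\<delta> z + m * (b - z)) - \<phi> b) \<ge> 0"
    using \<phi>ab str by auto
  with sum0 have "(b - z) * ((\<delta> z + m * (a - z)) - \<phi> a) = 0" "(z - a) * ((\<delta> z + m * (b - z)) - \<phi> b) = 0"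
    by linarith+
  then have eqs: "\<phi> a = \<delta> z + m * (a - z)" "\<phi> b = \<delta> z + m * (b - z)"
    using str unfolding mult_eq_0_iff by linarith+
  have \<delta>eq: "\<delta> y = \<delta> z + m * (y - z)" if y: "a \<le> y" "y \<le> b" for y
  proof (rule antisym)
    show "\<delta> y \<le> \<delta> z + m * (y - z)" using m\<delta> y ab' by auto
    have "chord y a b = \<delta> z + m * (y - z)"
      unfolding chord_def eqs using ab' by (simp add: field_simps)
    then show "\<delta> z + m * (y - z) \<le> \<delta> y" using chord_le_env[of a y b] y ab' by simp
  qed
  have "D x = m" if x: "a < x" "x < b" for x
  proof (rule tendsto_unique[OF _ slope_tendsto_D])
    show "(slope x \<longlongrightarrow> m) (at_right x)"
    proof (rule tendsto_eventually)
      have "\<forall>\<^sub>F t in at_right x. t \<in> {x<..<b}" using x by (intro eventually_at_right_real) auto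
      then show "\<forall>\<^sub>F t in at_right x. slope x t = m"
        by eventually_elim (use x in \<open>auto simp: slope_def \<delta>eq field_simps\<close>)
    qed
  qed (use x ab' in auto)
  with str ab' show ?thesis by (intro that[of a b]) auto
qed

end

section \<open>Pairing quantiles with the envelope\<close>

abbreviation L :: "real measure" where "L \<equiv> restrict_space lborel {0<..<1}"

lemma space_L: "space L = {0<..<1}"
  by (simp add: space_restrict_space)

lemma sets_L: "sets L = sets (restrict_space borel {0<..<1})"
  by (simp add: sets_restrict_space)

interpretation L: prob_space L
  by (auto simp: emeasure_restrict_space space_restrict_space intro!: prob_spaceI)

lemma measurable_L_mono:
  fixes f :: "real \<Rightarrow> real"
  shows "mono_on {0<..<1} f \<Longrightarrow> f \<in> borel_measurable L"
  using borel_measurable_mono_on_fnc[of "{0<..<1}" f] measurable_cong_sets[OF sets_L refl] by auto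

lemma nn_integral_L: "(\<integral>\<^sup>+x\<in>{0<..<1}. f x \<partial>lborel) = (\<integral>\<^sup>+x. f x \<partial>L)"
  by (subst nn_integral_restrict_space) auto

lemma indicator_measurable_L:
  "A \<in> sets borel \<Longrightarrow> (indicator A :: real \<Rightarrow> real) \<in> borel_measurable L"
  "A \<in> sets borel \<Longrightarrow> (indicator A :: real \<Rightarrow> ennreal) \<in> borel_measurable L"
  by (auto intro: measurable_restrict_space1)

lemma AE_L_neq: "AE x in L. x \<noteq> (a :: real)"
  using AE_lborel_singleton[of a] by (subst AE_restrict_space_iff) auto

lemma AE_L_space: "AE x in L. x \<in> {0<..<1}"
  using AE_space[of L] by (simp add: space_L)

text \<open>Q x is the length of the interval (0, Q x), and Tonelli exchanges the integrals. In
  \<open>ennreal\<close> no integrability is required; a negative Q x counts as 0 on both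
  sides.\<close>

lemma nn_integral_layer_cake:
  assumes Q: "Q \<in> borel_measurable L" and g: "g \<in> borel_measurable L"
  shows "(\<integral>\<^sup>+x. ennreal (Q x) * g x \<partial>L)
    = (\<integral>\<^sup>+t. (\<integral>\<^sup>+x. indicator {x \<in> {0<..<1}. t < Q x} x * g x \<partial>L) * indicator {0<..} t \<partial>lborel)"
proof -
  interpret pair_sigma_finite L "lborel :: real measure"
    by unfold_locales
  have "(\<integral>\<^sup>+x. ennreal (Q x) * g x \<partial>L) = (\<integral>\<^sup>+x. (\<integral>\<^sup>+t. (if 0 < t \<and> t < Q x then g x else 0) \<partial>lborel) \<partial>L)"
  proof (rule nn_integral_cong)
    fix x
    have "(\<integral>\<^sup>+t. (if 0 < t \<and> t < Q x then g x else 0) \<partial>lborel) = (\<integral>\<^sup>+t. g x * indicator {0<..<Q x} t \<partial>lborel)"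
      by (intro nn_integral_cong) (auto split: split_indicator)
    also have "\<dots> = g x * emeasure lborel {0<..<Q x}" by (rule nn_integral_cmult_indicator) simp
    also have "emeasure lborel {0<..<Q x} = ennreal (Q x)"
      by (cases "0 \<le> Q x") (auto simp: ennreal_neg)
    finally show "ennreal (Q x) * g x = (\<integral>\<^sup>+t. (if 0 < t \<and> t < Q x then g x else 0) \<partial>lborel)"
      by (simp add: mult.commute)
  qed
  also have "\<dots> = (\<integral>\<^sup>+t. (\<integral>\<^sup>+x. (if 0 < t \<and> t < Q x then g x else 0) \<partial>L) \<partial>lborel)"
  proof (rule Fubini'[symmetric])
    note [measurable] = Q g
    show "(\<lambda>(x, t). if 0 < t \<and> t < Q x then g x else 0) \<in> borel_measurable (L \<Otimes>\<^sub>M lborel)"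
      by measurable
  qed
  also have "\<dots> = (\<integral>\<^sup>+t. (\<integral>\<^sup>+x. indicator {x \<in> {0<..<1}. t < Q x} x * g x \<partial>L) * indicator {0<..} t \<partial>lborel)"
  proof (rule nn_integral_cong)
    fix t :: real
    show "(\<integral>\<^sup>+x. (if 0 < t \<and> t < Q x then g x else 0) \<partial>L)
      = (\<integral>\<^sup>+x. indicator {x \<in> {0<..<1}. t < Q x} x * g x \<partial>L) * indicator {0<..} t"
      by (cases "0 < t") (auto intro!: nn_integral_cong simp: space_L split: split_indicator)
  qed
  finally show ?thesis .
qed

text \<open>An up-set of (0,1) is an interval that starts at its infimum; only membership of that
  single point is undetermined, hence the almost-everywhere form.\<close>

lemma upset_AE_eq:
  assumes U: "U \<subseteq> {0<..<1::real}" "U \<noteq> {}" and up: "\<And>x y. x \<in> U \<Longrightarrow> x \<le> y \<Longrightarrow> y < 1 \<Longrightarrow> y \<in> U"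
  shows "0 \<le> Inf U" "Inf U < 1" "AE x in L. x \<in> U \<longleftrightarrow> Inf U < x"
    "\<And>b. Inf U < b \<Longrightarrow> \<exists>u\<in>U. u < b"
proof -
  have bdd: "bdd_below U" using U by (force intro!: bdd_belowI[where m = 0])
  show "0 \<le> Inf U" using U by (intro cInf_greatest) auto
  obtain u where "u \<in> U" using U(2) by auto
  then show "Inf U < 1" using U(1) cInf_lower[OF _ bdd, of u] by auto
  show ex: "\<exists>u\<in>U. u < b" if "Inf U < b" for b using that cInf_less_iff[OF U(2) bdd] by auto
  show "AE x in L. x \<in> U \<longleftrightarrow> Inf U < x"
    using AE_L_neq[of "Inf U"] AE_L_space
  proof eventually_elim
    case (elim x)
    show ?case
    proof
      assume "x \<in> U" then show "Inf U < x" using cInf_lower[OF _ bdd, of x] elim by simp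
    next
      assume "Inf U < x" then show "x \<in> U" using ex[of x] up[of _ x] elim by (meson greaterThanLessThan_iff less_imp_le)
    qed
  qed
qed

section \<open>Price densities and the envelope of their primitive\<close>

locale pricing =
  fixes \<psi> :: "real \<Rightarrow> real"
  assumes psi_int: "integrable L \<psi>"
    and psi_nonneg: "\<And>x. 0 < x \<Longrightarrow> x < 1 \<Longrightarrow> 0 \<le> \<psi> x"
    and psi_pos: "0 < (\<integral>x. \<psi> x \<partial>L)"
begin

definition \<Phi> where "\<Phi> x = - (LBINT y:{x<..<1}. \<psi> y)"

lemma psi_meas: "\<psi> \<in> borel_measurable L" using psi_int by simp

lemma psi_cut_int: "integrable L (\<lambda>y. indicator {x<..} y * \<psi> y)"
proof (rule Bochner_Integration.integrable_bound[OF psi_int])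
  show "(\<lambda>y. indicator {x<..} y * \<psi> y) \<in> borel_measurable L"
    using psi_meas by (intro borel_measurable_times indicator_measurable_L) auto
qed (auto split: split_indicator)

lemma \<Phi>_eq: "0 \<le> x \<Longrightarrow> \<Phi> x = - (\<integral>y. indicator {x<..} y * \<psi> y \<partial>L)"
  unfolding \<Phi>_def set_lebesgue_integral_def
  by (subst integral_restrict_space) (auto intro!: Bochner_Integration.integral_cong split: split_indicator)

lemma \<Phi>_continuous: "continuous_on {0..1} \<Phi>"
proof (rule continuous_on_sequentiallyI)
  fix X :: "nat \<Rightarrow> real" and a assume X: "\<forall>n. X n \<in> {0..1}" and a: "a \<in> {0..1}" and lim: "X \<longlonglongrightarrow> a"
  have "(\<lambda>n. \<integral>y. indicator {X n<..} y * \<psi> y \<partial>L) \<longlonglongrightarrow> (\<integral>y. indicator {a<..} y * \<psi> y \<partial>L)"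
  proof (rule integral_dominated_convergence[where w = "\<lambda>y. \<bar>\<psi> y\<bar>"])
    show "AE y in L. (\<lambda>n. indicator {X n<..} y * \<psi> y) \<longlonglongrightarrow> indicator {a<..} y * \<psi> y"
      using AE_L_neq[of a]
    proof eventually_elim
      case (elim y)
      have "\<forall>\<^sub>F n in sequentially. indicator {X n<..} y = (indicator {a<..} y :: real)"
      proof (cases "y < a")
        case True
        show ?thesis using order_tendstoD(1)[OF lim True]
        proof eventually_elim
          case (elim n)
          with True show ?case by simp
        qed
      next
        case False
        with elim have "a < y" by simp
        show ?thesis using order_tendstoD(2)[OF lim \<open>a < y\<close>]
        proof eventually_elim
          case (elim n)
          with \<open>a < y\<close> show ?case by simp
        qed
      qed
      then show ?case by (intro tendsto_mult_right tendsto_eventually)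
    qed
  qed (use psi_cut_int psi_int in \<open>auto split: split_indicator\<close>)
  then show "(\<lambda>n. \<Phi> (X n)) \<longlonglongrightarrow> \<Phi> a" using X a by (simp add: \<Phi>_eq tendsto_minus)
qed

lemma \<Phi>_nonpos: "x \<in> {0..1} \<Longrightarrow> \<Phi> x \<le> 0"
  using psi_nonneg by (auto simp: \<Phi>_eq space_L intro!: Bochner_Integration.integral_nonneg mult_nonneg_nonneg)

lemma \<Phi>_1: "\<Phi> 1 = 0"
  unfolding \<Phi>_def by (simp add: set_lebesgue_integral_def)

sublocale envelope \<Phi>
  by unfold_locales (use \<Phi>_continuous \<Phi>_nonpos \<Phi>_1 in auto)

lemma nn_integral_psi_cut:
  assumes "0 \<le> x" "x \<le> 1"
  shows "(\<integral>\<^sup>+y. indicator {x<..} y * ennreal (\<psi> y) \<partial>L) = ennreal (- \<Phi> x)"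
proof -
  have "(\<integral>\<^sup>+y. indicator {x<..} y * ennreal (\<psi> y) \<partial>L) = (\<integral>\<^sup>+y. ennreal (indicator {x<..} y * \<psi> y) \<partial>L)"
    by (intro nn_integral_cong) (auto split: split_indicator)
  also have "\<dots> = ennreal (\<integral>y. indicator {x<..} y * \<psi> y \<partial>L)"
    using psi_nonneg by (intro nn_integral_eq_integral psi_cut_int AE_I2) (auto simp: space_L)
  finally show ?thesis using assms by (simp add: \<Phi>_eq)
qed

lemma D_measurable: "D \<in> borel_measurable L"
proof -
  have "mono_on {0<..<1} (\<lambda>x. - D x)" by (auto intro!: mono_onI D_antimono)
  from borel_measurable_uminus[OF measurable_L_mono[OF this]] show ?thesis by simp
qed

text \<open>On [x,y] the integral of \<open>D\<close> and the increment of \<delta> both lie between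
  D y * (y - x) and D x * (y - x). Hence their difference satisfies
  \<open>eq_of_increment_bound\<close>. Staying off the ends keeps \<open>D\<close> bounded.\<close>

lemma D_integral_interior:
  assumes "0 < a" "a < b" "b < 1"
  shows "(\<integral>\<^sup>+y. indicator {a..<b} y * ennreal (D y) \<partial>L) = ennreal (\<delta> b - \<delta> a)"
proof -
  have int: "integrable L (\<lambda>y. indicator {x..<y'} y * D y)" if "a \<le> x" for x y'
  proof (rule Bochner_Integration.integrable_bound[where f = "\<lambda>_. D a"])
    show "(\<lambda>y. indicator {x..<y'} y * D y) \<in> borel_measurable L"
      using D_measurable by (intro borel_measurable_times indicator_measurable_L) auto
    show "AE y in L. norm (indicator {x..<y'} y * D y) \<le> norm (D a)"
      using AE_L_space
      by eventually_elim (use that assms D_antimono[of a] D_nonneg in \<open>auto split: split_indicator simp: order_trans[OF _ abs_ge_self]\<close>)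
  qed simp
  define H where "H y = (\<integral>t. indicator {a..<y} t * D t \<partial>L) - \<delta> y" for y
  have "H a = H b"
  proof (rule eq_of_increment_bound[of a b H D])
    fix x y assume xy: "a \<le> x" "x < y" "y \<le> b"
    have eq: "indicator {a..<y} t * D t = indicator {a..<x} t * D t + indicator {x..<y} t * D t" for t
      using xy by (auto split: split_indicator)
    have "(\<integral>t. indicator {a..<y} t * D t \<partial>L) = (\<integral>t. indicator {a..<x} t * D t \<partial>L) + (\<integral>t. indicator {x..<y} t * D t \<partial>L)"
      unfolding eq using xy by (intro Bochner_Integration.integral_add int) auto
    then have *: "H y - H x = (\<integral>t. indicator {x..<y} t * D t \<partial>L) - (\<delta> y - \<delta> x)"
      by (simp add: H_def)
    have meas: "measure L ({x..<y} \<inter> space L) = y - x"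
    proof -
      have "{x..<y} \<inter> space L = {x..<y}" using xy assms by (auto simp: space_L)
      then show ?thesis using xy assms by (subst measure_restrict_space) auto
    qed
    have c: "integrable L (\<lambda>t. indicator {x..<y} t * c) \<and> (\<integral>t. indicator {x..<y} t * c \<partial>L) = (y - x) * c" for c :: real
    proof -
      have "{x..<y} \<in> sets L" using xy assms by (auto simp: sets_restrict_space_iff)
      then show ?thesis using meas integrable_real_indicator[of "{x..<y}" L] by (simp add: L.emeasure_finite less_top[symmetric] space_L)
    qed
    have "(\<integral>t. indicator {x..<y} t * D t \<partial>L) \<le> (\<integral>t. indicator {x..<y} t * D x \<partial>L)"
      using xy assms c int by (intro integral_mono) (auto split: split_indicator simp: space_L intro: D_antimono)
    moreover have "(\<integral>t. indicator {x..<y} t * D t \<partial>L) \<ge> (\<integral>t. indicator {x..<y} t * D y \<partial>L)"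
      using xy assms c int by (intro integral_mono) (auto split: split_indicator simp: space_L intro: D_antimono)
    ultimately have "(\<integral>t. indicator {x..<y} t * D t \<partial>L) \<le> D x * (y - x)" "D y * (y - x) \<le> (\<integral>t. indicator {x..<y} t * D t \<partial>L)"
      using conjunct2[OF c, of "D x"] conjunct2[OF c, of "D y"] by (simp_all only: mult.commute)
    with D_bounds[of x y] xy assms show "\<bar>H y - H x\<bar> \<le> (D x - D y) * (y - x)"
      unfolding * by (auto simp: algebra_simps abs_if)
  qed (use assms in simp)
  then have "(\<integral>t. indicator {a..<b} t * D t \<partial>L) = \<delta> b - \<delta> a" by (simp add: H_def)
  moreover have "(\<integral>\<^sup>+y. ennreal (indicator {a..<b} y * D y) \<partial>L) = ennreal (\<integral>t. indicator {a..<b} t * D t \<partial>L)"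
    using D_nonneg by (intro nn_integral_eq_integral int AE_I2) (auto simp: space_L)
  moreover have "(\<integral>\<^sup>+y. indicator {a..<b} y * ennreal (D y) \<partial>L) = (\<integral>\<^sup>+y. ennreal (indicator {a..<b} y * D y) \<partial>L)"
    by (intro nn_integral_cong) (auto split: split_indicator)
  ultimately show ?thesis by simp
qed

text \<open>Monotone convergence from the inside extends the formula to (x,1); the boundary terms
  converge because \<delta> has the right limits at 1 and at x, including x = 0.\<close>

lemma nn_integral_D_cut:
  assumes "0 \<le> x" "x < 1"
  shows "(\<integral>\<^sup>+y. indicator {x<..} y * ennreal (D y) \<partial>L) = ennreal (- \<delta> x)"
proof -
  \<comment> \<open>The denominator n + 3 exceeds 2, so x + e n lies below 1 - e n already for n =
    0.\<close>
  define e where "e n = (1 - x) / real (n + 3)" for n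
  have e: "e n > 0" "x + e n < 1 - e n" for n
  proof -
    show "e n > 0" using assms by (simp add: e_def)
    have "(1 - x) * 2 < (1 - x) * real (n + 3)" using assms by (intro mult_strict_left_mono) auto
    then have "2 * e n < 1 - x" unfolding e_def by (simp add: divide_less_eq)
    then show "x + e n < 1 - e n" by simp
  qed
  have e_lim: "e \<longlonglongrightarrow> 0" unfolding e_def by real_asymp
  have e_dec: "e n \<le> e m" if "m \<le> n" for m n
    unfolding e_def using that assms by (intro divide_left_mono) auto
  let ?f = "\<lambda>n y. indicator {x + e n..<1 - e n} y * ennreal (D y)"
  have "(\<lambda>n. \<integral>\<^sup>+y. ?f n y \<partial>L) \<longlonglongrightarrow> (\<integral>\<^sup>+y. indicator {x<..<1} y * ennreal (D y) \<partial>L)"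
  proof (rule nn_integral_LIMSEQ)
    show "incseq ?f"
    proof (rule incseq_SucI, rule le_funI)
      fix n y
      show "?f n y \<le> ?f (Suc n) y" using e_dec[of n "Suc n"] by (auto split: split_indicator)
    qed
    show "?f n \<in> borel_measurable L" for n
      using D_measurable by (intro borel_measurable_times_ennreal indicator_measurable_L) auto
    show "(\<lambda>n. ?f n y) \<longlonglongrightarrow> indicator {x<..<1} y * ennreal (D y)" for y
    proof -
      show ?thesis
      proof (cases "x < y \<and> y < 1")
        case True
        have "\<forall>\<^sub>F n in sequentially. e n < min (y - x) (1 - y)"
          using True by (intro order_tendstoD(2)[OF e_lim]) auto
        then have "\<forall>\<^sub>F n in sequentially. ?f n y = indicator {x<..<1} y * ennreal (D y)"
          by eventually_elim (use True in \<open>auto split: split_indicator\<close>)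
        then show ?thesis by (rule tendsto_eventually)
      next
        case False
        then have "?f n y = indicator {x<..<1} y * ennreal (D y)" for n using e(1)[of n] by (auto split: split_indicator)
        then show ?thesis by simp
      qed
    qed
  qed
  moreover have "(\<lambda>n. \<integral>\<^sup>+y. ?f n y \<partial>L) \<longlonglongrightarrow> ennreal (0 - \<delta> x)"
  proof -
    have "(\<lambda>n. \<integral>\<^sup>+y. ?f n y \<partial>L) = (\<lambda>n. ennreal (\<delta> (1 - e n) - \<delta> (x + e n)))"
      using e assms by (intro ext D_integral_interior) (auto simp: add_nonneg_pos)
    moreover have "(\<lambda>n. \<delta> (1 - e n)) \<longlonglongrightarrow> 0"
    proof (rule filterlim_compose[OF env_tendsto_1])
      have "(\<lambda>n. 1 - e n) \<longlonglongrightarrow> 1 - 0" by (intro tendsto_intros e_lim)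
      moreover have "e n \<noteq> 0" for n using e(1)[of n] by simp
      ultimately show "filterlim (\<lambda>n. 1 - e n) (at_left 1) sequentially" using e(1) by (auto simp: filterlim_at)
    qed
    moreover have "(\<lambda>n. \<delta> (x + e n)) \<longlonglongrightarrow> \<delta> x"
    proof (rule filterlim_compose[where g = \<delta>])
      show "(\<delta> \<longlongrightarrow> \<delta> x) (at_right x)"
      proof (cases "x = 0")
        case False
        then show ?thesis using env_continuous_at[of x] assms by (auto simp: isCont_def intro: tendsto_within_subset[of _ _ _ UNIV])
      qed (use env_tendsto_0 in simp)
      have "(\<lambda>n. x + e n) \<longlonglongrightarrow> x + 0" by (intro tendsto_intros e_lim)
      moreover have "e n \<noteq> 0" for n using e(1)[of n] by simp
      ultimately show "filterlim (\<lambda>n. x + e n) (at_right x) sequentially" using e(1) by (auto simp: filterlim_at)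
    qed
    ultimately show ?thesis by (simp only:) (intro tendsto_ennrealI tendsto_diff)
  qed
  ultimately have "(\<integral>\<^sup>+y. indicator {x<..<1} y * ennreal (D y) \<partial>L) = ennreal (0 - \<delta> x)"
    by (rule LIMSEQ_unique)
  moreover have "(\<integral>\<^sup>+y. indicator {x<..} y * ennreal (D y) \<partial>L) = (\<integral>\<^sup>+y. indicator {x<..<1} y * ennreal (D y) \<partial>L)"
    by (intro nn_integral_cong) (auto simp: space_L split: split_indicator)
  ultimately show ?thesis by simp
qed

lemma upset_weight:
  fixes Q :: "real \<Rightarrow> real"
  assumes mono: "mono_on {0<..<1} Q"
  defines "U \<equiv> \<lambda>t. {x \<in> {0<..<1}. t < Q x}"
  shows "(\<integral>\<^sup>+x. indicator (U t) x * ennreal (D x) \<partial>L) \<le> (\<integral>\<^sup>+x. indicator (U t) x * ennreal (\<psi> x) \<partial>L)" (is ?le)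
    and "\<forall>x\<in>{0<..<1}. \<forall>y\<in>{0<..<1}. D x = D y \<longrightarrow> Q x = Q y \<Longrightarrow>
      (\<integral>\<^sup>+x. indicator (U t) x * ennreal (D x) \<partial>L) = (\<integral>\<^sup>+x. indicator (U t) x * ennreal (\<psi> x) \<partial>L)" (is "?fac \<Longrightarrow> ?eq")
proof -
  have "?le \<and> (?fac \<longrightarrow> ?eq)"
  proof (cases "U t = {}")
    case False
    have U: "U t \<subseteq> {0<..<1}" by (auto simp: U_def)
    have U_up: "y \<in> U t" if "x \<in> U t" "x \<le> y" "y < 1" for x y
      using mono_onD[OF mono, of x y] that by (auto simp: U_def)
    define a where "a = Inf (U t)"
    have up: "0 \<le> a" "a < 1" "AE x in L. x \<in> U t \<longleftrightarrow> a < x" "\<And>b. a < b \<Longrightarrow> \<exists>u\<in>U t. u < b"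
      using upset_AE_eq[OF U False] U_up unfolding a_def by blast+
    have cut: "(\<integral>\<^sup>+x. indicator (U t) x * g x \<partial>L) = (\<integral>\<^sup>+x. indicator {a<..} x * g x \<partial>L)" for g :: "real \<Rightarrow> ennreal"
    proof (rule nn_integral_cong_AE)
      show "AE x in L. indicator (U t) x * g x = indicator {a<..} x * g x"
        using up(3) by eventually_elim (auto split: split_indicator)
    qed
    have D: "(\<integral>\<^sup>+x. indicator (U t) x * ennreal (D x) \<partial>L) = ennreal (- \<delta> a)"
      unfolding cut using up by (intro nn_integral_D_cut)
    have P: "(\<integral>\<^sup>+x. indicator (U t) x * ennreal (\<psi> x) \<partial>L) = ennreal (- \<Phi> a)"
      unfolding cut using up by (intro nn_integral_psi_cut) auto
    have le: "\<Phi> a \<le> \<delta> a" using up by (intro le_env) auto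
    \<comment> \<open>If \<Phi> a were below \<delta> a, \<open>D\<close> and with it Q would be
      constant on a neighbourhood of a. The up-set has points of that neighbourhood at or to the
      right of a, hence would also contain points to its left.\<close>
    have touch: "\<Phi> a = \<delta> a" if fac: ?fac
    proof (rule ccontr)
      assume "\<Phi> a \<noteq> \<delta> a"
      with le have gap: "\<Phi> a < \<delta> a" by simp
      \<comment> \<open>At 0 the envelope touches, so a gap can occur only at an interior
        point.\<close>
      then have "0 < a" using env_0 up(1) by (cases "a = 0") auto
      with env_affine_near[OF _ up(2) gap] obtain l r where
        lr: "0 \<le> l" "l < a" "a < r" "r \<le> 1" "\<And>x. l < x \<Longrightarrow> x < r \<Longrightarrow> D x = D a" by blast
      obtain u where u: "u \<in> U t" "u < r" using up(4)[OF lr(3)] by auto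
      have "bdd_below (U t)" using U by (force intro!: bdd_belowI[where m = 0])
      then have "a \<le> u" unfolding a_def using u by (intro cInf_lower)
      define y where "y = (l + a) / 2"
      have y: "l < y" "y < a" using lr(2) by (auto simp: y_def)
      have "Q y = Q u" proof -
        have "y \<in> {0<..<1}" "u \<in> {0<..<1}" "D y = D a" "D u = D a"
          using y u lr(1-4) lr(5)[of y] lr(5)[of u] \<open>a \<le> u\<close> by auto
        then show ?thesis using fac[rule_format, of y u] by simp
      qed
      then have "y \<in> U t" using u y lr(1-4) \<open>a \<le> u\<close> by (auto simp: U_def)
      then have "a \<le> y" unfolding a_def using \<open>bdd_below (U t)\<close> by (intro cInf_lower)
      with y show False by simp
    qed
    show ?thesis
    proof (intro conjI impI)
      show ?le unfolding D P using le by (intro ennreal_leI) simp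
      assume ?fac
      from touch[OF this] show ?eq unfolding D P by simp
    qed
  qed simp
  then show ?le "?fac \<Longrightarrow> ?eq" by blast+
qed

lemma
  fixes Q :: "real \<Rightarrow> real"
  assumes mono: "mono_on {0<..<1} Q"
  shows cost_envelope_le: "(\<integral>\<^sup>+x. ennreal (Q x) * ennreal (D x) \<partial>L) \<le> (\<integral>\<^sup>+x. ennreal (Q x) * ennreal (\<psi> x) \<partial>L)"
    and cost_envelope_eq: "\<forall>x\<in>{0<..<1}. \<forall>y\<in>{0<..<1}. D x = D y \<longrightarrow> Q x = Q y \<Longrightarrow>
      (\<integral>\<^sup>+x. ennreal (Q x) * ennreal (D x) \<partial>L) = (\<integral>\<^sup>+x. ennreal (Q x) * ennreal (\<psi> x) \<partial>L)"
proof -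
  have Q: "Q \<in> borel_measurable L" by (rule measurable_L_mono[OF mono])
  have *: "(\<lambda>x. ennreal (D x)) \<in> borel_measurable L" "(\<lambda>x. ennreal (\<psi> x)) \<in> borel_measurable L"
    using D_measurable psi_meas by measurable
  show "(\<integral>\<^sup>+x. ennreal (Q x) * ennreal (D x) \<partial>L) \<le> (\<integral>\<^sup>+x. ennreal (Q x) * ennreal (\<psi> x) \<partial>L)"
    unfolding nn_integral_layer_cake[OF Q *(1)] nn_integral_layer_cake[OF Q *(2)]
    by (rule nn_integral_mono) (rule mult_right_mono[OF upset_weight(1)[OF mono] zero_le])
  assume fac: "\<forall>x\<in>{0<..<1}. \<forall>y\<in>{0<..<1}. D x = D y \<longrightarrow> Q x = Q y"
  show "(\<integral>\<^sup>+x. ennreal (Q x) * ennreal (D x) \<partial>L) = (\<integral>\<^sup>+x. ennreal (Q x) * ennreal (\<psi> x) \<partial>L)"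
    unfolding nn_integral_layer_cake[OF Q *(1)] nn_integral_layer_cake[OF Q *(2)]
      upset_weight(2)[OF mono fac] ..
qed

lemma D_int: "integrable L D"
proof (rule integrableI_nonneg)
  have "(\<integral>\<^sup>+x. ennreal (D x) \<partial>L) = (\<integral>\<^sup>+y. indicator {0<..} y * ennreal (D y) \<partial>L)"
    by (intro nn_integral_cong) (auto simp: space_L split: split_indicator)
  then show "(\<integral>\<^sup>+x. ennreal (D x) \<partial>L) < \<infinity>" using nn_integral_D_cut[of 0] by simp
  show "AE x in L. 0 \<le> D x" using AE_L_space by eventually_elim (auto intro: D_nonneg)
qed (rule D_measurable)

lemma integrable_bounded_mult:
  assumes Q: "Q \<in> borel_measurable L" and f: "integrable L f"
    and bnd: "\<And>x. 0 < x \<Longrightarrow> x < 1 \<Longrightarrow> \<bar>Q x\<bar> \<le> m"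
  shows "integrable L (\<lambda>x. Q x * f x :: real)"
proof (rule Bochner_Integration.integrable_bound[where f = "\<lambda>x. m * f x"])
  show "AE x in L. norm (Q x * f x) \<le> norm (m * f x)"
    using AE_L_space
  proof eventually_elim
    case (elim x)
    then have "\<bar>Q x\<bar> \<le> \<bar>m\<bar>" using bnd[of x] by auto
    then show ?case by (auto simp: abs_mult intro!: mult_right_mono)
  qed
qed (use assms in auto)


text \<open>Real-valued counterpart: integrability of Q D is inherited from Q \<psi>, because the
  comparison already holds for the extended integrals.\<close>

lemma
  assumes mono: "mono_on {0<..<1} Q" and nn: "\<And>x. 0 < x \<Longrightarrow> x < 1 \<Longrightarrow> 0 \<le> Q x"
    and int: "integrable L (\<lambda>x. Q x * \<psi> x)"
  shows cost_D_int: "integrable L (\<lambda>x. Q x * D x)"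
    and cost_D_le: "(\<integral>x. Q x * D x \<partial>L) \<le> (\<integral>x. Q x * \<psi> x \<partial>L)"
    and cost_D_eq: "\<forall>x\<in>{0<..<1}. \<forall>y\<in>{0<..<1}. D x = D y \<longrightarrow> Q x = Q y \<Longrightarrow>
      (\<integral>x. Q x * D x \<partial>L) = (\<integral>x. Q x * \<psi> x \<partial>L)"
proof -
  have e: "(\<integral>\<^sup>+x. ennreal (Q x) * ennreal (g x) \<partial>L) = (\<integral>\<^sup>+x. ennreal (Q x * g x) \<partial>L)" for g
    using nn by (intro nn_integral_cong) (simp add: space_L ennreal_mult')
  have QD: "AE x in L. 0 \<le> Q x * D x" "AE x in L. 0 \<le> Q x * \<psi> x"
    using AE_L_space by (eventually_elim, auto intro!: mult_nonneg_nonneg nn D_nonneg psi_nonneg)+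
  have p: "(\<integral>\<^sup>+x. ennreal (Q x * \<psi> x) \<partial>L) = ennreal (\<integral>x. Q x * \<psi> x \<partial>L)"
    using QD int by (intro nn_integral_eq_integral)
  show i: "integrable L (\<lambda>x. Q x * D x)"
    using cost_envelope_le[OF mono] measurable_L_mono[OF mono] D_measurable QD
    unfolding e p by (intro integrableI_nonneg) (auto intro: le_less_trans)
  have d: "(\<integral>\<^sup>+x. ennreal (Q x * D x) \<partial>L) = ennreal (\<integral>x. Q x * D x \<partial>L)"
    using QD i by (intro nn_integral_eq_integral)
  have nn: "0 \<le> (\<integral>x. Q x * D x \<partial>L)" "0 \<le> (\<integral>x. Q x * \<psi> x \<partial>L)"
    using QD by (auto intro: integral_nonneg_AE)
  show "(\<integral>x. Q x * D x \<partial>L) \<le> (\<integral>x. Q x * \<psi> x \<partial>L)"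
    using cost_envelope_le[OF mono] nn unfolding e d p by simp
  assume "\<forall>x\<in>{0<..<1}. \<forall>y\<in>{0<..<1}. D x = D y \<longrightarrow> Q x = Q y"
  from cost_envelope_eq[OF mono this] show "(\<integral>x. Q x * D x \<partial>L) = (\<integral>x. Q x * \<psi> x \<partial>L)"
    using nn unfolding e d p by simp
qed

end

section \<open>Utility functions, price-taking maximizers and the class of quantiles\<close>

lemma increment_slopes:
  fixes a b c d m y z :: real
  assumes "y < m" "m < z" "d < c" "(m - y) * c = a" "(z - m) * d = b"
  shows "b * (m - y) < a * (z - m)"
proof -
  have "(z - m) * (m - y) * d < (z - m) * (m - y) * c" using assms by (intro mult_strict_left_mono) auto
  then show ?thesis using assms(4,5)[symmetric] by (simp add: mult_ac)
qed

section \<open>Strictly concave utilities, possibly -\<infinity> at 0\<close>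

locale utility =
  fixes u :: "real \<Rightarrow> real"
  assumes u_mono: "strict_mono_on {0<..} u"
    and u_deriv: "\<And>y. 0 < y \<Longrightarrow> u differentiable (at y) \<and> deriv u differentiable (at y) \<and> deriv (deriv u) y < 0"
begin

text \<open>At 0 this is the default value 0 when the utility tends to -\<infinity>, so statements
  about \<open>uu\<close> carry membership in \<open>dom\<close>, which is either [0,\<infinity>) or
  (0,\<infinity>).\<close>

definition uu where "uu y = real_of_ereal (util u y)"

definition dom where "dom = {y. 0 \<le> y \<and> util u y \<noteq> -\<infinity>}"

lemma util_pos: "0 < y \<Longrightarrow> util u y = ereal (u y)"
  by (simp add: util_def)

lemma u_less: "0 < y \<Longrightarrow> y < z \<Longrightarrow> u y < u z"
  using strict_mono_onD[OF u_mono] by simp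

lemma u_le: "0 < y \<Longrightarrow> y \<le> z \<Longrightarrow> u y \<le> u z"
  using u_less[of y z] by (cases "y = z") auto

text \<open>Monotonicity turns the right limit at 0 into an infimum, which always exists in
  \<open>ereal\<close>; so the \<open>Lim\<close> in \<open>util\<close> is a genuine limit.\<close>

lemma util_0_tendsto: "((\<lambda>z. ereal (u z)) \<longlongrightarrow> util u 0) (at_right 0)"
proof -
  have "((\<lambda>z. ereal (u z)) \<longlongrightarrow> Inf ((\<lambda>z. ereal (u z)) ` ({0<..} \<inter> UNIV))) (at 0 within ({0<..} \<inter> UNIV))"
    by (rule Lim_right_bound[where K = "-\<infinity>"]) (auto intro: u_le)
  then have *: "((\<lambda>z. ereal (u z)) \<longlongrightarrow> Inf ((\<lambda>z. ereal (u z)) ` {0<..})) (at_right 0)" by simp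
  then show ?thesis using tendsto_Lim[OF _ *] by (simp add: util_def)
qed

lemma util_less: "0 \<le> y \<Longrightarrow> y < z \<Longrightarrow> util u y < util u z"
proof (cases "y = 0")
  case True
  assume "y < z"
  \<comment> \<open>The intermediate point z/2 keeps the inequality strict after passing to the
    limit.\<close>
  have "\<forall>\<^sub>F t::real in at_right 0. t \<in> {0<..<z/2}" using \<open>y < z\<close> True by (intro eventually_at_right_real) auto
  then have "\<forall>\<^sub>F t in at_right 0. ereal (u t) \<le> ereal (u (z/2))"
    by eventually_elim (auto intro: u_le)
  with util_0_tendsto have "util u 0 \<le> ereal (u (z/2))" by (rule tendsto_upperbound) simp
  also have "\<dots> < ereal (u z)" using u_less[of "z/2" z] \<open>y < z\<close> True by simp
  finally show ?thesis using True \<open>y < z\<close> by (simp add: util_pos)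
qed (use u_less[of y z] in \<open>auto simp: util_pos\<close>)


lemma util_neq_PInf: "0 \<le> y \<Longrightarrow> util u y \<noteq> \<infinity>"
  using util_less[of y "y + 1"] by auto

lemma dom_pos: "0 < y \<Longrightarrow> y \<in> dom"
  by (simp add: dom_def util_pos)

lemma dom_nonneg: "y \<in> dom \<Longrightarrow> 0 \<le> y"
  by (simp add: dom_def)

lemma util_dom: "y \<in> dom \<Longrightarrow> util u y = ereal (uu y)"
  using util_neq_PInf[of y] by (cases "util u y") (auto simp: dom_def uu_def)

lemma util_not_dom: "0 \<le> y \<Longrightarrow> y \<notin> dom \<Longrightarrow> util u y = -\<infinity>"
  by (simp add: dom_def)

lemma uu_pos: "0 < y \<Longrightarrow> uu y = u y"
  by (simp add: uu_def util_pos)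

lemma dom_up: "y \<in> dom \<Longrightarrow> y \<le> z \<Longrightarrow> z \<in> dom"
  using dom_pos[of z] by (cases "y = z") (auto simp: dom_def)

lemma dom_convex: "y \<in> dom \<Longrightarrow> z \<in> dom \<Longrightarrow> 0 \<le> t \<Longrightarrow> t \<le> 1 \<Longrightarrow> (1 - t) * y + t * z \<in> dom"
proof (cases "y \<le> z")
  case True
  assume "y \<in> dom" "0 \<le> t"
  moreover have "0 \<le> t * (z - y)" using True \<open>0 \<le> t\<close> by simp
  then have "y \<le> (1 - t) * y + t * z" by (simp add: algebra_simps)
  ultimately show ?thesis using dom_up[of y] by blast
next
  case False
  assume "z \<in> dom" "t \<le> 1"
  moreover have "0 \<le> (1 - t) * (y - z)" using False \<open>t \<le> 1\<close> by simp
  then have "z \<le> (1 - t) * y + t * z" by (simp add: algebra_simps)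
  ultimately show ?thesis using dom_up[of z] by blast
qed

lemma uu_less: "y \<in> dom \<Longrightarrow> y < z \<Longrightarrow> uu y < uu z"
  using util_less[of y z] util_dom[of y] util_dom[of z] dom_up[of y z] dom_nonneg[of y] by auto

lemma uu_le: "y \<in> dom \<Longrightarrow> y \<le> z \<Longrightarrow> uu y \<le> uu z"
  using uu_less[of y z] by (cases "y = z") auto

lemma u_isCont: "0 < y \<Longrightarrow> isCont u y"
  using u_deriv[of y] differentiable_imp_continuous_within by blast

text \<open>Continuity into \<open>ereal\<close> includes 0 even if the value there is -\<infinity>,
  so that compactness and limits can be used on closed intervals containing 0.\<close>

lemma util_continuous: "continuous_on {0..} (util u)"
proof -
  have "(util u \<longlongrightarrow> util u y) (at y within {0..})" if "0 \<le> y" for y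
  proof (cases "y = 0")
    case True
    have "\<forall>\<^sub>F t in at_right 0. ereal (u t) = util u t"
      by (auto simp: eventually_at_filter util_pos)
    then have "(util u \<longlongrightarrow> util u 0) (at_right 0)"
      using util_0_tendsto by (rule Lim_transform_eventually[rotated])
    then show ?thesis using True by (simp add: at_within_Ici_at_right)
  next
    case False
    with that have "0 < y" by simp
    have "((\<lambda>t. ereal (u t)) \<longlongrightarrow> ereal (u y)) (at y)"
      using u_isCont[OF \<open>0 < y\<close>] by (intro tendsto_intros) (simp add: isCont_def)
    moreover have "\<forall>\<^sub>F t in at y. t \<in> {0<..}" using \<open>0 < y\<close> by (intro eventually_at_topological[THEN iffD2] exI[of _ "{0<..}"]) auto
    then have "\<forall>\<^sub>F t in at y. ereal (u t) = util u t"
      by eventually_elim (simp add: util_pos)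
    ultimately have "(util u \<longlongrightarrow> ereal (u y)) (at y)" by (rule Lim_transform_eventually)
    then show ?thesis using \<open>0 < y\<close> by (auto simp: util_pos intro: tendsto_within_subset)
  qed
  then show ?thesis by (auto simp: continuous_on)
qed

lemma uu_continuous: "continuous_on dom uu"
proof -
  have "(uu \<longlongrightarrow> uu y) (at y within dom)" if "y \<in> dom" for y
  proof -
    have "(util u \<longlongrightarrow> util u y) (at y within dom)"
      using util_continuous that by (auto simp: continuous_on dom_def intro: tendsto_within_subset)
    then have "(util u \<longlongrightarrow> ereal (uu y)) (at y within dom)" by (simp only: util_dom[OF that])
    from lim_real_of_ereal[OF this] show ?thesis
      by (rule tendsto_cong[THEN iffD1, rotated]) (simp add: uu_def)
  qed
  then show ?thesis by (auto simp: continuous_on)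
qed

lemma uu_deriv: "0 < y \<Longrightarrow> (uu has_real_derivative deriv u y) (at y)"
proof -
  assume y: "0 < y"
  then have "(u has_real_derivative deriv u y) (at y)"
    using u_deriv by (auto simp: DERIV_deriv_iff_real_differentiable)
  moreover have "\<forall>\<^sub>F t in nhds y. t \<in> {0<..}" using y by (intro eventually_nhds_in_open) auto
  then have "\<forall>\<^sub>F t in nhds y. uu t = u t" by eventually_elim (simp add: uu_pos)
  ultimately show ?thesis using DERIV_cong_ev[OF refl _ refl, of uu u y] by simp
qed

lemma deriv_u_less:
  assumes "0 < y" "y < z"
  shows "deriv u z < deriv u y"
proof (rule DERIV_neg_imp_decreasing[OF assms(2)])
  fix x assume "y \<le> x"
  with assms(1) show "\<exists>l. (deriv u has_real_derivative l) (at x) \<and> l < 0"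
    using u_deriv[of x] by (auto simp: DERIV_deriv_iff_real_differentiable intro!: exI[of _ "deriv (deriv u) x"])
qed

lemma mvt:
  assumes "y \<in> dom" "y < z"
  obtains c where "y < c" "c < z" "uu z - uu y = (z - y) * deriv u c"
proof -
  have "continuous_on {y..z} uu"
    using uu_continuous by (rule continuous_on_subset) (use assms dom_up in auto)
  moreover have "\<And>x. y < x \<Longrightarrow> x < z \<Longrightarrow> uu differentiable (at x)"
    using uu_deriv dom_nonneg[OF assms(1)] by (auto simp: real_differentiable_def intro: le_less_trans)
  ultimately obtain l c where c: "y < c" "c < z" "(uu has_real_derivative l) (at c)" "uu z - uu y = (z - y) * l"
    using MVT[OF assms(2), of uu] by blast
  then have "l = deriv u c" using DERIV_unique[OF c(3) uu_deriv] dom_nonneg[OF assms(1)] by simp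
  then show ?thesis using that c by simp
qed

lemma strict_concave:
  assumes "y \<in> dom" "y < m" "m < z"
  shows "(uu z - uu m) * (m - y) < (uu m - uu y) * (z - m)"
proof -
  obtain c where c: "y < c" "c < m" "uu m - uu y = (m - y) * deriv u c" using mvt assms by blast
  have "m \<in> dom" using assms dom_up by auto
  obtain d where d: "m < d" "d < z" "uu z - uu m = (z - m) * deriv u d" using mvt[OF \<open>m \<in> dom\<close> assms(3)] by blast
  show ?thesis using c d assms dom_nonneg[OF assms(1)]
    by (intro increment_slopes[of y m z "deriv u d" "deriv u c"] deriv_u_less) auto
qed

lemma concave:
  assumes "y \<in> dom" "z \<in> dom" "0 \<le> t" "t \<le> 1"
  shows "(1 - t) * uu y + t * uu z \<le> uu ((1 - t) * y + t * z)"
proof -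
  have main: "(1 - t) * uu y + t * uu z \<le> uu ((1 - t) * y + t * z)"
    if "y \<in> dom" "y < z" "0 \<le> t" "t \<le> 1" for y z t
  proof (cases "t = 0 \<or> t = 1")
    case False
    with that have t: "0 < t" "t < 1" by auto
    let ?m = "(1 - t) * y + t * z"
    have d: "?m - y = t * (z - y)" "z - ?m = (1 - t) * (z - y)" by (auto simp: algebra_simps)
    have "0 < ?m - y" "0 < z - ?m" unfolding d using t that by auto
    then have "(uu z - uu ?m) * (?m - y) < (uu ?m - uu y) * (z - ?m)" using that by (intro strict_concave) auto
    then have "((uu z - uu ?m) * t) * (z - y) < ((uu ?m - uu y) * (1 - t)) * (z - y)" unfolding d by (simp add: mult_ac)
    then have "(uu z - uu ?m) * t < (uu ?m - uu y) * (1 - t)" using that by simp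
    then show ?thesis by (simp add: algebra_simps)
  qed auto
  show ?thesis
  proof (cases y z rule: linorder_cases)
    case equal then show ?thesis by (simp add: algebra_simps)
  next
    case greater
    then show ?thesis using main[of z y "1 - t"] assms by (simp add: algebra_simps)
  qed (use main assms in auto)
qed

lemma midpoint:
  assumes "y \<in> dom" "z \<in> dom" "y \<noteq> z"
  shows "(uu y + uu z) / 2 < uu ((y + z) / 2)"
proof -
  have main: "(uu y + uu z) / 2 < uu ((y + z) / 2)" if "y \<in> dom" "y < z" for y z
  proof -
    let ?m = "(y + z) / 2"
    have "(uu z - uu ?m) * (?m - y) < (uu ?m - uu y) * (z - ?m)" using that by (intro strict_concave) auto
    moreover have "?m - y = (z - y) / 2" "z - ?m = (z - y) / 2" by (auto simp: field_simps)
    ultimately have "(uu z - uu ?m) * ((z - y) / 2) < (uu ?m - uu y) * ((z - y) / 2)" by simp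
    then have "uu z - uu ?m < uu ?m - uu y" using that by simp
    then show ?thesis by simp
  qed
  show ?thesis using main[of y z] main[of z y] assms by (cases "y < z") (auto simp: add.commute)
qed

text \<open>A concave function minus a linear one cannot drop below both end values. This controls
  the loss from capping a quantile.\<close>

lemma quasi_concave:
  assumes "y \<in> dom" "y \<le> m" "m \<le> z"
  shows "min (uu y - c * y) (uu z - c * z) \<le> uu m - c * m"
proof (cases "y = z")
  case False
  with assms have yz: "y < z" by auto
  define t where "t = (m - y) / (z - y)"
  have t: "0 \<le> t" "t \<le> 1" using assms yz by (auto simp: t_def divide_simps)
  have m: "m = (1 - t) * y + t * z"
  proof -
    have "t * (z - y) = m - y" using yz by (simp add: t_def)
    then show ?thesis by (simp add: algebra_simps)
  qed
  have "z \<in> dom" using assms dom_up by auto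
  have "min (uu y - c * y) (uu z - c * z) = (1 - t) * min (uu y - c * y) (uu z - c * z) + t * min (uu y - c * y) (uu z - c * z)"
    by (simp add: algebra_simps)
  also have "\<dots> \<le> (1 - t) * (uu y - c * y) + t * (uu z - c * z)"
    using t by (intro add_mono mult_left_mono) auto
  also have "\<dots> = ((1 - t) * uu y + t * uu z) - c * m" unfolding m by (simp add: algebra_simps)
  also have "\<dots> \<le> uu m - c * m" using concave[OF assms(1) \<open>z \<in> dom\<close> t] m by simp
  finally show ?thesis .
qed (use assms in auto)

section \<open>Maximizers of utility minus price over a set of wealth levels\<close>

definition is_max where
  "is_max S p y \<longleftrightarrow> y \<in> S \<and> y \<in> dom \<and> (\<forall>z\<in>S \<inter> dom. uu z - p * z \<le> uu y - p * y)"

lemma is_maxD: "is_max S p y \<Longrightarrow> z \<in> S \<Longrightarrow> z \<in> dom \<Longrightarrow> uu z - p * z \<le> uu y - p * y"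
  by (simp add: is_max_def)

text \<open>The positive point of S has finite utility and so excludes maximizers of value
  -\<infinity>; the real-valued comparison on \<open>dom\<close> then says the same as the extended
  one.\<close>

lemma is_max_ereal:
  assumes "S \<subseteq> {0..}" "s \<in> S" "0 < s"
  shows "is_max S p y \<longleftrightarrow> y \<in> S \<and> (\<forall>z\<in>S. util u z - ereal (p * z) \<le> util u y - ereal (p * y))"
proof safe
  assume m: "is_max S p y"
  then show "y \<in> S" by (simp add: is_max_def)
  fix z assume "z \<in> S"
  with m assms show "util u z - ereal (p * z) \<le> util u y - ereal (p * y)"
    by (cases "z \<in> dom") (auto simp: is_max_def util_dom util_not_dom)
next
  assume y: "y \<in> S" and *: "\<forall>z\<in>S. util u z - ereal (p * z) \<le> util u y - ereal (p * y)"
  have "y \<in> dom"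
  proof (rule ccontr)
    assume "y \<notin> dom"
    then show False using *[rule_format, OF assms(2)] util_not_dom[of y] y assms by (auto simp: util_pos)
  qed
  then show "is_max S p y" using y * by (auto simp: is_max_def util_dom)
qed

lemma is_maximizer_iff: "is_maximizer u p y \<longleftrightarrow> is_max {0..} p y"
  by (subst is_max_ereal[of _ 1]) (auto simp: is_maximizer_def)

lemma is_max_unique:
  assumes "convex S" "is_max S p y" "is_max S p z"
  shows "y = z"
proof (rule ccontr)
  assume "y \<noteq> z"
  have d: "y \<in> dom" "z \<in> dom" "y \<in> S" "z \<in> S" using assms by (auto simp: is_max_def)
  have "(y + z) / 2 \<in> S" using convexD[OF assms(1) d(3,4), of "1/2" "1/2"] by (simp add: add_divide_distrib)
  moreover have "(y + z) / 2 \<in> dom" using dom_convex[OF d(1,2), of "1/2"] by (simp add: add_divide_distrib)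
  ultimately have "uu ((y + z) / 2) - p * ((y + z) / 2) \<le> uu y - p * y" "uu ((y + z) / 2) - p * ((y + z) / 2) \<le> uu z - p * z"
    using is_maxD[OF assms(2), of "(y + z) / 2"] is_maxD[OF assms(3), of "(y + z) / 2"] by blast+
  moreover have "p * ((y + z) / 2) = (p * y + p * z) / 2" by (simp add: algebra_simps)
  ultimately show False using midpoint[OF d(1,2) \<open>y \<noteq> z\<close>] by simp
qed

text \<open>Adding the two optimality inequalities gives (p' - p) * (y' - y) \<le> 0; equal prices
  are settled by uniqueness.\<close>

lemma is_max_mono:
  assumes "convex S" "is_max S p y" "is_max S p' y'" "p \<le> p'"
  shows "y' \<le> y"
proof (cases "p = p'")
  case False
  with assms have "0 < p' - p" by simp
  have "uu y' - p * y' \<le> uu y - p * y" "uu y - p' * y \<le> uu y' - p' * y'"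
    using assms by (auto simp: is_max_def)
  then have "(p' - p) * y' \<le> (p' - p) * y" by (simp add: algebra_simps)
  then show ?thesis using \<open>0 < p' - p\<close> by simp
qed (use assms is_max_unique in auto)

lemma is_max_exists: "0 < m \<Longrightarrow> \<exists>y. is_max {0..m} p y"
proof -
  assume m: "0 < m"
  have "continuous_on {0..m} (\<lambda>y. util u y - ereal (p * y))"
  proof -
    have "((\<lambda>y. util u y - ereal (p * y)) \<longlongrightarrow> util u x - ereal (p * x)) (at x within {0..m})" if "x \<in> {0..m}" for x
      using continuous_on_subset[OF util_continuous, of "{0..m}"] that
      by (intro tendsto_diff_ereal_general) (auto simp: continuous_on intro!: tendsto_intros)
    then show ?thesis by (simp add: continuous_on)
  qed
  from continuous_attains_sup[OF _ _ this] m obtain y where "y \<in> {0..m}"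
    "\<forall>z\<in>{0..m}. util u z - ereal (p * z) \<le> util u y - ereal (p * y)" by force
  then show ?thesis using m by (intro exI[of _ y]) (auto simp: is_max_ereal[of "{0..m}" m])
qed

text \<open>Each optimality inequality is kept as a finite lower bound for
  \<open>util u (Y x)\<close>; it survives the limit and forces the limit point to have finite
  utility.\<close>

lemma is_max_limit:
  assumes "F \<noteq> bot" and Y: "(Y \<longlongrightarrow> y) F" and P: "(P \<longlongrightarrow> p) F"
    and ev: "\<forall>\<^sub>F x in F. is_max S (P x) (Y x)"
    and S: "closed S" "S \<subseteq> {0..}" "s \<in> S" "0 < s"
  shows "is_max S p y"
proof -
  have YS: "\<forall>\<^sub>F x in F. Y x \<in> S" using ev by eventually_elim (simp add: is_max_def)
  have yS: "y \<in> S" by (rule Lim_in_closed_set[OF S(1) YS assms(1) Y])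
  have U: "((\<lambda>x. util u (Y x)) \<longlongrightarrow> util u y) F"
    by (rule continuous_on_tendsto_compose[OF util_continuous Y])
      (use yS S YS in \<open>auto elim: eventually_mono\<close>)
  have *: "ereal (uu z - p * z + p * y) \<le> util u y" if z: "z \<in> S" "z \<in> dom" for z
  proof (rule tendsto_le[OF assms(1) U])
    show "((\<lambda>x. ereal (uu z - P x * z + P x * Y x)) \<longlongrightarrow> ereal (uu z - p * z + p * y)) F"
      by (intro tendsto_intros P Y)
    show "\<forall>\<^sub>F x in F. ereal (uu z - P x * z + P x * Y x) \<le> util u (Y x)"
      using ev
    proof eventually_elim
      case (elim x)
      then show ?case using is_maxD[OF elim z] by (auto simp: is_max_def util_dom)
    qed
  qed
  have "y \<in> dom"
    using *[OF S(3) dom_pos[OF S(4)]] yS S(2) by (cases "y \<in> dom") (auto simp: util_not_dom)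
  then show ?thesis using * yS by (force simp: is_max_def util_dom)
qed

lemma util_meas:
  assumes "Q \<in> borel_measurable L" "\<And>x. 0 < x \<Longrightarrow> x < 1 \<Longrightarrow> 0 \<le> Q x"
  shows "(\<lambda>x. util u (Q x)) \<in> borel_measurable L"
proof -
  have "continuous_on UNIV (\<lambda>x. util u (max 0 x))"
    by (rule continuous_on_compose2[OF util_continuous]) (auto intro!: continuous_intros)
  then have "(\<lambda>x. util u (max 0 x)) \<in> borel_measurable borel"
    by (rule borel_measurable_continuous_onI)
  from measurable_compose[OF assms(1) this]
  have "(\<lambda>x. util u (max 0 (Q x))) \<in> borel_measurable L" .
  moreover have "(\<lambda>x. util u (max 0 (Q x))) \<in> borel_measurable L \<longleftrightarrow> (\<lambda>x. util u (Q x)) \<in> borel_measurable L"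
    using assms(2) by (intro measurable_cong) (auto simp: space_L max_def)
  ultimately show ?thesis by simp
qed

end

section \<open>The class of quantiles: closure properties and right-continuity\<close>

lemma \<G>I:
  assumes nn: "\<And>x. 0 < x \<Longrightarrow> x < 1 \<Longrightarrow> 0 \<le> Q x" and mono: "mono_on {0<..<1} Q"
    and rc: "\<And>x. 0 < x \<Longrightarrow> x < 1 \<Longrightarrow> (Q \<longlongrightarrow> Q x) (at_right x)"
  shows "Q \<in> \<G>"
proof -
  \<comment> \<open>Left limits come from monotonicity alone, as suprema of the values to the
    left.\<close>
  have "\<exists>l. (Q \<longlongrightarrow> l) (at_left x)" if x: "x \<in> {0<..<1}" for x
  proof -
    have "(Q \<longlongrightarrow> Sup (Q ` ({..<x} \<inter> {0<..<1}))) (at x within ({..<x} \<inter> {0<..<1}))"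
      using x by (intro Lim_left_bound[where K = "Q x"]) (auto intro!: mono_onD[OF mono])
    moreover have "at x within ({..<x} \<inter> {0<..<1}) = at_left x"
      using x by (intro at_within_nhd[of _ "{0<..<1}"]) auto
    ultimately show ?thesis by auto
  qed
  then show ?thesis using assms by (auto simp: \<G>_def continuous_within)
qed

lemma
  assumes "Q \<in> \<G>"
  shows \<G>_nonneg: "\<And>x. 0 < x \<Longrightarrow> x < 1 \<Longrightarrow> 0 \<le> Q x" and \<G>_mono: "mono_on {0<..<1} Q"
    and \<G>_right: "\<And>x. 0 < x \<Longrightarrow> x < 1 \<Longrightarrow> (Q \<longlongrightarrow> Q x) (at_right x)"
    and \<G>_meas: "Q \<in> borel_measurable L"
  using assms measurable_L_mono[of Q] by (auto simp: \<G>_def continuous_within)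

lemma \<G>_const: "0 \<le> c \<Longrightarrow> (\<lambda>_. c) \<in> \<G>"
  by (rule \<G>I) (auto simp: mono_on_def)

lemma \<G>_mix:
  assumes P: "P \<in> \<G>" and Q: "Q \<in> \<G>" and "0 \<le> t" "t \<le> 1"
  shows "(\<lambda>x. (1 - t) * P x + t * Q x) \<in> \<G>"
proof (rule \<G>I)
  show "mono_on {0<..<1} (\<lambda>x. (1 - t) * P x + t * Q x)"
    using assms mono_onD[OF \<G>_mono[OF P]] mono_onD[OF \<G>_mono[OF Q]]
    by (intro mono_onI add_mono mult_left_mono) auto
  fix x :: real assume x: "0 < x" "x < 1"
  show "0 \<le> (1 - t) * P x + t * Q x"
    using \<G>_nonneg[OF P x] \<G>_nonneg[OF Q x] assms by simp
  show "((\<lambda>x. (1 - t) * P x + t * Q x) \<longlongrightarrow> (1 - t) * P x + t * Q x) (at_right x)"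
    by (intro tendsto_intros \<G>_right[OF P x] \<G>_right[OF Q x])
qed

lemma \<G>_min:
  assumes Q: "Q \<in> \<G>" and "0 \<le> c"
  shows "(\<lambda>x. min (Q x) c) \<in> \<G>"
proof (rule \<G>I)
  show "mono_on {0<..<1} (\<lambda>x. min (Q x) c)"
    using mono_onD[OF \<G>_mono[OF Q]] by (intro mono_onI min.mono) auto
  fix x :: real assume x: "0 < x" "x < 1"
  show "0 \<le> min (Q x) c" using \<G>_nonneg[OF Q x] assms by simp
  show "((\<lambda>x. min (Q x) c) \<longlongrightarrow> min (Q x) c) (at_right x)"
    by (intro tendsto_intros \<G>_right[OF Q x])
qed

lemma \<G>_max:
  assumes Q: "Q \<in> \<G>" and "0 \<le> c"
  shows "(\<lambda>x. max (Q x) c) \<in> \<G>"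
proof (rule \<G>I)
  show "mono_on {0<..<1} (\<lambda>x. max (Q x) c)"
    using mono_onD[OF \<G>_mono[OF Q]] by (intro mono_onI max.mono) auto
  fix x :: real assume x: "0 < x" "x < 1"
  show "0 \<le> max (Q x) c" using assms by simp
  show "((\<lambda>x. max (Q x) c) \<longlongrightarrow> max (Q x) c) (at_right x)"
    by (intro tendsto_intros \<G>_right[OF Q x])
qed

lemma \<G>_cong:
  assumes "Q \<in> \<G>" and eq: "\<And>x. x \<in> {0<..<1} \<Longrightarrow> Q x = R x"
  shows "R \<in> \<G>"
proof (rule \<G>I)
  show "mono_on {0<..<1} R" using mono_onD[OF \<G>_mono[OF assms(1)]] by (intro mono_onI) (auto simp: eq[symmetric])
  fix x :: real assume x: "0 < x" "x < 1"
  show "0 \<le> R x" using \<G>_nonneg[OF assms(1) x] eq[of x] x by simp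
  have "\<forall>\<^sub>F t in at_right x. t \<in> {x<..<1}" using x by (intro eventually_at_right_real) auto
  then have "\<forall>\<^sub>F t in at_right x. Q t = R t" by eventually_elim (use eq x in auto)
  then show "(R \<longlongrightarrow> R x) (at_right x)"
    using \<G>_right[OF assms(1) x] eq[of x] x by (auto intro: Lim_transform_eventually)
qed

text \<open>A violation at x would, by the right limits, persist on an interval (x,c), which has
  positive measure.\<close>

lemma right_limit_le:
  fixes f g :: "real \<Rightarrow> 'b :: linorder_topology"
  assumes x: "0 < x" "x < 1" and f: "(f \<longlongrightarrow> f x) (at_right x)" and g: "(g \<longlongrightarrow> g x) (at_right x)"
    and ae: "AE t in L. f t \<le> g t"
  shows "f x \<le> g x"
proof (rule ccontr)
  assume "\<not> f x \<le> g x"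
  then have lt: "g x < f x" by simp
  \<comment> \<open>In an order that is not dense there may be nothing between \<open>g x\<close>
    and \<open>f x\<close>; then these two values themselves serve as separators.\<close>
  obtain a b where ab: "g x < a" "b < f x" "\<And>s t. s < a \<Longrightarrow> b < t \<Longrightarrow> s < t"
  proof (cases "\<exists>c. g x < c \<and> c < f x")
    case True
    then obtain c where "g x < c" "c < f x" by blast
    then show ?thesis by (rule that[OF _ _ less_trans])
  next
    case False
    have sep: "s < t" if "s < f x" "g x < t" for s t
    proof (rule ccontr)
      assume "\<not> s < t"
      then have "t < f x" using \<open>s < f x\<close> by simp
      with False \<open>g x < t\<close> show False by blast
    qed
    show ?thesis by (rule that[OF lt lt sep])
  qed
  have "\<forall>\<^sub>F t in at_right x. g t < f t"
    using order_tendstoD(1)[OF f ab(2)] order_tendstoD(2)[OF g ab(1)]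
  proof eventually_elim
    case (elim t)
    then show ?case by (rule ab(3)[rotated])
  qed
  then obtain b where b: "x < b" "\<And>t. x < t \<Longrightarrow> t < b \<Longrightarrow> g t < f t"
    unfolding eventually_at_right_field by blast
  define c where "c = min b 1"
  have c: "x < c" "c \<le> 1" "c \<le> b" using b x by (auto simp: c_def)
  from ae have "AE t in lborel. t \<in> {0<..<1} \<longrightarrow> f t \<le> g t" by (subst (asm) AE_restrict_space_iff) auto
  then have "AE t in lborel. t \<notin> {x<..<c}"
  proof eventually_elim
    case (elim t)
    then show ?case using b(2)[of t] x c by force
  qed
  then have "emeasure lborel {t \<in> space lborel. \<not> t \<notin> {x<..<c}} = 0"
    by (subst (asm) AE_iff_measurable[OF _ refl]) auto
  moreover have "{t \<in> space lborel. \<not> t \<notin> {x<..<c}} = {x<..<c}" by auto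
  ultimately have "emeasure lborel {x<..<c} = 0" by metis
  then show False using c by simp
qed

lemma \<G>_AE_eq:
  assumes "P \<in> \<G>" "Q \<in> \<G>" "AE x in L. P x = Q x" "0 < x" "x < 1"
  shows "P x = Q x"
proof (rule antisym)
  show "P x \<le> Q x" using assms(3) by (intro right_limit_le assms \<G>_right) auto
  show "Q x \<le> P x" using assms(3) by (intro right_limit_le assms \<G>_right) auto
qed

section \<open>Integrals with values in the extended reals\<close>

lemma integral_defined_L: "integral_defined f \<longleftrightarrow>
    (\<integral>\<^sup>+x. e2ennreal (f x) \<partial>L) < \<infinity> \<or> (\<integral>\<^sup>+x. e2ennreal (- f x) \<partial>L) < \<infinity>"
  unfolding integral_defined_def nn_integral_L ..

lemma ext_integral_L: "ext_integral f = (if integral_defined f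
    then enn2ereal (\<integral>\<^sup>+x. e2ennreal (f x) \<partial>L) - enn2ereal (\<integral>\<^sup>+x. e2ennreal (- f x) \<partial>L) else -\<infinity>)"
  unfolding ext_integral_def nn_integral_L ..

lemma ext_integral_cong:
  assumes "\<And>x. x \<in> {0<..<1} \<Longrightarrow> f x = g x"
  shows "ext_integral f = ext_integral g"
proof -
  have "(\<integral>\<^sup>+x. e2ennreal (f x) \<partial>L) = (\<integral>\<^sup>+x. e2ennreal (g x) \<partial>L)"
    "(\<integral>\<^sup>+x. e2ennreal (- f x) \<partial>L) = (\<integral>\<^sup>+x. e2ennreal (- g x) \<partial>L)"
    by (intro nn_integral_cong; simp add: space_L assms)+
  then show ?thesis unfolding ext_integral_L integral_defined_L by simp
qed

lemma ext_integral_real: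
  assumes int: "integrable L g" and eq: "AE x in L. f x = ereal (g x)"
  shows "ext_integral f = ereal (\<integral>x. g x \<partial>L)"
proof -
  have P: "(\<integral>\<^sup>+x. e2ennreal (f x) \<partial>L) = (\<integral>\<^sup>+x. ennreal (g x) \<partial>L)"
    by (rule nn_integral_cong_AE[OF eventually_mono[OF eq]]) simp
  have N: "(\<integral>\<^sup>+x. e2ennreal (- f x) \<partial>L) = (\<integral>\<^sup>+x. ennreal (- g x) \<partial>L)"
    by (rule nn_integral_cong_AE[OF eventually_mono[OF eq]]) simp
  obtain p n where pn: "0 \<le> p" "0 \<le> n" "(\<integral>\<^sup>+x. ennreal (g x) \<partial>L) = ennreal p" "(\<integral>\<^sup>+x. ennreal (- g x) \<partial>L) = ennreal n"
    "(\<integral>x. g x \<partial>L) = p - n"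
    by (rule integrableE[OF int])
  then show ?thesis unfolding ext_integral_L integral_defined_L P N by simp
qed

lemma ext_integral_finite:
  assumes meas: "f \<in> borel_measurable L" and fin: "ext_integral f \<noteq> -\<infinity>" "ext_integral f \<noteq> \<infinity>"
  shows "AE x in L. f x = ereal (real_of_ereal (f x))" "integrable L (\<lambda>x. real_of_ereal (f x))"
    "ext_integral f = ereal (\<integral>x. real_of_ereal (f x) \<partial>L)"
proof -
  let ?P = "\<integral>\<^sup>+x. e2ennreal (f x) \<partial>L" and ?N = "\<integral>\<^sup>+x. e2ennreal (- f x) \<partial>L"
  have meas': "(\<lambda>x. e2ennreal (f x)) \<in> borel_measurable L" "(\<lambda>x. e2ennreal (- f x)) \<in> borel_measurable L"
    using meas by measurable
  \<comment> \<open>An undefined integral has value -\<infinity>, so excluding both infinite values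
    also gives definedness; then neither part can be infinite.\<close>
  have "integral_defined f" using fin by (auto simp: ext_integral_L split: if_splits)
  then have fin': "?P \<noteq> \<infinity>" "?N \<noteq> \<infinity>"
    using fin by (cases ?P; cases ?N; auto simp: ext_integral_L integral_defined_L)+
  have e2: "e2ennreal y = \<infinity> \<longleftrightarrow> y = \<infinity>" for y by (cases y) (auto simp: e2ennreal_neg)
  show ae: "AE x in L. f x = ereal (real_of_ereal (f x))"
    using nn_integral_PInf_AE[OF meas'(1) fin'(1)] nn_integral_PInf_AE[OF meas'(2) fin'(2)]
  proof eventually_elim
    case (elim x)
    then show ?case unfolding e2 by (cases "f x") auto
  qed
  have "(\<integral>\<^sup>+x. ennreal (norm (real_of_ereal (f x))) \<partial>L) \<le> (\<integral>\<^sup>+x. e2ennreal (f x) + e2ennreal (- f x) \<partial>L)"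
  proof (rule nn_integral_mono_AE)
    show "AE x in L. ennreal (norm (real_of_ereal (f x))) \<le> e2ennreal (f x) + e2ennreal (- f x)"
      using ae
    proof eventually_elim
      case (elim x)
      then obtain r where "f x = ereal r" by blast
      then show ?case by (cases "0 \<le> r") (auto simp: ennreal_neg)
    qed
  qed
  also have "\<dots> = ?P + ?N" using meas' by (rule nn_integral_add)
  also have "\<dots> < \<infinity>" using fin' by (simp add: less_top)
  finally show int: "integrable L (\<lambda>x. real_of_ereal (f x))"
    using meas by (intro integrableI_bounded) auto
  show "ext_integral f = ereal (\<integral>x. real_of_ereal (f x) \<partial>L)" by (rule ext_integral_real[OF int ae])
qed

text \<open>An integrable minorant makes the integral of the negative part finite, which gives
  definedness as well.\<close>

lemma ext_integral_lower:
  assumes int: "integrable L g" and le: "AE x in L. ereal (g x) \<le> f x"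
  shows "ext_integral f \<noteq> -\<infinity>"
proof -
  have "(\<integral>\<^sup>+x. e2ennreal (- f x) \<partial>L) \<le> (\<integral>\<^sup>+x. ennreal (norm (g x)) \<partial>L)"
  proof (rule nn_integral_mono_AE)
    show "AE x in L. e2ennreal (- f x) \<le> ennreal (norm (g x))"
      using le
    proof eventually_elim
      case (elim x)
      then have "- f x \<le> ereal (norm (g x))"
        by (cases "f x") auto
      from e2ennreal_mono[OF this] show ?case by simp
    qed
  qed
  also have "\<dots> < \<infinity>" using int by (auto simp: integrable_iff_bounded)
  finally have N: "(\<integral>\<^sup>+x. e2ennreal (- f x) \<partial>L) < \<infinity>" .
  then show ?thesis unfolding ext_integral_L integral_defined_L
    by (cases "\<integral>\<^sup>+x. e2ennreal (- f x) \<partial>L"; cases "\<integral>\<^sup>+x. e2ennreal (f x) \<partial>L") auto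
qed

section \<open>The penalized problem\<close>

text \<open>Every x eventually satisfies Q x \<le> n, and |a| + |b| dominates. The second branch
  allows any integrable substitute b where Q exceeds n.\<close>

lemma
  fixes a b Q :: "real \<Rightarrow> real"
  assumes Q: "Q \<in> borel_measurable L" and a: "integrable L a" and b: "integrable L b"
  shows cut_int: "\<And>n. integrable L (\<lambda>x. if Q x \<le> real n then a x else b x)"
    and cut_limit: "(\<lambda>n. \<integral>x. (if Q x \<le> real n then a x else b x) \<partial>L) \<longlonglongrightarrow> (\<integral>x. a x \<partial>L)"
proof -
  note [measurable] = Q
  have [measurable]: "a \<in> borel_measurable L" "b \<in> borel_measurable L" using a b by auto
  have dom: "integrable L (\<lambda>x. \<bar>a x\<bar> + \<bar>b x\<bar>)" using a b by simp
  show "integrable L (\<lambda>x. if Q x \<le> real n then a x else b x)" for n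
    by (rule Bochner_Integration.integrable_bound[OF dom]) auto
  show "(\<lambda>n. \<integral>x. (if Q x \<le> real n then a x else b x) \<partial>L) \<longlonglongrightarrow> (\<integral>x. a x \<partial>L)"
  proof (rule integral_dominated_convergence[OF _ _ dom])
    show "AE x in L. (\<lambda>n. if Q x \<le> real n then a x else b x) \<longlonglongrightarrow> a x"
    proof (rule AE_I2)
      fix x
      obtain N where N: "Q x \<le> real N" using real_arch_simple by blast
      show "(\<lambda>n. if Q x \<le> real n then a x else b x) \<longlonglongrightarrow> a x"
        by (rule tendsto_eventually, rule eventually_sequentiallyI[of N]) (use N in auto)
    qed
  qed auto
qed

lemma AE_eq_of_integral_le:
  fixes f g :: "real \<Rightarrow> real"
  assumes "integrable L f" "integrable L g" "AE x in L. f x \<le> g x" "(\<integral>x. g x \<partial>L) \<le> (\<integral>x. f x \<partial>L)"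
  shows "AE x in L. f x = g x"
proof -
  have nn: "AE x in L. 0 \<le> g x - f x" using assms(3) by eventually_elim simp
  have "(\<integral>x. g x - f x \<partial>L) = 0"
    using assms integral_mono_AE[OF assms(1-3)] by simp
  then have "AE x in L. g x - f x = 0"
    using integral_nonneg_eq_0_iff_AE[OF _ nn] assms(1,2) by simp
  then show ?thesis by eventually_elim simp
qed

locale market = utility u + pricing \<psi> for u \<psi> :: "real \<Rightarrow> real"
begin

text \<open>The multiplier c is positive in the penalized problem and 0 in the budget problem, where
  \<open>J 0\<close> is expected utility; both share the facts below.\<close>

definition obj where "obj c Q x = uu (Q x) - c * Q x * \<psi> x"

definition integrand where "integrand c Q x = util u (Q x) - ereal (c * Q x * \<psi> x)"

definition J where "J c Q = ext_integral (integrand c Q)"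

lemma integrand_dom: "Q x \<in> dom \<Longrightarrow> integrand c Q x = ereal (obj c Q x)"
  by (simp add: integrand_def obj_def util_dom)

lemma uu_meas: "Q \<in> \<G> \<Longrightarrow> (\<lambda>x. uu (Q x)) \<in> borel_measurable L"
  unfolding uu_def by (intro borel_measurable_real_of_ereal util_meas \<G>_meas \<G>_nonneg)

lemma obj_meas: "Q \<in> \<G> \<Longrightarrow> obj c Q \<in> borel_measurable L"
  unfolding obj_def[abs_def] using uu_meas[of Q] \<G>_meas[of Q] psi_meas by measurable

lemma integrand_meas: "Q \<in> \<G> \<Longrightarrow> integrand c Q \<in> borel_measurable L"
  unfolding integrand_def[abs_def] using util_meas[OF \<G>_meas \<G>_nonneg] \<G>_meas[of Q] psi_meas by measurable

lemma J_real:
  assumes "AE x in L. Q x \<in> dom" "integrable L (obj c Q)"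
  shows "J c Q = ereal (\<integral>x. obj c Q x \<partial>L)"
  unfolding J_def
proof (rule ext_integral_real[OF assms(2)])
  show "AE x in L. integrand c Q x = ereal (obj c Q x)"
    using assms(1) by eventually_elim (rule integrand_dom)
qed

lemma J_finite:
  assumes Q: "Q \<in> \<G>" and fin: "J c Q \<noteq> -\<infinity>" "J c Q \<noteq> \<infinity>"
  shows "AE x in L. Q x \<in> dom" "integrable L (obj c Q)" "J c Q = ereal (\<integral>x. obj c Q x \<partial>L)"
proof -
  note f = ext_integral_finite[OF integrand_meas[OF Q] fin[unfolded J_def]]
  show dom: "AE x in L. Q x \<in> dom"
    using f(1) AE_L_space
  proof eventually_elim
    case (elim x)
    show ?case
    proof (rule ccontr)
      assume "Q x \<notin> dom"
      then have "integrand c Q x = -\<infinity>" using util_not_dom[of "Q x"] \<G>_nonneg[OF Q, of x] elim by (simp add: integrand_def)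
      then show False using elim(1) by simp
    qed
  qed
  have "AE x in L. real_of_ereal (integrand c Q x) = obj c Q x"
    using dom by eventually_elim (simp add: integrand_dom)
  then show "integrable L (obj c Q)"
    using f(2) integrable_cong_AE[OF _ obj_meas[OF Q]] integrand_meas[OF Q] by (metis borel_measurable_real_of_ereal)
  then show "J c Q = ereal (\<integral>x. obj c Q x \<partial>L)" by (rule J_real[OF dom])
qed

lemma J_lower:
  assumes int: "integrable L g" and le: "AE x in L. Q x \<in> dom \<and> g x \<le> obj c Q x"
  shows "J c Q \<noteq> -\<infinity>"
  unfolding J_def
proof (rule ext_integral_lower[OF int])
  show "AE x in L. ereal (g x) \<le> integrand c Q x"
    using le by eventually_elim (simp add: integrand_dom)
qed

lemma J_const: "0 < k \<Longrightarrow> J c (\<lambda>_. k) = ereal (u k - c * k * (\<integral>x. \<psi> x \<partial>L))"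
  using psi_int L.prob_space by (subst J_real) (auto simp: obj_def[abs_def] dom_pos uu_pos)

text \<open>Only the midpoint is required to be no better than r, so the lemma serves both problems.
  Costs are linear, so the gain at the midpoint is a gain in utility; its integral must be 0, so it
  vanishes almost everywhere, and right-continuity removes the exceptional set.\<close>

lemma optimal_unique:
  assumes P: "P \<in> \<G>" and Q: "Q \<in> \<G>" and JP: "J c P = ereal r" and JQ: "J c Q = ereal r"
    and max: "J c (\<lambda>x. (1 - 1/2) * P x + 1/2 * Q x) \<le> ereal r"
    and x: "0 < x" "x < 1"
  shows "P x = Q x"
proof -
  define R where "R x = (1 - 1/2) * P x + 1/2 * Q x" for x
  have R: "R \<in> \<G>" unfolding R_def using \<G>_mix[OF P Q, of "1/2"] by simp
  have R2: "R x = (P x + Q x) / 2" for x by (simp add: R_def)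
  note fP = J_finite[OF P, of c, unfolded JP, simplified]
  note fQ = J_finite[OF Q, of c, unfolded JQ, simplified]
  define g where "g x = (obj c P x + obj c Q x) / 2" for x
  have gint: "integrable L g" unfolding g_def using fP fQ by auto
  have "AE x in L. R x \<in> dom \<and> g x \<le> obj c R x \<and> (g x = obj c R x \<longrightarrow> P x = Q x)"
    using fP(1) fQ(1)
  proof eventually_elim
    case (elim x)
    have "R x \<in> dom" unfolding R_def using dom_convex[OF elim, of "1/2"] by simp
    moreover have "c * R x * \<psi> x = (c * P x * \<psi> x + c * Q x * \<psi> x) / 2" by (simp add: R2 algebra_simps add_divide_distrib)
    then have "obj c R x - g x = uu (R x) - (uu (P x) + uu (Q x)) / 2"
      by (simp add: g_def obj_def field_simps)
    moreover have "P x = Q x \<Longrightarrow> uu (R x) = (uu (P x) + uu (Q x)) / 2" by (simp add: R2)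
    moreover have "P x \<noteq> Q x \<Longrightarrow> (uu (P x) + uu (Q x)) / 2 < uu (R x)" using midpoint[OF elim] by (simp add: R2)
    ultimately show ?case by (cases "P x = Q x") linarith+
  qed
  then have R': "AE x in L. R x \<in> dom \<and> g x \<le> obj c R x" "AE x in L. g x = obj c R x \<longrightarrow> P x = Q x"
    by (auto elim: eventually_mono)
  have JR: "J c R \<noteq> \<infinity>" using max unfolding R_def[symmetric] by auto
  note fR = J_finite[OF R J_lower[OF gint R'(1)] JR]
  have gr: "(\<integral>x. g x \<partial>L) = r" unfolding g_def using fP fQ by simp
  have "AE x in L. g x = obj c R x"
  proof (rule AE_eq_of_integral_le[OF gint fR(2)])
    show "AE x in L. g x \<le> obj c R x" using R'(1) by eventually_elim simp
    show "(\<integral>x. obj c R x \<partial>L) \<le> (\<integral>x. g x \<partial>L)" using max unfolding R_def[symmetric] fR(3) gr by simp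
  qed
  with R'(2) have "AE x in L. P x = Q x" by eventually_elim simp
  from \<G>_AE_eq[OF P Q this x] show ?thesis .
qed

text \<open>\<open>D\<close> decreases, so the maximizers increase. A right limit of maximizers is a
  maximizer at the limiting price, which by right-continuity of \<open>D\<close> is the price at x;
  uniqueness then gives right-continuity and the dependence on \<open>D x\<close> alone.\<close>

lemma
  assumes l: "0 < l" and max: "\<And>x. 0 < x \<Longrightarrow> x < 1 \<Longrightarrow> is_max S (l * D x) (Q x)"
    and S: "closed S" "convex S" "S \<subseteq> {0..}" "s \<in> S" "0 < s"
  shows is_max_\<G>: "Q \<in> \<G>"
    and is_max_factor: "\<forall>x\<in>{0<..<1}. \<forall>y\<in>{0<..<1}. D x = D y \<longrightarrow> Q x = Q y"
proof -
  show "\<forall>x\<in>{0<..<1}. \<forall>y\<in>{0<..<1}. D x = D y \<longrightarrow> Q x = Q y"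
  proof (intro ballI impI)
    fix x y assume *: "x \<in> {0<..<1}" "y \<in> {0<..<1}" "D x = D y"
    show "Q x = Q y" by (rule is_max_unique[OF S(2), of "l * D x"]) (use max[of x] max[of y] * in simp_all)
  qed
  have nn: "0 \<le> Q x" if "0 < x" "x < 1" for x using max[OF that] dom_nonneg by (simp add: is_max_def)
  have mono: "mono_on {0<..<1} Q"
  proof (rule mono_onI)
    fix x y :: real assume xy: "x \<in> {0<..<1}" "y \<in> {0<..<1}" "x \<le> y"
    show "Q x \<le> Q y"
      by (rule is_max_mono[OF S(2) max[of y] max[of x]]) (use xy l D_antimono[of x y] in auto)
  qed
  have rc: "(Q \<longlongrightarrow> Q x) (at_right x)" if x: "0 < x" "x < 1" for x
  proof -
    define q where "q = Inf (Q ` ({x<..} \<inter> {0<..<1}))"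
    have "(Q \<longlongrightarrow> q) (at x within ({x<..} \<inter> {0<..<1}))"
      unfolding q_def using nn by (intro Lim_right_bound[where K = 0]) (auto intro: mono_onD[OF mono])
    moreover have "at x within ({x<..} \<inter> {0<..<1}) = at_right x"
      using x by (intro at_within_nhd[of _ "{0<..<1}"]) auto
    ultimately have lim: "(Q \<longlongrightarrow> q) (at_right x)" by simp
    have "is_max S (l * D x) q"
    proof (rule is_max_limit[OF _ lim _ _ S(1,3-5)])
      show "((\<lambda>t. l * D t) \<longlongrightarrow> l * D x) (at_right x)"
        by (intro tendsto_intros D_right_continuous x)
      have "\<forall>\<^sub>F t in at_right x. t \<in> {x<..<1}" using x by (intro eventually_at_right_real) auto
      then show "\<forall>\<^sub>F t in at_right x. is_max S (l * D t) (Q t)"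
        by eventually_elim (use max x in auto)
    qed simp
    then have "q = Q x" using is_max_unique[OF S(2)] max[OF x] by blast
    with lim show ?thesis by simp
  qed
  show "Q \<in> \<G>" by (rule \<G>I[OF nn mono rc])
qed

text \<open>Capping wealth at m gives a maximizer at every price, by compactness, and bounded
  quantiles, whose costs are integrable.\<close>

definition trunc where "trunc l m x = (SOME y. is_max {0..m} (l * D x) y)"

text \<open>The penalized integrand with \<open>D\<close> in place of \<psi>.\<close>

definition hval where "hval l Q x = uu (Q x) - l * Q x * D x"

lemma trunc_max: "0 < m \<Longrightarrow> is_max {0..m} (l * D x) (trunc l m x)"
  unfolding trunc_def by (rule someI_ex) (rule is_max_exists)

lemma trunc_bounds: "0 < m \<Longrightarrow> 0 \<le> trunc l m x" "0 < m \<Longrightarrow> trunc l m x \<le> m" "0 < m \<Longrightarrow> trunc l m x \<in> dom"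
  using trunc_max[of m l x] by (auto simp: is_max_def)

lemma
  assumes "0 < l" "0 < m"
  shows trunc_\<G>: "trunc l m \<in> \<G>"
    and trunc_factor: "\<forall>x\<in>{0<..<1}. \<forall>y\<in>{0<..<1}. D x = D y \<longrightarrow> trunc l m x = trunc l m y"
  by (rule is_max_\<G>[OF assms(1), of "{0..m}" "trunc l m" m]; use trunc_max[OF assms(2)] assms(2) in simp)
    (rule is_max_factor[OF assms(1), of "{0..m}" "trunc l m" m]; use trunc_max[OF assms(2)] assms(2) in simp)

lemma bounded_cost:
  assumes mono: "mono_on {0<..<1} Q" and bnd: "\<And>x. 0 < x \<Longrightarrow> x < 1 \<Longrightarrow> 0 \<le> Q x \<and> Q x \<le> m"
  shows "integrable L (\<lambda>x. Q x * \<psi> x)" "integrable L (\<lambda>x. Q x * D x)"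
    "(\<integral>x. Q x * D x \<partial>L) \<le> (\<integral>x. Q x * \<psi> x \<partial>L)"
proof -
  show i: "integrable L (\<lambda>x. Q x * \<psi> x)"
    by (rule integrable_bounded_mult[OF measurable_L_mono[OF mono] psi_int, of m]) (use bnd in fastforce)
  show "integrable L (\<lambda>x. Q x * D x)" "(\<integral>x. Q x * D x \<partial>L) \<le> (\<integral>x. Q x * \<psi> x \<partial>L)"
    using cost_D_int[OF mono _ i] cost_D_le[OF mono _ i] bnd by auto
qed

lemma trunc_value:
  assumes l: "0 < l" and m: "1 \<le> m"
  shows "integrable L (hval l (trunc l m))"
    "integrable L (\<lambda>x. trunc l m x * \<psi> x)"
    "integrable L (\<lambda>x. trunc l m x * D x)"
    "(\<integral>x. trunc l m x * D x \<partial>L) = (\<integral>x. trunc l m x * \<psi> x \<partial>L)"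
proof -
  have m0: "0 < m" using m by simp
  note G = trunc_\<G>[OF l m0]
  have bnd: "0 \<le> trunc l m x \<and> trunc l m x \<le> m" for x using trunc_bounds[OF m0] by auto
  note c = bounded_cost[OF \<G>_mono[OF G], of m]
  show i: "integrable L (\<lambda>x. trunc l m x * \<psi> x)" "integrable L (\<lambda>x. trunc l m x * D x)" using c bnd by auto
  show "(\<integral>x. trunc l m x * D x \<partial>L) = (\<integral>x. trunc l m x * \<psi> x \<partial>L)"
    using cost_D_eq[OF \<G>_mono[OF G] _ i(1) trunc_factor[OF l m0]] bnd by auto
  have meas: "hval l (trunc l m) \<in> borel_measurable L"
    unfolding hval_def[abs_def] using uu_meas[OF G] \<G>_meas[OF G] D_measurable by measurable
  show "integrable L (hval l (trunc l m))"
  \<comment> \<open>Comparison with wealth 1, admissible because m \<ge> 1, bounds the value from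
    below; dropping the nonnegative cost leaves \<open>uu m\<close> as an upper bound.\<close>
  proof (rule Bochner_Integration.integrable_bound[where f = "\<lambda>x. \<bar>uu m\<bar> + \<bar>u 1 - l * D x\<bar>", OF _ meas])
    show "integrable L (\<lambda>x. \<bar>uu m\<bar> + \<bar>u 1 - l * D x\<bar>)" using D_int by auto
    show "AE x in L. norm (hval l (trunc l m) x) \<le> norm (\<bar>uu m\<bar> + \<bar>u 1 - l * D x\<bar>)"
      using AE_L_space
    proof eventually_elim
      case (elim x)
      have "u 1 - l * D x \<le> hval l (trunc l m) x"
        using is_maxD[OF trunc_max[OF m0, of l x], of 1] m by (simp add: hval_def dom_pos uu_pos mult_ac)
      moreover have "uu (trunc l m x) \<le> uu m" using trunc_bounds[OF m0, of l x] by (intro uu_le)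
      moreover have "0 \<le> l * trunc l m x * D x"
        using l bnd[of x] D_nonneg[of x] elim by (intro mult_nonneg_nonneg) auto
      ultimately show ?case by (simp add: hval_def)
    qed
  qed
qed

lemma hval_le_trunc:
  assumes "0 < m" "Q x \<in> dom" "Q x \<le> m"
  shows "hval l Q x \<le> hval l (trunc l m) x"
  using is_maxD[OF trunc_max[OF assms(1), of l x], of "Q x"] assms dom_nonneg[OF assms(2)]
  by (simp add: hval_def mult_ac)

text \<open>A truncated maximizer is a function of \<open>D\<close>, so its costs under
  \<open>D\<close> and \<psi> agree and cancel.\<close>

lemma J_trunc:
  assumes l: "0 < l" and m: "1 \<le> m"
  shows "J l (trunc l m) = ereal (\<integral>x. hval l (trunc l m) x \<partial>L)"
proof -
  have m0: "0 < m" using m by simp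
  note t = trunc_value[OF assms]
  have eq: "obj l (trunc l m) = (\<lambda>x. hval l (trunc l m) x + l * (trunc l m x * D x) - l * (trunc l m x * \<psi> x))"
    by (auto simp: obj_def hval_def)
  have "integrable L (obj l (trunc l m))" unfolding eq using t by auto
  moreover have "(\<integral>x. obj l (trunc l m) x \<partial>L) = (\<integral>x. hval l (trunc l m) x \<partial>L)"
    unfolding eq using t by simp
  ultimately show ?thesis using J_real[of "trunc l m" l] trunc_bounds[OF m0] by simp
qed

text \<open>Capping \<open>Q\<close> at \<open>n\<close> makes all costs integrable; since the integrand is quasi-concave in
  the quantile, the capped integrand stays above an integrable function.\<close>

lemma objective_le_trunc:
  assumes l: "0 < l" and Q: "Q \<in> \<G>" and dom: "AE x in L. Q x \<in> dom" and int: "integrable L (obj l Q)"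
    and bnd: "\<And>n::nat. 1 \<le> real n \<Longrightarrow> (\<integral>x. hval l (trunc l (real n)) x \<partial>L) \<le> B"
  shows "(\<integral>x. obj l Q x \<partial>L) \<le> B"
proof -
  \<comment> \<open>If Q x exceeds n, the cap n lies between 1 and Q x, so quasi-concavity bounds
    the capped integrand from below by the smaller of the values at Q x and at wealth 1.\<close>
  define b where "b x = min (obj l Q x) (u 1 - l * \<psi> x)" for x
  have bint: "integrable L b" unfolding b_def using int psi_int by auto
  define k where "k n x = (if Q x \<le> real n then obj l Q x else b x)" for n x
  have kint: "integrable L (k n)" for n unfolding k_def by (rule cut_int[OF \<G>_meas[OF Q] int bint])
  have lim: "(\<lambda>n. \<integral>x. k n x \<partial>L) \<longlonglongrightarrow> (\<integral>x. obj l Q x \<partial>L)"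
    unfolding k_def by (rule cut_limit[OF \<G>_meas[OF Q] int bint])
  have le_B: "(\<integral>x. k n x \<partial>L) \<le> B" if n1: "1 \<le> real n" for n
  proof -
    define W where "W x = min (Q x) (real n)" for x
    have W: "W \<in> \<G>" unfolding W_def by (rule \<G>_min[OF Q]) simp
    have Wb: "0 \<le> W x \<and> W x \<le> real n" if "0 < x" "x < 1" for x
      using \<G>_nonneg[OF Q that] by (simp add: W_def)
    note c = bounded_cost[OF \<G>_mono[OF W] Wb]
    note t = trunc_value[OF l n1]
    have "AE x in L. k n x \<le> hval l (trunc l (real n)) x + l * (W x * D x) - l * (W x * \<psi> x)"
      using dom
    proof eventually_elim
      case (elim x)
      have Wd: "W x \<in> dom" using elim n1 dom_pos[of "real n"] by (simp add: W_def min_def)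
      have "k n x \<le> obj l W x"
      proof (cases "Q x \<le> real n")
        case False
        then have "b x \<le> obj l W x"
          using quasi_concave[of 1 "real n" "Q x" "l * \<psi> x"] n1
          by (simp add: b_def obj_def W_def dom_pos uu_pos mult_ac min.commute)
        then show ?thesis using False by (simp add: k_def)
      qed (simp add: k_def obj_def W_def)
      also have "obj l W x = hval l W x + l * (W x * D x) - l * (W x * \<psi> x)" by (simp add: obj_def hval_def)
      also have "hval l W x \<le> hval l (trunc l (real n)) x" using n1 Wd by (intro hval_le_trunc) (auto simp: W_def)
      finally show ?case by simp
    qed
    then have "(\<integral>x. k n x \<partial>L) \<le> (\<integral>x. hval l (trunc l (real n)) x + l * (W x * D x) - l * (W x * \<psi> x) \<partial>L)"
      using kint t c by (intro integral_mono_AE) auto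
    also have "\<dots> = (\<integral>x. hval l (trunc l (real n)) x \<partial>L) + l * (\<integral>x. W x * D x \<partial>L) - l * (\<integral>x. W x * \<psi> x \<partial>L)"
      using t c by simp
    also have "\<dots> \<le> (\<integral>x. hval l (trunc l (real n)) x \<partial>L)" using c(3) l by simp
    finally show ?thesis using bnd[OF n1] by simp
  qed
  show ?thesis by (rule LIMSEQ_le_const2[OF lim], rule exI[of _ 1]) (use le_B in auto)
qed

text \<open>At each x, once n reaches Q x, the truncated maximizer does at least as well as Q.
  Fatou, applied after subtracting the integrable value at wealth 1, turns the uniform bound B into
  integrability.\<close>

lemma
  assumes l: "0 < l" and max: "\<And>x. 0 < x \<Longrightarrow> x < 1 \<Longrightarrow> is_max {0..} (l * D x) (Q x)"
    and bnd: "\<And>n::nat. 1 \<le> real n \<Longrightarrow> (\<integral>x. hval l (trunc l (real n)) x \<partial>L) \<le> B"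
  shows hval_max_int: "integrable L (hval l Q)"
    and trunc_le_max: "\<And>n::nat. 1 \<le> real n \<Longrightarrow> (\<integral>x. hval l (trunc l (real n)) x \<partial>L) \<le> (\<integral>x. hval l Q x \<partial>L)"
proof -
  have Q: "Q \<in> \<G>" by (rule is_max_\<G>[OF l max, of 1]) simp_all
  have meas: "hval l Q \<in> borel_measurable L"
    unfolding hval_def[abs_def] using uu_meas[OF Q] \<G>_meas[OF Q] D_measurable by measurable
  have le: "hval l (trunc l m) x \<le> hval l Q x" if "0 < m" "0 < x" "x < 1" for m x
    using is_maxD[OF max[OF that(2,3)], of "trunc l m x"] trunc_bounds[OF that(1)] by (simp add: hval_def mult_ac)
  define e where "e x = u 1 - l * D x" for x
  have eint: "integrable L e" unfolding e_def using D_int by auto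
  have e_le: "e x \<le> hval l (trunc l m) x" if "1 \<le> m" for m x
    using is_maxD[OF trunc_max[of m l x], of 1] that by (simp add: hval_def e_def dom_pos uu_pos mult_ac)
  have fatou: "(\<integral>\<^sup>+x. ennreal (hval l Q x - e x) \<partial>L) \<le> ennreal (B - (\<integral>x. e x \<partial>L))"
  proof -
    \<comment> \<open>The index \<open>Suc n\<close> guarantees that wealth 1 is admissible.\<close>
    let ?h = "\<lambda>n x. ennreal (hval l (trunc l (real (Suc n))) x - e x)"
    have hint: "integrable L (hval l (trunc l (real (Suc n))))" for n using trunc_value(1)[OF l, of "real (Suc n)"] by simp
    have "(\<integral>\<^sup>+x. ennreal (hval l Q x - e x) \<partial>L) \<le> (\<integral>\<^sup>+x. liminf (\<lambda>n. ?h n x) \<partial>L)"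
    proof (rule nn_integral_mono)
      fix x assume "x \<in> space L"
      then have x: "0 < x" "x < 1" by (auto simp: space_L)
      obtain N where N: "Q x \<le> real N" using real_arch_simple by blast
      have "ennreal (hval l Q x - e x) \<le> ?h n x" if "N \<le> n" for n
        using hval_le_trunc[of "real (Suc n)" Q x l] N that max[OF x] by (intro ennreal_leI) (simp add: is_max_def)
      then show "ennreal (hval l Q x - e x) \<le> liminf (\<lambda>n. ?h n x)"
        by (intro Liminf_bounded eventually_sequentiallyI[of N]) auto
    qed
    also have "\<dots> \<le> liminf (\<lambda>n. \<integral>\<^sup>+x. ?h n x \<partial>L)"
      using hint eint by (intro nn_integral_liminf) auto
    also have "(\<lambda>n. \<integral>\<^sup>+x. ?h n x \<partial>L) = (\<lambda>n. ennreal ((\<integral>x. hval l (trunc l (real (Suc n))) x \<partial>L) - (\<integral>x. e x \<partial>L)))"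
    proof
      fix n
      have "(\<integral>\<^sup>+x. ?h n x \<partial>L) = ennreal (\<integral>x. hval l (trunc l (real (Suc n))) x - e x \<partial>L)"
        using hint eint e_le[of "real (Suc n)"] by (intro nn_integral_eq_integral) auto
      then show "(\<integral>\<^sup>+x. ?h n x \<partial>L) = ennreal ((\<integral>x. hval l (trunc l (real (Suc n))) x \<partial>L) - (\<integral>x. e x \<partial>L))"
        using hint eint by simp
    qed
    also have "liminf \<dots> \<le> limsup (\<lambda>n::nat. ennreal (B - (\<integral>x. e x \<partial>L)))"
      by (rule order_trans[OF Liminf_le_Limsup Limsup_mono]) (use bnd[of "Suc _"] in \<open>auto intro!: ennreal_leI always_eventually\<close>)
    also have "\<dots> = ennreal (B - (\<integral>x. e x \<partial>L))" by (simp add: Limsup_const)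
    finally show ?thesis .
  qed
  have "integrable L (\<lambda>x. hval l Q x - e x)"
  proof (rule integrableI_nonneg)
    show "(\<lambda>x. hval l Q x - e x) \<in> borel_measurable L" using meas eint by auto
    show "AE x in L. 0 \<le> hval l Q x - e x"
      using AE_L_space
    proof eventually_elim
      case (elim x)
      then show ?case using le[of 1 x] e_le[of 1 x] by auto
    qed
    show "(\<integral>\<^sup>+x. ennreal (hval l Q x - e x) \<partial>L) < \<infinity>" using fatou by (auto intro: le_less_trans)
  qed
  from Bochner_Integration.integrable_add[OF this eint] show i: "integrable L (hval l Q)" by simp
  fix n :: nat assume n: "1 \<le> real n"
  show "(\<integral>x. hval l (trunc l (real n)) x \<partial>L) \<le> (\<integral>x. hval l Q x \<partial>L)"
    using n trunc_value(1)[OF l, of "real n"] i le[of "real n"]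
    by (intro integral_mono) (auto simp: space_L)
qed

text \<open>Neither Q D nor Q \<psi> need be integrable, so the two costs are exchanged only on {Q
  \<le> n}. Fatou then bounds the negative part of the objective, and n tends to infinity.\<close>

lemma objective_of_max:
  assumes l: "0 < l" and max: "\<And>x. 0 < x \<Longrightarrow> x < 1 \<Longrightarrow> is_max {0..} (l * D x) (Q x)"
    and hint: "integrable L (hval l Q)"
    and idef: "integral_defined (integrand l Q)" and fin: "J l Q \<noteq> \<infinity>"
  shows "J l Q = ereal (\<integral>x. hval l Q x \<partial>L)"
proof -
  have Q: "Q \<in> \<G>" by (rule is_max_\<G>[OF l max, of 1]) simp_all
  have fac: "\<forall>x\<in>{0<..<1}. \<forall>y\<in>{0<..<1}. D x = D y \<longrightarrow> Q x = Q y" by (rule is_max_factor[OF l max, of 1]) simp_all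
  have dom: "Q x \<in> dom" if "0 < x" "x < 1" for x using max[OF that] by (simp add: is_max_def)
  have domAE: "AE x in L. Q x \<in> dom" using AE_L_space by eventually_elim (use dom in auto)
  have hmeas: "hval l Q \<in> borel_measurable L" using hint by auto
  note omeas = obj_meas[OF Q, of l]
  have cut: "integrable L (\<lambda>x. if Q x \<le> real n then obj l Q x else 0)
    \<and> (\<integral>x. (if Q x \<le> real n then obj l Q x else 0) \<partial>L) = (\<integral>x. (if Q x \<le> real n then hval l Q x else 0) \<partial>L)" for n :: nat
  proof -
    \<comment> \<open>W - Z is Q on {Q \<le> n} and 0 elsewhere. Unlike this difference, W and Z are
      both increasing, and they are functions of \<open>D\<close>, so the cost identity applies to
      each.\<close>
    define W where "W x = min (Q x) (real n)" for x
    define Z where "Z x = (if Q x \<le> real n then 0 else real n)" for x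
    have Wm: "mono_on {0<..<1} W" unfolding W_def by (rule \<G>_mono[OF \<G>_min[OF Q]]) simp
    have Zm: "mono_on {0<..<1} Z"
      using mono_onD[OF \<G>_mono[OF Q]] unfolding Z_def by (intro mono_onI) (auto dest: order_trans)
    have bd: "0 \<le> W x \<and> W x \<le> real n" "0 \<le> Z x \<and> Z x \<le> real n" if "0 < x" "x < 1" for x
      using \<G>_nonneg[OF Q that] by (auto simp: W_def Z_def)
    have WZ: "W x = W y" "Z x = Z y" if "Q x = Q y" for x y
      using that by (simp_all add: W_def Z_def)
    have Wf: "\<forall>x\<in>{0<..<1}. \<forall>y\<in>{0<..<1}. D x = D y \<longrightarrow> W x = W y"
      and Zf: "\<forall>x\<in>{0<..<1}. \<forall>y\<in>{0<..<1}. D x = D y \<longrightarrow> Z x = Z y"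
      using fac WZ by blast+
    note cW = bounded_cost[OF Wm bd(1)] and cZ = bounded_cost[OF Zm bd(2)]
    have eW: "(\<integral>x. W x * D x \<partial>L) = (\<integral>x. W x * \<psi> x \<partial>L)" by (rule cost_D_eq[OF Wm _ cW(1) Wf]) (use bd in auto)
    have eZ: "(\<integral>x. Z x * D x \<partial>L) = (\<integral>x. Z x * \<psi> x \<partial>L)" by (rule cost_D_eq[OF Zm _ cZ(1) Zf]) (use bd in auto)
    have eq: "(if Q x \<le> real n then obj l Q x else 0) = (if Q x \<le> real n then hval l Q x else 0)
        + l * (W x * D x) - l * (Z x * D x) - l * (W x * \<psi> x) + l * (Z x * \<psi> x)" for x
      by (auto simp: W_def Z_def obj_def hval_def)
    have hc: "integrable L (\<lambda>x. if Q x \<le> real n then hval l Q x else 0)"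
      by (rule cut_int[OF \<G>_meas[OF Q] hint]) simp
    show ?thesis unfolding eq using hc cW cZ eW eZ by simp
  qed
  have P: "(\<integral>\<^sup>+x. ennreal (obj l Q x) \<partial>L) < \<infinity>"
  proof -
    have eq: "(\<integral>\<^sup>+x. e2ennreal (integrand l Q x) \<partial>L) = (\<integral>\<^sup>+x. ennreal (obj l Q x) \<partial>L)"
      by (intro nn_integral_cong) (simp add: space_L integrand_dom dom)
    \<comment> \<open>An infinite positive part would, the integral being defined, make
      \<open>J l Q\<close> infinite.\<close>
    have "(\<integral>\<^sup>+x. e2ennreal (integrand l Q x) \<partial>L) < \<infinity>"
    proof (rule ccontr)
      assume "\<not> ?thesis"
      then show False using idef fin unfolding J_def ext_integral_L integral_defined_L
        by (cases "\<integral>\<^sup>+x. e2ennreal (- integrand l Q x) \<partial>L") (auto simp: not_less top_unique)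
    qed
    then show ?thesis unfolding eq .
  qed
  have pint: "integrable L (\<lambda>x. max 0 (obj l Q x))"
  proof (rule integrableI_nonneg)
    have "(\<integral>\<^sup>+x. ennreal (max 0 (obj l Q x)) \<partial>L) = (\<integral>\<^sup>+x. ennreal (obj l Q x) \<partial>L)"
      by (intro nn_integral_cong) (auto simp: max_def ennreal_neg)
    then show "(\<integral>\<^sup>+x. ennreal (max 0 (obj l Q x)) \<partial>L) < \<infinity>" using P by simp
  qed (use omeas in auto)
  \<comment> \<open>On each cut the negative part integrates to the positive part minus the
    objective, and the latter has the same integral as the cut \<open>hval\<close>; \<open>C\<close>
    bounds this uniformly in n.\<close>
  define C where "C = (\<integral>x. max 0 (obj l Q x) \<partial>L) + (\<integral>x. \<bar>hval l Q x\<bar> \<partial>L)"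
  have N: "(\<integral>\<^sup>+x. ennreal (- obj l Q x) \<partial>L) \<le> ennreal C"
  proof -
    let ?f = "\<lambda>n x. ennreal (- (if Q x \<le> real n then obj l Q x else 0))"
    have "(\<integral>\<^sup>+x. ennreal (- obj l Q x) \<partial>L) \<le> (\<integral>\<^sup>+x. liminf (\<lambda>n. ?f n x) \<partial>L)"
    proof (rule nn_integral_mono)
      fix x
      obtain N where N: "Q x \<le> real N" using real_arch_simple by blast
      show "ennreal (- obj l Q x) \<le> liminf (\<lambda>n. ?f n x)"
        by (intro Liminf_bounded eventually_sequentiallyI[of N]) (use N in auto)
    qed
    also have "\<dots> \<le> liminf (\<lambda>n. \<integral>\<^sup>+x. ?f n x \<partial>L)"
      by (intro nn_integral_liminf measurable_compose[OF _ measurable_ennreal] borel_measurable_uminus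
          borel_measurable_integrable conjunct1[OF cut])
    also have "\<dots> \<le> limsup (\<lambda>n::nat. ennreal C)"
    proof (rule order_trans[OF Liminf_le_Limsup Limsup_mono])
      have "(\<integral>\<^sup>+x. ?f n x \<partial>L) \<le> ennreal C" for n :: nat
      proof -
        let ?o = "\<lambda>x. if Q x \<le> real n then obj l Q x else 0"
        have pc: "integrable L (\<lambda>x. if Q x \<le> real n then max 0 (obj l Q x) else 0)"
          by (rule cut_int[OF \<G>_meas[OF Q] pint]) simp
        have hc: "integrable L (\<lambda>x. if Q x \<le> real n then hval l Q x else 0)"
          by (rule cut_int[OF \<G>_meas[OF Q] hint]) simp
        let ?g = "\<lambda>x. (if Q x \<le> real n then max 0 (obj l Q x) else 0) - ?o x"
        have "(\<integral>\<^sup>+x. ?f n x \<partial>L) \<le> (\<integral>\<^sup>+x. ennreal (?g x) \<partial>L)"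
          by (intro nn_integral_mono ennreal_leI) auto
        also have "\<dots> = ennreal (\<integral>x. ?g x \<partial>L)"
          using cut[of n] pc by (intro nn_integral_eq_integral) auto
        also have "(\<integral>x. ?g x \<partial>L) = (\<integral>x. (if Q x \<le> real n then max 0 (obj l Q x) else 0) \<partial>L) - (\<integral>x. (if Q x \<le> real n then hval l Q x else 0) \<partial>L)"
          using cut[of n] pc by simp
        also have "\<dots> \<le> C"
        proof -
          have "(\<integral>x. (if Q x \<le> real n then max 0 (obj l Q x) else 0) \<partial>L) \<le> (\<integral>x. max 0 (obj l Q x) \<partial>L)"
            by (rule integral_mono[OF pc pint]) auto
          moreover have "(\<integral>x. - \<bar>hval l Q x\<bar> \<partial>L) \<le> (\<integral>x. (if Q x \<le> real n then hval l Q x else 0) \<partial>L)"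
            by (rule integral_mono[OF _ hc]) (use hint in auto)
          ultimately show ?thesis unfolding C_def by simp
        qed
        finally show ?thesis by (simp add: ennreal_leI)
      qed
      then show "\<forall>\<^sub>F n in sequentially. (\<integral>\<^sup>+x. ?f n x \<partial>L) \<le> ennreal C" by simp
    qed simp
    also have "\<dots> = ennreal C" by (simp add: Limsup_const)
    finally show ?thesis .
  qed
  have oint: "integrable L (obj l Q)"
  proof (rule integrableI_bounded[OF omeas])
    have "(\<integral>\<^sup>+x. ennreal (norm (obj l Q x)) \<partial>L) = (\<integral>\<^sup>+x. ennreal (obj l Q x) + ennreal (- obj l Q x) \<partial>L)"
      by (intro nn_integral_cong) (auto simp: abs_if ennreal_neg)
    also have "\<dots> = (\<integral>\<^sup>+x. ennreal (obj l Q x) \<partial>L) + (\<integral>\<^sup>+x. ennreal (- obj l Q x) \<partial>L)"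
      using omeas by (intro nn_integral_add) auto
    also have "\<dots> < \<infinity>" using P N by (auto simp: less_top[symmetric] top_unique)
    finally show "(\<integral>\<^sup>+x. ennreal (norm (obj l Q x)) \<partial>L) < \<infinity>" .
  qed
  have "(\<lambda>n. \<integral>x. (if Q x \<le> real n then obj l Q x else 0) \<partial>L) \<longlonglongrightarrow> (\<integral>x. obj l Q x \<partial>L)"
    by (rule cut_limit[OF \<G>_meas[OF Q] oint]) simp
  moreover have "(\<lambda>n. \<integral>x. (if Q x \<le> real n then obj l Q x else 0) \<partial>L) \<longlonglongrightarrow> (\<integral>x. hval l Q x \<partial>L)"
    unfolding conjunct2[OF cut] by (rule cut_limit[OF \<G>_meas[OF Q] hint]) simp
  ultimately have "(\<integral>x. obj l Q x \<partial>L) = (\<integral>x. hval l Q x \<partial>L)" by (rule LIMSEQ_unique)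
  then show ?thesis using J_real[OF domAE oint] by simp
qed

text \<open>The finite supremum s first serves as the bound B that makes \<open>hval l Qs\<close>
  integrable. The integral of \<open>hval l Qs\<close> then takes over as B in
  \<open>objective_le_trunc\<close>, which shows that \<open>Qs\<close> is at least as good as every
  admissible quantile.\<close>

theorem penalized_optimal_iff:
  assumes l: "0 < l" and max: "\<And>x. 0 < x \<Longrightarrow> x < 1 \<Longrightarrow> is_max {0..} (l * D x) (Qs x)"
    and wp: "well_posed \<G> (J l)" and idef: "integral_defined (integrand l Qs)"
  shows "optimal \<G> (J l) Q \<longleftrightarrow> (\<forall>x\<in>{0<..<1}. Q x = Qs x)"
proof -
  define S where "S = (SUP Q\<in>\<G>. J l Q)"
  have S: "S < \<infinity>" using wp by (simp add: well_posed_def S_def)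
  have upper: "J l Q \<le> S" if "Q \<in> \<G>" for Q unfolding S_def using that by (rule SUP_upper)
  have "J l (\<lambda>_. 1) \<le> S" by (rule upper) (simp add: \<G>_const)
  with S obtain s where s: "S = ereal s" by (cases S) (auto simp: J_const)
  have G: "Qs \<in> \<G>" by (rule is_max_\<G>[OF l max, of 1]) simp_all
  have bnd: "(\<integral>x. hval l (trunc l (real n)) x \<partial>L) \<le> s" if "1 \<le> real n" for n :: nat
    using upper[OF trunc_\<G>[OF l, of "real n"]] J_trunc[OF l, of "real n"] that s by simp
  note h = hval_max_int[OF l max bnd] and t = trunc_le_max[OF l max bnd]
  have fin: "J l Qs \<noteq> \<infinity>" using upper[OF G] S by auto
  have val: "J l Qs = ereal (\<integral>x. hval l Qs x \<partial>L)" by (rule objective_of_max[OF l max h idef fin])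
  have le: "J l Q \<le> J l Qs" if Q: "Q \<in> \<G>" for Q
  proof (cases "J l Q = -\<infinity>")
    case False
    have "J l Q \<noteq> \<infinity>" using upper[OF Q] S by auto
    note f = J_finite[OF Q False this]
    have "(\<integral>x. obj l Q x \<partial>L) \<le> (\<integral>x. hval l Qs x \<partial>L)"
      by (rule objective_le_trunc[OF l Q f(1,2) t])
    then show ?thesis using f(3) val by simp
  qed simp
  have SS: "S = J l Qs" using upper[OF G] le unfolding S_def by (intro antisym SUP_least) auto
  show ?thesis
  proof
    assume opt: "optimal \<G> (J l) Q"
    then have Q: "Q \<in> \<G>" "J l Q = S" by (auto simp: optimal_def S_def)
    have "J l (\<lambda>x. (1 - 1/2) * Q x + 1/2 * Qs x) \<le> S" using Q(1) G by (intro upper \<G>_mix) auto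
    then show "\<forall>x\<in>{0<..<1}. Q x = Qs x"
      using optimal_unique[OF Q(1) G, of l s] Q(2) SS s by auto
  next
    assume eq: "\<forall>x\<in>{0<..<1}. Q x = Qs x"
    have "Q \<in> \<G>" by (rule \<G>_cong[OF G]) (use eq in auto)
    moreover have "J l Q = J l Qs" unfolding J_def by (rule ext_integral_cong) (use eq in \<open>auto simp: integrand_def\<close>)
    ultimately show "optimal \<G> (J l) Q" using SS by (simp add: optimal_def S_def)
  qed
qed

end

section \<open>The budget problem and its Lagrange multiplier\<close>

context market
begin

definition budget_set where
  "budget_set c = {Q \<in> \<G>. ext_integral (\<lambda>x. ereal (Q x * \<psi> x)) = ereal c}"

text \<open>Utility and cost are separately integrable, so that the Lagrangian is an expression in
  real numbers. Budget quantiles of finite expected utility are of this kind by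
  \<open>tameI\<close>.\<close>

definition tame where
  "tame Q \<longleftrightarrow> Q \<in> \<G> \<and> (AE x in L. Q x \<in> dom) \<and> integrable L (\<lambda>x. uu (Q x)) \<and> integrable L (\<lambda>x. Q x * \<psi> x)"

definition EU where "EU Q = (\<integral>x. uu (Q x) \<partial>L)"

definition C where "C Q = (\<integral>x. Q x * \<psi> x \<partial>L)"

lemma budget_set_iff:
  "Q \<in> budget_set c \<longleftrightarrow> Q \<in> \<G> \<and> integrable L (\<lambda>x. Q x * \<psi> x) \<and> C Q = c"
proof safe
  assume "Q \<in> budget_set c"
  then have Q: "Q \<in> \<G>" and eq: "ext_integral (\<lambda>x. ereal (Q x * \<psi> x)) = ereal c" by (auto simp: budget_set_def)
  show "Q \<in> \<G>" by (rule Q)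
  have "(\<lambda>x. ereal (Q x * \<psi> x)) \<in> borel_measurable L" using \<G>_meas[OF Q] psi_meas by measurable
  from ext_integral_finite[OF this] eq show "integrable L (\<lambda>x. Q x * \<psi> x)" "C Q = c" by (auto simp: C_def)
qed (auto simp: budget_set_def C_def intro: ext_integral_real)

lemma obj_0: "obj 0 Q = (\<lambda>x. uu (Q x))"
  by (auto simp: obj_def)

lemma J_tame: "tame Q \<Longrightarrow> J 0 Q = ereal (EU Q)"
  unfolding tame_def EU_def using J_real[of Q 0] by (simp add: obj_0)

lemma tameI:
  assumes "Q \<in> budget_set c" "J 0 Q \<noteq> -\<infinity>" "J 0 Q \<noteq> \<infinity>"
  shows "tame Q"
  using assms J_finite[of Q 0] unfolding tame_def obj_0 by (auto simp: budget_set_iff)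

lemma const_tame: "0 < k \<Longrightarrow> tame (\<lambda>_. k)" and const_C: "C (\<lambda>_. k) = k * (\<integral>x. \<psi> x \<partial>L)"
  using psi_int by (auto simp: tame_def C_def \<G>_const dom_pos)

text \<open>Concavity bounds the utility of the mixture from below; monotonicity bounds it from
  above, since R \<le> max P Q pointwise.\<close>

lemma
  assumes P: "tame P" and Q: "tame Q" and t: "0 \<le> t" "t \<le> 1"
  defines "R \<equiv> \<lambda>x. (1 - t) * P x + t * Q x"
  shows tame_mix: "tame R" and EU_mix: "(1 - t) * EU P + t * EU Q \<le> EU R" and C_mix: "C R = (1 - t) * C P + t * C Q"
proof -
  note p = P[unfolded tame_def] and q = Q[unfolded tame_def]
  have R: "R \<in> \<G>" unfolding R_def using p q t by (intro \<G>_mix) auto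
  have ae: "AE x in L. R x \<in> dom \<and> (1 - t) * uu (P x) + t * uu (Q x) \<le> uu (R x) \<and> uu (R x) \<le> \<bar>uu (P x)\<bar> + \<bar>uu (Q x)\<bar>"
    using conjunct1[OF conjunct2[OF p]] conjunct1[OF conjunct2[OF q]]
  proof eventually_elim
    case (elim x)
    have Rd: "R x \<in> dom" unfolding R_def by (rule dom_convex[OF elim t])
    have "R x \<le> (1 - t) * max (P x) (Q x) + t * max (P x) (Q x)"
      unfolding R_def using t by (intro add_mono mult_left_mono) auto
    also have "\<dots> = max (P x) (Q x)" by (simp add: algebra_simps)
    finally have "uu (R x) \<le> uu (max (P x) (Q x))" by (rule uu_le[OF Rd])
    also have "\<dots> \<le> \<bar>uu (P x)\<bar> + \<bar>uu (Q x)\<bar>" by (auto simp: max_def)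
    finally show ?case using Rd concave[OF elim t] by (simp add: R_def)
  qed
  have "integrable L (\<lambda>x. uu (R x))"
  proof (rule Bochner_Integration.integrable_bound[where f = "\<lambda>x. \<bar>uu (P x)\<bar> + \<bar>uu (Q x)\<bar> + \<bar>(1 - t) * uu (P x) + t * uu (Q x)\<bar>", OF _ uu_meas[OF R]])
    show "AE x in L. norm (uu (R x)) \<le> norm (\<bar>uu (P x)\<bar> + \<bar>uu (Q x)\<bar> + \<bar>(1 - t) * uu (P x) + t * uu (Q x)\<bar>)"
      using ae by eventually_elim auto
  qed (use p q in auto)
  moreover have eq: "R x * \<psi> x = (1 - t) * (P x * \<psi> x) + t * (Q x * \<psi> x)" for x by (simp add: R_def algebra_simps)
  have "integrable L (\<lambda>x. R x * \<psi> x)" unfolding eq using p q by auto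
  moreover have "AE x in L. R x \<in> dom" using ae by eventually_elim simp
  ultimately show nR: "tame R" using R by (simp add: tame_def)
  show "C R = (1 - t) * C P + t * C Q" unfolding C_def eq using p q by simp
  have "(\<integral>x. (1 - t) * uu (P x) + t * uu (Q x) \<partial>L) \<le> EU R"
    unfolding EU_def
  proof (rule integral_mono_AE)
    show "AE x in L. (1 - t) * uu (P x) + t * uu (Q x) \<le> uu (R x)" using ae by eventually_elim simp
  qed (use p q nR in \<open>auto simp: tame_def\<close>)
  then show "(1 - t) * EU P + t * EU Q \<le> EU R" unfolding EU_def using p q by simp
qed

text \<open>The multiplier is the largest slope of a chord from the budget \<open>c\<close> to a larger budget in the
  hypograph of the (concave) value function.\<close>

lemma lagrange_multiplier:
  assumes Q: "tame Q" and CQ: "C Q = c" and c: "0 < c"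
    and opt: "\<And>P. tame P \<Longrightarrow> C P = c \<Longrightarrow> EU P \<le> EU Q"
  obtains l where "0 < l" "\<And>P. tame P \<Longrightarrow> EU P - l * C P \<le> EU Q - l * c"
proof -
  define j where "j = EU Q"
  define E where "E = (\<integral>x. \<psi> x \<partial>L)"
  have E: "0 < E" using psi_pos by (simp add: E_def)
  \<comment> \<open>The weight t mixes \<open>P1\<close> and \<open>P2\<close> to a quantile of cost
    exactly c, whose utility is at most j; concavity turns this into an ordering of the chord slopes
    on the two sides of c.\<close>
  have cross: "(EU P2 - j) / (C P2 - c) \<le> (j - EU P1) / (c - C P1)"
    if P1: "tame P1" "C P1 < c" and P2: "tame P2" "c < C P2" for P1 P2
  proof -
    define t where "t = (c - C P1) / (C P2 - C P1)"
    have t: "0 \<le> t" "t \<le> 1" using that by (auto simp: t_def divide_simps)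
    have t': "t * (C P2 - C P1) = c - C P1" using that by (simp add: t_def)
    have "C (\<lambda>x. (1 - t) * P1 x + t * P2 x) = (1 - t) * C P1 + t * C P2" by (rule C_mix[OF P1(1) P2(1) t])
    also have "\<dots> = c" using t' by (simp add: algebra_simps)
    finally have "EU (\<lambda>x. (1 - t) * P1 x + t * P2 x) \<le> j"
      unfolding j_def by (intro opt tame_mix[OF P1(1) P2(1) t])
    then have "(1 - t) * EU P1 + t * EU P2 \<le> j" using EU_mix[OF P1(1) P2(1) t] by simp
    then have "((1 - t) * EU P1 + t * EU P2) * (C P2 - C P1) \<le> j * (C P2 - C P1)"
      using that by (intro mult_right_mono) auto
    moreover have "(1 - t) * (C P2 - C P1) = C P2 - c" using t' by (simp add: algebra_simps)
    moreover have "((1 - t) * EU P1 + t * EU P2) * (C P2 - C P1)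
        = EU P1 * ((1 - t) * (C P2 - C P1)) + EU P2 * (t * (C P2 - C P1))"
      by (simp add: algebra_simps)
    ultimately have "EU P1 * (C P2 - c) + EU P2 * (c - C P1) \<le> j * (C P2 - C P1)"
      unfolding t' by simp
    then have "(EU P2 - j) * (c - C P1) \<le> (j - EU P1) * (C P2 - c)" by (simp add: algebra_simps)
    then show ?thesis using that by (simp add: pos_divide_le_eq pos_le_divide_eq)
  qed
  define R where "R = {(EU P - j) / (C P - c) | P. tame P \<and> c < C P}"
  \<comment> \<open>A constant of cost c / 2: through \<open>cross\<close>, a cheaper competitor
    bounds the slopes in \<open>R\<close> from above.\<close>
  define P1 where "P1 = (\<lambda>_::real. c / (2 * E))"
  have P1: "tame P1" "C P1 < c" using c E by (auto simp: P1_def const_C const_tame E_def[symmetric])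
  have bdd: "bdd_above R" unfolding R_def using cross[OF P1] by (auto intro!: bdd_aboveI)
  \<comment> \<open>The first entry makes the cost of \<open>P2\<close> at least 2 * c, the second
    lifts it above Q at 1/2. Then its utility exceeds j strictly, so \<open>R\<close> contains a
    positive slope and l > 0.\<close>
  define k where "k = max (2 * c / E) (Q (1/2) + 1)"
  define P2 where "P2 = (\<lambda>x. max (Q x) k)"
  have k: "0 < k" unfolding k_def using c E by (simp add: less_max_iff_disj)
  note q = Q[unfolded tame_def]
  have dom2: "AE x in L. P2 x \<in> dom" unfolding P2_def using dom_pos k by (auto simp: less_max_iff_disj)
  have uu2: "AE x in L. uu (P2 x) = max (uu (Q x)) (uu k)"
    using conjunct1[OF conjunct2[OF q]]
  proof eventually_elim
    case (elim x)
    then show ?case using uu_le[OF elim, of k] uu_le[OF dom_pos[OF k], of "Q x"] by (auto simp: P2_def max_def)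
  qed
  have G2: "P2 \<in> \<G>" unfolding P2_def using q k by (intro \<G>_max) auto
  have int2: "integrable L (\<lambda>x. uu (P2 x))"
  proof (rule Bochner_Integration.integrable_bound[where f = "\<lambda>x. \<bar>uu (Q x)\<bar> + \<bar>uu k\<bar>", OF _ uu_meas[OF G2]])
    show "AE x in L. norm (uu (P2 x)) \<le> norm (\<bar>uu (Q x)\<bar> + \<bar>uu k\<bar>)"
      using uu2 by eventually_elim auto
  qed (use q in auto)
  have c2: "integrable L (\<lambda>x. P2 x * \<psi> x)"
  proof (rule Bochner_Integration.integrable_bound[where f = "\<lambda>x. \<bar>Q x * \<psi> x\<bar> + \<bar>k * \<psi> x\<bar>"])
    show "(\<lambda>x. P2 x * \<psi> x) \<in> borel_measurable L" using \<G>_meas[OF G2] psi_meas by measurable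
    show "AE x in L. norm (P2 x * \<psi> x) \<le> norm (\<bar>Q x * \<psi> x\<bar> + \<bar>k * \<psi> x\<bar>)"
      by (auto simp: P2_def max_def)
  qed (use q psi_int in auto)
  have tame2: "tame P2" using G2 dom2 int2 c2 by (simp add: tame_def)
  have "k * E \<le> C P2"
  proof -
    have "(\<integral>x. k * \<psi> x \<partial>L) \<le> C P2" unfolding C_def
      using psi_int c2 psi_nonneg by (intro integral_mono) (auto simp: P2_def space_L intro!: mult_right_mono)
    then show ?thesis using psi_int by (simp add: E_def)
  qed
  moreover have "2 * c \<le> k * E"
  proof -
    have "(2 * c / E) * E \<le> k * E" unfolding k_def using E by (intro mult_right_mono) auto
    then show ?thesis using E by simp
  qed
  ultimately have C2: "c < C P2" using c by simp
  have U2: "j < EU P2"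
  proof (rule ccontr)
    assume "\<not> j < EU P2"
    then have le: "(\<integral>x. uu (P2 x) \<partial>L) \<le> (\<integral>x. uu (Q x) \<partial>L)" by (simp add: j_def EU_def)
    have "AE x in L. uu (Q x) \<le> uu (P2 x)" using uu2 by eventually_elim simp
    then have "AE x in L. uu (Q x) = uu (P2 x)"
      using q int2 by (intro AE_eq_of_integral_le le) auto
    then have "AE x in L. Q x = P2 x"
      using conjunct1[OF conjunct2[OF q]]
    proof eventually_elim
      case (elim x)
      then show ?case using uu_less[OF elim(2), of k] by (cases "Q x < k") (auto simp: P2_def max_def)
    qed
    then have "Q (1/2) = P2 (1/2)" using q G2 by (intro \<G>_AE_eq) auto
    then show False by (auto simp: P2_def k_def max_def split: if_splits)
  qed
  define l where "l = Sup R"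
  have l_ge: "(EU P - j) / (C P - c) \<le> l" if "tame P" "c < C P" for P
    unfolding l_def by (rule cSup_upper[OF _ bdd]) (use that in \<open>auto simp: R_def\<close>)
  have ne: "R \<noteq> {}" using tame2 C2 by (auto simp: R_def)
  have "0 < (EU P2 - j) / (C P2 - c)" using U2 C2 by simp
  then have l: "0 < l" using l_ge[OF tame2 C2] by simp
  have "EU P - l * C P \<le> j - l * c" if P: "tame P" for P
  proof (cases "C P" c rule: linorder_cases)
    case less
    have "l \<le> (j - EU P) / (c - C P)"
      unfolding l_def by (rule cSup_least[OF ne]) (use cross[OF P less] in \<open>auto simp: R_def\<close>)
    then show ?thesis using less by (simp add: pos_le_divide_eq algebra_simps)
  next
    case equal
    then show ?thesis using opt[OF P] by (simp add: j_def)
  next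
    case greater
    then show ?thesis using l_ge[OF P greater] by (simp add: pos_divide_le_eq algebra_simps)
  qed
  then show ?thesis using that l unfolding j_def by blast
qed

text \<open>The Lagrangian inequality is given under \<psi>. It carries over to \<open>D\<close>
  because truncated maximizers have equal costs under both, while the cost of Q under
  \<open>D\<close> is at most c.\<close>

lemma lagrange_imp_max:
  assumes l: "0 < l" and Q: "tame Q" and CQ: "C Q = c"
    and lag: "\<And>P. tame P \<Longrightarrow> EU P - l * C P \<le> EU Q - l * c"
    and x: "0 < x" "x < 1"
  shows "is_max {0..} (l * D x) (Q x)"
proof -
  note q = Q[unfolded tame_def]
  have G: "Q \<in> \<G>" and dom: "AE x in L. Q x \<in> dom" using q by auto
  have qD: "integrable L (\<lambda>x. Q x * D x)" "(\<integral>x. Q x * D x \<partial>L) \<le> c"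
    using cost_D_int[OF \<G>_mono[OF G] \<G>_nonneg[OF G]] cost_D_le[OF \<G>_mono[OF G] \<G>_nonneg[OF G]] q CQ
    by (auto simp: C_def)
  have eqh: "hval l Q = (\<lambda>x. uu (Q x) - l * (Q x * D x))" by (auto simp: hval_def)
  have hint: "integrable L (hval l Q)" unfolding eqh using q qD by auto
  have hle: "EU Q - l * c \<le> (\<integral>x. hval l Q x \<partial>L)"
    unfolding eqh EU_def using q qD l by simp
  have ae: "AE x in L. uu z - l * z * D x \<le> hval l Q x" if z: "z \<in> dom" for z
  proof -
    define g where "g x = uu z - l * z * D x" for x
    have gint: "integrable L g" unfolding g_def using D_int by auto
    \<comment> \<open>The better of Q x and the fixed wealth z. On {Q \<le> n} a truncated maximizer
      does at least as well as both, elsewhere at least as well as z; so the integral of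
      \<open>a\<close> cannot exceed that of \<open>hval l Q\<close>, and the two functions agree
      almost everywhere.\<close>
    define a where "a x = max (hval l Q x) (g x)" for x
    have aint: "integrable L a" unfolding a_def using hint gint by auto
    \<comment> \<open>From N on, the truncation range contains both z and the wealth 1.\<close>
    obtain N where N: "max 1 z \<le> real N" using real_arch_simple by blast
    have "(\<integral>x. (if Q x \<le> real n then a x else g x) \<partial>L) \<le> (\<integral>x. hval l Q x \<partial>L)" if n: "N \<le> n" for n
    proof -
      have n1: "1 \<le> real n" "z \<le> real n" using N n by auto
      then have n0: "0 < real n" by simp
      note t = trunc_value[OF l n1(1)]
      note b = trunc_bounds[OF n0]
      have "AE x in L. (if Q x \<le> real n then a x else g x) \<le> hval l (trunc l (real n)) x"
        using dom
      proof eventually_elim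
        case (elim x)
        have "g x \<le> hval l (trunc l (real n)) x"
          using hval_le_trunc[OF n0, of "\<lambda>_. z" x l] z n1 by (simp add: g_def hval_def)
        then show ?case using hval_le_trunc[OF n0, of Q x l] elim by (simp add: a_def)
      qed
      then have "(\<integral>x. (if Q x \<le> real n then a x else g x) \<partial>L) \<le> (\<integral>x. hval l (trunc l (real n)) x \<partial>L)"
        using t(1) cut_int[OF \<G>_meas[OF G] aint gint] by (intro integral_mono_AE)
      also have "\<dots> = EU (trunc l (real n)) - l * C (trunc l (real n))"
      proof -
        have e: "uu (trunc l (real n) x) = hval l (trunc l (real n)) x + l * (trunc l (real n) x * D x)" for x
          by (simp add: hval_def)
        show ?thesis unfolding EU_def C_def e using t by simp
      qed
      also have "\<dots> \<le> EU Q - l * c"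
      proof (rule lag)
        have e: "uu (trunc l (real n) x) = hval l (trunc l (real n)) x + l * (trunc l (real n) x * D x)" for x
          by (simp add: hval_def)
        have "integrable L (\<lambda>x. uu (trunc l (real n) x))" unfolding e using t by auto
        then show "tame (trunc l (real n))" using trunc_\<G>[OF l n0] b(3) t by (simp add: tame_def)
      qed
      finally show ?thesis using hle by simp
    qed
    then have "(\<integral>x. a x \<partial>L) \<le> (\<integral>x. hval l Q x \<partial>L)"
      by (intro LIMSEQ_le_const2[OF cut_limit[OF \<G>_meas[OF G] aint gint]]) auto
    then have "AE x in L. hval l Q x = a x"
      by (intro AE_eq_of_integral_le[OF hint aint]) (auto simp: a_def)
    then show ?thesis by eventually_elim (auto simp: a_def g_def max_def split: if_splits)
  qed
  \<comment> \<open>For each fixed z both sides are right-continuous in x, so the exceptional null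
    set disappears. Isolating \<open>util u (Q x)\<close> keeps the inequality meaningful should it
    be -\<infinity>.\<close>
  have *: "ereal (uu z - l * z * D x + l * Q x * D x) \<le> util u (Q x)" if z: "z \<in> dom" for z
  proof (rule right_limit_le[OF x, where f = "\<lambda>x. ereal (uu z - l * z * D x + l * Q x * D x)" and g = "\<lambda>x. util u (Q x)"])
    show "((\<lambda>x. ereal (uu z - l * z * D x + l * Q x * D x)) \<longlongrightarrow> ereal (uu z - l * z * D x + l * Q x * D x)) (at_right x)"
      by (intro tendsto_intros D_right_continuous x \<G>_right[OF G])
    have "\<forall>\<^sub>F t in at_right x. t \<in> {x<..<1}" using x by (intro eventually_at_right_real) auto
    then have "\<forall>\<^sub>F t in at_right x. Q t \<in> {0..}" by eventually_elim (use \<G>_nonneg[OF G] x in auto)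
    then show "((\<lambda>x. util u (Q x)) \<longlongrightarrow> util u (Q x)) (at_right x)"
      using continuous_on_tendsto_compose[OF util_continuous \<G>_right[OF G x]] \<G>_nonneg[OF G x] by simp
    show "AE t in L. ereal (uu z - l * z * D t + l * Q t * D t) \<le> util u (Q t)"
      using ae[OF z] dom by eventually_elim (simp add: util_dom hval_def)
  qed
  have "Q x \<in> dom" using *[OF dom_pos[of 1]] \<G>_nonneg[OF G x] by (cases "Q x \<in> dom") (auto simp: util_not_dom)
  moreover have "uu z - l * D x * z \<le> uu (Q x) - l * D x * Q x" if "z \<in> dom" for z
    using *[OF that] by (simp add: util_dom[OF \<open>Q x \<in> dom\<close>] mult_ac)
  ultimately show ?thesis using \<G>_nonneg[OF G x] by (simp add: is_max_def)
qed

text \<open>The constant quantile that spends exactly c keeps the supremum above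
  -\<infinity>.\<close>

lemma budget_value_real:
  assumes c: "0 < c" and wp: "well_posed (budget_set c) (J 0)"
  obtains s where "(SUP Q\<in>budget_set c. J 0 Q) = ereal s"
proof -
  define k where "k = c / (\<integral>x. \<psi> x \<partial>L)"
  have k: "0 < k" "k * (\<integral>x. \<psi> x \<partial>L) = c" using c psi_pos by (auto simp: k_def)
  have "(\<lambda>_. k) \<in> budget_set c" using k const_tame[OF k(1)] by (auto simp: budget_set_iff const_C tame_def)
  then have "J 0 (\<lambda>_. k) \<le> (SUP Q\<in>budget_set c. J 0 Q)" by (rule SUP_upper)
  then show ?thesis using that wp k(1) by (cases "SUP Q\<in>budget_set c. J 0 Q") (auto simp: well_posed_def J_const)
qed

theorem budget_optimal_iff:
  assumes l: "0 < l" and max: "\<And>x. 0 < x \<Longrightarrow> x < 1 \<Longrightarrow> is_max {0..} (l * D x) (Qs x)"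
    and Qs: "Qs \<in> budget_set c" and c: "0 < c" and wp: "well_posed (budget_set c) (J 0)"
  shows "optimal (budget_set c) (J 0) Q \<longleftrightarrow> (\<forall>x\<in>{0<..<1}. Q x = Qs x)"
proof -
  define S where "S = (SUP Q\<in>budget_set c. J 0 Q)"
  obtain s where s: "S = ereal s" using budget_value_real[OF c wp] unfolding S_def by blast
  have upper: "J 0 Q \<le> S" if "Q \<in> budget_set c" for Q unfolding S_def using that by (rule SUP_upper)
  have G: "Qs \<in> \<G>" and ci: "integrable L (\<lambda>x. Qs x * \<psi> x)" and CQs: "C Qs = c"
    using Qs by (auto simp: budget_set_iff)
  have fac: "\<forall>x\<in>{0<..<1}. \<forall>y\<in>{0<..<1}. D x = D y \<longrightarrow> Qs x = Qs y" by (rule is_max_factor[OF l max, of 1]) simp_all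
  have iD: "integrable L (\<lambda>x. Qs x * D x)" by (rule cost_D_int[OF \<G>_mono[OF G] \<G>_nonneg[OF G] ci])
  have eD: "(\<integral>x. Qs x * D x \<partial>L) = c" using cost_D_eq[OF \<G>_mono[OF G] \<G>_nonneg[OF G] ci fac] CQs by (simp add: C_def)
  have le: "J 0 Q \<le> J 0 Qs" if Q: "Q \<in> budget_set c" for Q
  proof (cases "J 0 Q = -\<infinity>")
    case False
    have fin: "J 0 Q \<noteq> \<infinity>" using upper[OF Q] s by auto
    have nQ: "tame Q" by (rule tameI[OF Q False fin])
    note q = nQ[unfolded tame_def]
    have GQ: "Q \<in> \<G>" and CQ: "C Q = c" and qc: "integrable L (\<lambda>x. Q x * \<psi> x)" using Q by (auto simp: budget_set_iff)
    have qD: "integrable L (\<lambda>x. Q x * D x)" by (rule cost_D_int[OF \<G>_mono[OF GQ] \<G>_nonneg[OF GQ] qc])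
    have qDle: "(\<integral>x. Q x * D x \<partial>L) \<le> c" using cost_D_le[OF \<G>_mono[OF GQ] \<G>_nonneg[OF GQ] qc] CQ by (simp add: C_def)
    \<comment> \<open>Optimality of \<open>Qs x\<close> at price l * D x against Q x, solved for the
      utility of \<open>Qs x\<close>. The integral of \<open>g\<close> is at least
      \<open>EU Q\<close>, because the cost under \<open>D\<close> is c for \<open>Qs\<close> and at
      most c for Q; as an integrable minorant \<open>g\<close> also keeps \<open>J 0 Qs\<close>
      above -\<infinity>.\<close>
    define g where "g x = uu (Q x) + l * (Qs x * D x) - l * (Q x * D x)" for x
    have gint: "integrable L g" unfolding g_def using q iD qD by auto
    have gI: "(\<integral>x. g x \<partial>L) = EU Q + l * c - l * (\<integral>x. Q x * D x \<partial>L)"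
      unfolding g_def EU_def using q iD qD eD by simp
    have ae: "AE x in L. Qs x \<in> dom \<and> g x \<le> uu (Qs x)"
      using AE_L_space conjunct1[OF conjunct2[OF q]]
    proof eventually_elim
      case (elim x)
      then show ?case using is_maxD[OF max[of x], of "Q x"] max[of x] dom_nonneg[OF elim(2)]
        by (simp add: g_def is_max_def mult_ac)
    qed
    have "J 0 Qs \<noteq> -\<infinity>" by (rule J_lower[OF gint]) (use ae in \<open>simp add: obj_0\<close>)
    moreover have "J 0 Qs \<noteq> \<infinity>" using upper[OF Qs] s by auto
    ultimately have nQs: "tame Qs" by (rule tameI[OF Qs])
    have "(\<integral>x. g x \<partial>L) \<le> EU Qs"
      unfolding EU_def
    proof (rule integral_mono_AE[OF gint])
      show "AE x in L. g x \<le> uu (Qs x)" using ae by eventually_elim simp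
    qed (use nQs in \<open>simp add: tame_def\<close>)
    moreover have "l * (\<integral>x. Q x * D x \<partial>L) \<le> l * c" using qDle l by simp
    ultimately have "EU Q \<le> EU Qs" using gI by linarith
    then show ?thesis using J_tame nQ nQs by simp
  qed simp
  have SS: "S = J 0 Qs" using upper[OF Qs] le unfolding S_def by (intro antisym SUP_least) auto
  show ?thesis
  proof
    assume opt: "optimal (budget_set c) (J 0) Q"
    then have Q: "Q \<in> budget_set c" "J 0 Q = S" by (auto simp: optimal_def S_def)
    have GQ: "Q \<in> \<G>" using Q by (simp add: budget_set_iff)
    have J: "J 0 Q = ereal s" "J 0 Qs = ereal s" using Q(2) SS s by auto
    have "tame Q" "tame Qs" by (rule tameI[OF Q(1)], simp_all add: J) (rule tameI[OF Qs], simp_all add: J)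
    from tame_mix[OF this, of "1/2"] C_mix[OF this, of "1/2"]
    have "(\<lambda>x. (1 - 1/2) * Q x + 1/2 * Qs x) \<in> budget_set c"
      using Q(1) CQs by (auto simp: budget_set_iff tame_def)
    then have mid: "J 0 (\<lambda>x. (1 - 1/2) * Q x + 1/2 * Qs x) \<le> ereal s" using upper s by metis
    show "\<forall>x\<in>{0<..<1}. Q x = Qs x"
      using optimal_unique[OF GQ G J mid] by auto
  next
    assume eq: "\<forall>x\<in>{0<..<1}. Q x = Qs x"
    have "Q \<in> \<G>" by (rule \<G>_cong[OF G]) (use eq in auto)
    moreover have "ext_integral (\<lambda>x. ereal (Q x * \<psi> x)) = ext_integral (\<lambda>x. ereal (Qs x * \<psi> x))"
      by (rule ext_integral_cong) (use eq in auto)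
    ultimately have "Q \<in> budget_set c" using Qs by (simp add: budget_set_def)
    moreover have "J 0 Q = J 0 Qs" unfolding J_def by (rule ext_integral_cong) (use eq in \<open>auto simp: integrand_def\<close>)
    ultimately show "optimal (budget_set c) (J 0) Q" using SS by (simp add: optimal_def S_def)
  qed
qed

theorem budget_optimal_imp_max:
  assumes opt: "optimal (budget_set c) (J 0) Q" and c: "0 < c" and wp: "well_posed (budget_set c) (J 0)"
  obtains l where "0 < l" "\<And>x. 0 < x \<Longrightarrow> x < 1 \<Longrightarrow> is_max {0..} (l * D x) (Q x)"
proof -
  obtain s where s: "(SUP Q\<in>budget_set c. J 0 Q) = ereal s" using budget_value_real[OF c wp] by blast
  have Q: "Q \<in> budget_set c" "J 0 Q = ereal s" using opt s by (auto simp: optimal_def)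
  have nQ: "tame Q" by (rule tameI[OF Q(1)]) (use Q(2) in auto)
  have CQ: "C Q = c" using Q by (simp add: budget_set_iff)
  have best: "EU P \<le> EU Q" if P: "tame P" "C P = c" for P
  proof -
    have "P \<in> budget_set c" using P by (simp add: budget_set_iff tame_def)
    then have "J 0 P \<le> ereal s" unfolding s[symmetric] by (rule SUP_upper)
    then show ?thesis using J_tame[OF P(1)] J_tame[OF nQ] Q(2) by simp
  qed
  obtain l where "0 < l" "\<And>P. tame P \<Longrightarrow> EU P - l * C P \<le> EU Q - l * c"
    using lagrange_multiplier[OF nQ CQ c best] by blast
  then show ?thesis using that[of l] lagrange_imp_max[OF _ nQ CQ] by blast
qed

end

section \<open>Probability weighting and the quantile of the pricing kernel\<close>

text \<open>Translates between integrability on \<open>L\<close> and absolute integrability on a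
  set, the form used by the change of variables in \<open>phi'_pricing\<close>.\<close>

lemma
  fixes f :: "real \<Rightarrow> real"
  assumes f: "f \<in> borel_measurable L"
  shows abs_integrable_L: "f absolutely_integrable_on {0<..<1} \<longleftrightarrow> integrable L f"
    and integral_L: "integrable L f \<Longrightarrow> integral {0<..<1} f = (\<integral>x. f x \<partial>L)"
proof -
  have meas: "(\<lambda>x. indicator {0<..<1} x *\<^sub>R f x) \<in> borel_measurable lborel"
    using f by (subst (asm) borel_measurable_restrict_space_iff) (auto simp: mult.commute)
  show iff: "f absolutely_integrable_on {0<..<1} \<longleftrightarrow> integrable L f"
    unfolding set_integrable_def using integrable_completion[OF meas] by (simp add: integrable_restrict_space)
  assume "integrable L f"
  with iff have "f absolutely_integrable_on {0<..<1}" by simp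
  from set_lebesgue_integral_eq_integral(2)[OF this] integral_completion[OF meas]
  show "integral {0<..<1} f = (\<integral>x. f x \<partial>L)"
    by (simp add: set_lebesgue_integral_def integral_restrict_space)
qed

section \<open>Probability weighting and the transformed level \<nu>\<close>

locale weighting =
  fixes w :: "real \<Rightarrow> real"
  assumes w_range: "w \<in> {0..1} \<rightarrow> {0..1}" and w_diff: "w differentiable_on {0..1}"
    and w_mono: "strict_mono_on {0..1} w" and w_0: "w 0 = 0" and w_1: "w 1 = 1"
    and nu_diff: "\<nu> w differentiable_on {0..1}"
begin

lemma w_image: "w ` {0..1} = {0..1}"
proof
  show "{0..1} \<subseteq> w ` {0..1}"
  proof
    fix y :: real assume "y \<in> {0..1}"
    then obtain x where "0 \<le> x" "x \<le> 1" "w x = y"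
      using IVT'[of w 0 y 1] w_0 w_1 differentiable_imp_continuous_on[OF w_diff] by auto
    then show "y \<in> w ` {0..1}" by auto
  qed
qed (use w_range in auto)

lemma inv_w: "x \<in> {0..1} \<Longrightarrow> inv_into {0..1} w x \<in> {0..1}" "x \<in> {0..1} \<Longrightarrow> w (inv_into {0..1} w x) = x"
  using w_image inv_into_into[of x w "{0..1}"] f_inv_into_f[of x w "{0..1}"] by auto

lemma nu_range: "x \<in> {0..1} \<Longrightarrow> \<nu> w x \<in> {0..1}"
  using inv_w(1)[of "1 - x"] by (simp add: \<nu>_def)

lemma w_nu: "x \<in> {0..1} \<Longrightarrow> w (1 - \<nu> w x) = 1 - x"
  using inv_w(2)[of "1 - x"] by (simp add: \<nu>_def)

lemma nu_less: "0 \<le> x \<Longrightarrow> x < y \<Longrightarrow> y \<le> 1 \<Longrightarrow> \<nu> w x < \<nu> w y"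
proof (rule ccontr)
  assume xy: "0 \<le> x" "x < y" "y \<le> 1" and "\<not> \<nu> w x < \<nu> w y"
  then have "1 - \<nu> w x \<le> 1 - \<nu> w y" by simp
  then have "w (1 - \<nu> w x) \<le> w (1 - \<nu> w y)"
    using nu_range[of x] nu_range[of y] xy strict_mono_on_leD[OF w_mono] by simp
  then show False using w_nu[of x] w_nu[of y] xy by simp
qed

lemma nu_0: "\<nu> w 0 = 0" and nu_1: "\<nu> w 1 = 1"
proof -
  have inj: "inj_on w {0..1}" by (rule strict_mono_on_imp_inj_on[OF w_mono])
  show "\<nu> w 0 = 0" using inv_into_f_f[OF inj, of 1] by (simp add: \<nu>_def w_1)
  show "\<nu> w 1 = 1" using inv_into_f_f[OF inj, of 0] by (simp add: \<nu>_def w_0)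
qed

lemma nu_interior: "x \<in> {0<..<1} \<Longrightarrow> \<nu> w x \<in> {0<..<1}"
  using nu_less[of 0 x] nu_less[of x 1] by (simp add: nu_0 nu_1)

lemma nu_image: "(\<lambda>x. 1 - \<nu> w x) ` {0<..<1} = {0<..<1}"
proof
  show "(\<lambda>x. 1 - \<nu> w x) ` {0<..<1} \<subseteq> {0<..<1}" using nu_interior by auto
  show "{0<..<1} \<subseteq> (\<lambda>x. 1 - \<nu> w x) ` {0<..<1}"
  proof
    fix y :: real assume y: "y \<in> {0<..<1}"
    have "\<nu> w (1 - w y) = 1 - y"
      using inv_into_f_f[OF strict_mono_on_imp_inj_on[OF w_mono], of y] y by (simp add: \<nu>_def)
    moreover have "0 < w y" "w y < 1"
      using strict_mono_onD[OF w_mono, of 0 y] strict_mono_onD[OF w_mono, of y 1] y w_0 w_1 by auto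
    ultimately show "y \<in> (\<lambda>x. 1 - \<nu> w x) ` {0<..<1}" by (intro image_eqI[of _ _ "1 - w y"]) auto
  qed
qed

lemma nu_deriv: "x \<in> {0<..<1} \<Longrightarrow> (\<nu> w has_real_derivative deriv (\<nu> w) x) (at x)"
proof -
  assume x: "x \<in> {0<..<1}"
  then have "\<nu> w differentiable (at x within {0..1})" using nu_diff by (auto simp: differentiable_on_def)
  moreover have "at x within {0..1} = at x" using x by (intro at_within_interior) auto
  ultimately show ?thesis by (simp add: DERIV_deriv_iff_real_differentiable)
qed

lemma nu_mono: "mono_on {0<..<1} (\<nu> w)"
  using nu_less by (intro mono_onI) (force simp: le_less)

lemma nu_deriv_nonneg: "x \<in> {0<..<1} \<Longrightarrow> 0 \<le> deriv (\<nu> w) x"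
  using mono_on_imp_deriv_nonneg[OF nu_mono nu_deriv] by simp

lemma nu_deriv_measurable: "deriv (\<nu> w) \<in> borel_measurable L"
proof (rule borel_measurable_LIMSEQ_real)
  \<comment> \<open>The step shrinks with 1 - x, so that x plus the step stays in (0,1) even for n =
    0 and is still increasing in x; hence each difference quotient is measurable by monotonicity of
    \<nu>.\<close>
  let ?e = "\<lambda>n x. (1 - x) / real (n + 2)"
  let ?s = "\<lambda>n x. (\<nu> w (x + ?e n x) - \<nu> w x) / ?e n x"
  have e: "0 < ?e n x" "x + ?e n x < 1" if "x \<in> {0<..<1}" for n x
  proof -
    show "0 < ?e n x" using that by simp
    have "(1 - x) * 1 < (1 - x) * real (n + 2)" using that by (intro mult_strict_left_mono) auto
    then have "?e n x < 1 - x" by (simp add: divide_less_eq)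
    then show "x + ?e n x < 1" by simp
  qed
  show "?s n \<in> borel_measurable L" for n
  proof -
    have "mono_on {0<..<1} (\<lambda>x. \<nu> w (x + ?e n x))"
    proof (rule mono_onI)
      fix x y :: real assume xy: "x \<in> {0<..<1}" "y \<in> {0<..<1}" "x \<le> y"
      have "x + ?e n x = 1 - (1 - x) * (1 - 1 / real (n + 2))" for x :: real by (simp add: field_simps)
      moreover have "(1 - y) * (1 - 1 / real (n + 2)) \<le> (1 - x) * (1 - 1 / real (n + 2))"
        using xy by (intro mult_right_mono) auto
      ultimately have "x + ?e n x \<le> y + ?e n y" by simp
      then show "\<nu> w (x + ?e n x) \<le> \<nu> w (y + ?e n y)"
        using e[OF xy(1), of n] e[OF xy(2), of n] xy
        by (intro mono_onD[OF nu_mono]) (auto simp del: of_nat_add intro: add_pos_pos)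
    qed
    from measurable_L_mono[OF this] have [measurable]: "(\<lambda>x. \<nu> w (x + ?e n x)) \<in> borel_measurable L" .
    have [measurable]: "\<nu> w \<in> borel_measurable L" by (rule measurable_L_mono[OF nu_mono])
    have [measurable]: "(\<lambda>x. ?e n x) \<in> borel_measurable L" by (intro measurable_restrict_space1) simp
    show ?thesis by measurable
  qed
  show "(\<lambda>n. ?s n x) \<longlonglongrightarrow> deriv (\<nu> w) x" if "x \<in> space L" for x
  proof -
    have x: "x \<in> {0<..<1}" using that by (simp add: space_L)
    have "((\<lambda>h. (\<nu> w (x + h) - \<nu> w x) / h) \<longlongrightarrow> deriv (\<nu> w) x) (at 0)"
      using nu_deriv[OF x] by (simp add: has_field_derivative_def DERIV_def[symmetric] DERIV_def)
    moreover have "filterlim (\<lambda>n. ?e n x) (at 0) sequentially"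
    proof -
      have "(\<lambda>n. ?e n x) \<longlonglongrightarrow> 0" by real_asymp
      moreover have "?e n x \<noteq> 0" for n using e(1)[OF x, of n] by (metis less_irrefl)
      ultimately show ?thesis by (simp add: filterlim_at)
    qed
    ultimately show ?thesis by (rule filterlim_compose)
  qed
qed

end

section \<open>Quantiles of the pricing kernel\<close>

locale kernel = prob_space M for M :: "'a measure" +
  fixes \<rho> :: "'a \<Rightarrow> real" and F :: "real \<Rightarrow> real"
  assumes rho_meas: "\<rho> \<in> borel_measurable M" and rho_pos: "AE \<omega> in M. 0 < \<rho> \<omega>"
    and rho_int: "integrable M \<rho>" and F_def: "F = cdf (distr M borel \<rho>)"
begin

text \<open>\<open>R.I\<close> is the lower quantile, the least t with x \<le> F t; under
  \<open>L\<close> it has the law of \<rho>, which transfers integrals.\<close>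

sublocale R: cdf_distribution "distr M borel \<rho>"
  unfolding cdf_distribution_def using rho_meas by (rule real_distribution_distr)

lemma rho_mean_pos: "0 < expectation \<rho>"
proof -
  have nn: "AE \<omega> in M. 0 \<le> \<rho> \<omega>" using rho_pos by eventually_elim simp
  have "expectation \<rho> \<noteq> 0"
  proof
    assume "expectation \<rho> = 0"
    then have "AE \<omega> in M. \<rho> \<omega> = 0" using integral_nonneg_eq_0_iff_AE[OF rho_int nn] by simp
    with rho_pos have "AE \<omega> in M. False" by eventually_elim simp
    then show False by simp
  qed
  then show ?thesis using integral_nonneg_AE[OF nn] by simp
qed

text \<open>Almost sure positivity of \<rho> puts 0 into every set {t. F t \<le> x} with x > 0;
  hence these sets are nonempty and quantiles are nonnegative.\<close>

lemma F_0: "F 0 = 0"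
proof -
  have "measure M (\<rho> -` {..0} \<inter> space M) = measure M {}"
    using rho_pos rho_meas by (intro finite_measure_eq_AE) (auto elim!: eventually_mono)
  then show ?thesis unfolding F_def cdf_def using rho_meas by (simp add: measure_distr)
qed

lemma F_le_iff: "0 < x \<Longrightarrow> x < 1 \<Longrightarrow> x \<le> F t \<longleftrightarrow> R.I x \<le> t"
  unfolding F_def by (rule R.pseudoinverse)

lemma
  assumes x: "0 < x" "x < 1"
  shows quantile_bdd: "bdd_above {t. F t \<le> x}"
    and quantile_le: "\<And>y. x < y \<Longrightarrow> y < 1 \<Longrightarrow> quantile F x \<le> R.I y"
    and quantile_ge: "R.I x \<le> quantile F x"
    and quantile_nonneg: "0 \<le> quantile F x"
proof -
  have ub: "t \<le> R.I y" if "F t \<le> x" "x < y" "y < 1" for t y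
    using F_le_iff[of y t] that x by simp
  show bdd: "bdd_above {t. F t \<le> x}"
    using ub[of _ "(x + 1) / 2"] x by (intro bdd_aboveI[where M = "R.I ((x + 1) / 2)"]) simp
  show "0 \<le> quantile F x" unfolding quantile_def using F_0 x by (intro cSup_upper[OF _ bdd]) simp
  show "R.I x \<le> quantile F x"
  proof (rule dense_le)
    fix t assume "t < R.I x"
    then have "F t \<le> x" using F_le_iff[OF x, of t] by simp
    then show "t \<le> quantile F x" unfolding quantile_def by (intro cSup_upper[OF _ bdd]) simp
  qed
  fix y assume "x < y" "y < 1"
  then show "quantile F x \<le> R.I y"
    unfolding quantile_def using F_0 x ub by (intro cSup_least) (auto intro!: exI[of _ 0])
qed

lemma quantile_mono: "mono_on {0<..<1} (quantile F)"
proof (rule mono_onI)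
  fix x y :: real assume xy: "x \<in> {0<..<1}" "y \<in> {0<..<1}" "x \<le> y"
  show "quantile F x \<le> quantile F y"
    unfolding quantile_def using F_0 xy quantile_bdd[of y] by (intro cSup_subset_mono) (auto intro!: exI[of _ 0])
qed

text \<open>The upper quantile lies between \<open>R.I x\<close> and every \<open>R.I y\<close> with
  y > x, so the two agree wherever the monotone \<open>R.I\<close> is continuous, that is, off a
  countable set.\<close>

lemma quantile_AE: "AE x in L. quantile F x = R.I x"
proof -
  have "countable {x \<in> {0<..<1}. \<not> isCont R.I x}"
    by (rule mono_on_ctble_discont_open[OF _ R.mono_I]) simp
  then have "AE x in lborel. x \<notin> {x \<in> {0<..<1}. \<not> isCont R.I x}"
    by (intro AE_not_in countable_imp_null_set_lborel)
  then have "AE x in L. isCont R.I x" by (subst AE_restrict_space_iff) auto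
  then show ?thesis using AE_L_space
  proof eventually_elim
    case (elim x)
    then have x: "0 < x" "x < 1" by auto
    have "(R.I \<longlongrightarrow> R.I x) (at_right x)"
      using elim(1) unfolding isCont_def by (rule tendsto_within_subset) simp
    moreover have "\<forall>\<^sub>F y in at_right x. y \<in> {x<..<1}" using x by (intro eventually_at_right_real) auto
    then have "\<forall>\<^sub>F y in at_right x. quantile F x \<le> R.I y"
      by eventually_elim (use quantile_le[OF x] in auto)
    ultimately have "quantile F x \<le> R.I x" by (rule tendsto_lowerbound) simp
    then show ?case using quantile_ge[OF x] by simp
  qed
qed

lemma quantile_int: "integrable L (quantile F)" and quantile_integral: "(\<integral>x. quantile F x \<partial>L) = expectation \<rho>"
proof -
  have I: "R.I \<in> borel_measurable L" using R.measurable_CI measurable_cong_sets[OF sets_L refl] by blast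
  have qm: "quantile F \<in> borel_measurable L" by (rule measurable_L_mono[OF quantile_mono])
  have "integrable (distr M borel \<rho>) (\<lambda>x. x)" using rho_int rho_meas by (subst integrable_distr_eq) auto
  then have "integrable (distr L borel R.I) (\<lambda>x. x)" unfolding R.distr_I_eq_M .
  then have i: "integrable L R.I" by (subst (asm) integrable_distr_eq) (use I in auto)
  show "integrable L (quantile F)"
    using i integrable_cong_AE[OF qm I quantile_AE] by simp
  have "expectation \<rho> = (\<integral>x. x \<partial>distr M borel \<rho>)" using rho_meas by (subst integral_distr) auto
  also have "\<dots> = (\<integral>x. x \<partial>distr L borel R.I)" unfolding R.distr_I_eq_M ..
  also have "\<dots> = (\<integral>x. R.I x \<partial>L)" using I by (subst integral_distr) auto
  also have "\<dots> = (\<integral>x. quantile F x \<partial>L)"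
    using quantile_AE by (intro integral_cong_AE[OF I qm]) (auto elim: eventually_mono)
  finally show "(\<integral>x. quantile F x \<partial>L) = expectation \<rho>" ..
qed

end

text \<open>Substituting 1 - \<nu> x turns \<open>phi'\<close> into the quantile on (0,1), whose
  integral is the mean of \<rho> and hence positive.\<close>

lemma phi'_pricing:
  assumes "kernel M \<rho> F" "weighting w"
  shows "pricing (phi' F w)"
proof -
  interpret kernel M \<rho> F by fact
  interpret weighting w by fact
  let ?g = "\<lambda>x. 1 - \<nu> w x"
  have meas: "phi' F w \<in> borel_measurable L"
  proof -
    have "mono_on {0<..<1} (\<lambda>x. - quantile F (?g x))"
    proof (rule mono_onI)
      fix x y :: real assume xy: "x \<in> {0<..<1}" "y \<in> {0<..<1}" "x \<le> y"
      show "- quantile F (?g x) \<le> - quantile F (?g y)"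
        using mono_onD[OF quantile_mono, of "?g y" "?g x"] nu_interior[OF xy(1)] nu_interior[OF xy(2)]
          mono_onD[OF nu_mono xy] by simp
    qed
    from borel_measurable_uminus[OF measurable_L_mono[OF this]]
    have "(\<lambda>x. quantile F (?g x)) \<in> borel_measurable L" by simp
    then show ?thesis unfolding phi'_def[abs_def] using nu_deriv_measurable by measurable
  qed
  have nn: "0 \<le> phi' F w x" if "x \<in> {0<..<1}" for x
    unfolding phi'_def using quantile_nonneg[of "?g x"] nu_interior[OF that] nu_deriv_nonneg[OF that]
    by (intro mult_nonneg_nonneg) auto
  have eq: "\<bar>- deriv (\<nu> w) x\<bar> * quantile F (?g x) = phi' F w x" if "x \<in> {0<..<1}" for x
    unfolding phi'_def using nu_deriv_nonneg[OF that] by simp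
  have qm: "quantile F \<in> borel_measurable L" by (rule measurable_L_mono[OF quantile_mono])
  \<comment> \<open>This substitution rule works with a pointwise derivative and injectivity,
    without continuity of the derivative, and transfers integrability together with the
    value.\<close>
  have "(\<lambda>x. \<bar>- deriv (\<nu> w) x\<bar> * quantile F (?g x)) absolutely_integrable_on {0<..<1} \<and>
      integral {0<..<1} (\<lambda>x. \<bar>- deriv (\<nu> w) x\<bar> * quantile F (?g x)) = expectation \<rho> \<longleftrightarrow>
    quantile F absolutely_integrable_on (?g ` {0<..<1}) \<and> integral (?g ` {0<..<1}) (quantile F) = expectation \<rho>"
  proof (rule has_absolute_integral_change_of_variables_1')
    fix x :: real assume "x \<in> {0<..<1}"
    from DERIV_subset[OF nu_deriv[OF this]]
    show "(?g has_real_derivative - deriv (\<nu> w) x) (at x within {0<..<1})"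
      by (auto intro!: derivative_eq_intros)
  next
    show "inj_on ?g {0<..<1}"
    proof (rule inj_onI)
      fix x y :: real assume "x \<in> {0<..<1}" "y \<in> {0<..<1}" "?g x = ?g y"
      then show "x = y" using nu_less[of x y] nu_less[of y x] by (cases x y rule: linorder_cases) auto
    qed
  qed simp
  then have "(\<lambda>x. \<bar>- deriv (\<nu> w) x\<bar> * quantile F (?g x)) absolutely_integrable_on {0<..<1} \<and>
      integral {0<..<1} (\<lambda>x. \<bar>- deriv (\<nu> w) x\<bar> * quantile F (?g x)) = expectation \<rho>"
    unfolding nu_image using abs_integrable_L[OF qm] integral_L[OF qm] quantile_int quantile_integral by simp
  moreover have "(\<lambda>x. \<bar>- deriv (\<nu> w) x\<bar> * quantile F (?g x)) absolutely_integrable_on {0<..<1}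
      \<longleftrightarrow> phi' F w absolutely_integrable_on {0<..<1}"
    by (rule set_integrable_cong) (use eq in auto)
  moreover have "integral {0<..<1} (\<lambda>x. \<bar>- deriv (\<nu> w) x\<bar> * quantile F (?g x)) = integral {0<..<1} (phi' F w)"
    by (rule integral_cong) (use eq in auto)
  ultimately have *: "phi' F w absolutely_integrable_on {0<..<1}" "integral {0<..<1} (phi' F w) = expectation \<rho>" by auto
  then have int: "integrable L (phi' F w)" using abs_integrable_L[OF meas] by simp
  then have "(\<integral>x. phi' F w x \<partial>L) = expectation \<rho>" using integral_L[OF meas] * by simp
  then show ?thesis using int nn rho_mean_pos by unfold_locales auto
qed

section \<open>Translation to the original notions\<close>

theorem theorem1:
  fixes M :: "'a measure" and \<rho> :: "'a \<Rightarrow> real"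
    and u w F :: "real \<Rightarrow> real" and x0 :: real
  assumes "strict_mono_on {0<..} u"
    and "\<forall>y>0. u differentiable (at y) \<and> deriv u differentiable (at y) \<and> deriv (deriv u) y < 0"
    and "w \<in> {0..1} \<rightarrow> {0..1}"
    and "w differentiable_on {0..1}" and "strict_mono_on {0..1} w"
    and "w 0 = 0" and "w 1 = 1"
    and "\<nu> w differentiable_on {0..1}"
    and "prob_space M" and "\<rho> \<in> borel_measurable M"
    and "AE \<omega> in M. \<rho> \<omega> > 0" and "integrable M \<rho>"
    and "F = cdf (distr M borel \<rho>)" and "continuous_on UNIV F"
    and "x0 > 0"
  shows
    "(\<forall>l>0. candidate_defined u F w l \<longrightarrow>
        well_posed \<G> (penalized_objective u F w l) \<longrightarrow>
        integral_defined (penalized_integrand u F w l (candidate u F w l)) \<longrightarrow>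
        (\<forall>Q. optimal \<G> (penalized_objective u F w l) Q \<longleftrightarrow>
               (\<forall>x\<in>{0<..<1}. Q x = candidate u F w l x)))
     \<and>
     (well_posed (\<Q> F w x0) (expected_utility u) \<longrightarrow>
        ((\<exists>Q. optimal (\<Q> F w x0) (expected_utility u) Q) \<longleftrightarrow>
         (\<exists>l>0. candidate_defined u F w l \<and> cost F w (candidate u F w l) = ereal x0))
        \<and>
        (\<forall>l>0. candidate_defined u F w l \<and> cost F w (candidate u F w l) = ereal x0 \<longrightarrow>
           (\<forall>Q. optimal (\<Q> F w x0) (expected_utility u) Q \<longleftrightarrow>
                  (\<forall>x\<in>{0<..<1}. Q x = candidate u F w l x))))"
proof -
  interpret utility u using assms(1,2) by unfold_locales auto
  have "kernel M \<rho> F" using assms(9-13) by (simp add: kernel_def kernel_axioms_def)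
  moreover have "weighting w" using assms(3-8) by unfold_locales
  ultimately interpret pricing "phi' F w" by (rule phi'_pricing)
  interpret market u "phi' F w" by unfold_locales
  have "phi F w = \<Phi>" by (rule ext) (simp add: phi_def \<Phi>_def)
  then have delta: "delta' F w x = D x" if "0 < x" "x < 1" for x
    unfolding delta'_def using right_derivative_eq[OF that] by simp
  have pint: "penalized_integrand u F w l = integrand l" for l
    by (intro ext) (simp add: penalized_integrand_def integrand_def)
  have pobj: "penalized_objective u F w l = J l" for l
    by (rule ext) (simp add: penalized_objective_def J_def pint)
  have eu: "expected_utility u = J 0"
    by (rule ext) (simp add: expected_utility_def J_def integrand_def[abs_def] flip: zero_ereal_def)
  have bs: "\<Q> F w x0 = budget_set x0" by (simp add: \<Q>_def budget_set_def cost_def)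
  have cand: "candidate u F w l x = y" if "is_max {0..} (l * D x) y" "0 < x" "x < 1" for l x y
    unfolding candidate_def delta[OF that(2,3)] inv_marginal_def is_maximizer_iff
    using that(1) is_max_unique[of "{0..}"] by (intro the_equality) auto
  have cdef: "candidate_defined u F w l \<longleftrightarrow> (\<forall>x\<in>{0<..<1}. \<exists>y. is_max {0..} (l * D x) y)" for l
    unfolding candidate_defined_def inv_marginal_defined_def is_maximizer_iff by (auto simp: delta)
  have cmax: "is_max {0..} (l * D x) (candidate u F w l x)"
    if cd: "candidate_defined u F w l" and x: "0 < x" "x < 1" for l x
  proof -
    have "\<exists>y. is_max {0..} (l * D x) y" by (rule cd[unfolded cdef, rule_format]) (use x in simp)
    then obtain y where y: "is_max {0..} (l * D x) y" ..
    with cand[OF this x] show ?thesis by simp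
  qed
  have cG: "candidate u F w l \<in> \<G>" if "0 < l" "candidate_defined u F w l" for l
    by (rule is_max_\<G>[OF that(1) cmax[OF that(2)], of 1]) simp_all
  have cbs: "candidate u F w l \<in> budget_set x0"
    if "0 < l" "candidate_defined u F w l" "cost F w (candidate u F w l) = ereal x0" for l
    using cG[OF that(1,2)] that(3) by (simp add: budget_set_def cost_def)
  have part1: "optimal \<G> (penalized_objective u F w l) Q \<longleftrightarrow> (\<forall>x\<in>{0<..<1}. Q x = candidate u F w l x)"
    if "0 < l" "candidate_defined u F w l" "well_posed \<G> (penalized_objective u F w l)"
      "integral_defined (penalized_integrand u F w l (candidate u F w l))" for l Q
    unfolding pobj by (rule penalized_optimal_iff[OF that(1) cmax[OF that(2)]]) (use that in \<open>simp_all add: pobj pint\<close>)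
  have part2: "optimal (\<Q> F w x0) (expected_utility u) Q \<longleftrightarrow> (\<forall>x\<in>{0<..<1}. Q x = candidate u F w l x)"
    if "well_posed (\<Q> F w x0) (expected_utility u)" "0 < l" "candidate_defined u F w l"
      "cost F w (candidate u F w l) = ereal x0" for l Q
    unfolding bs eu
    by (rule budget_optimal_iff[OF that(2) cmax[OF that(3)] cbs[OF that(2-4)] assms(15)])
      (use that(1) in \<open>simp_all add: bs eu\<close>)
  have part3: "\<exists>l>0. candidate_defined u F w l \<and> cost F w (candidate u F w l) = ereal x0"
    if wp: "well_posed (\<Q> F w x0) (expected_utility u)" and opt: "optimal (\<Q> F w x0) (expected_utility u) Q" for Q
  proof -
    obtain l where l: "0 < l" and max: "\<And>x. 0 < x \<Longrightarrow> x < 1 \<Longrightarrow> is_max {0..} (l * D x) (Q x)"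
      using budget_optimal_imp_max[OF opt[unfolded bs eu] assms(15) wp[unfolded bs eu]] by blast
    have "candidate_defined u F w l" unfolding cdef
    proof
      fix x :: real assume "x \<in> {0<..<1}"
      then show "\<exists>y. is_max {0..} (l * D x) y" using max[of x] by (intro exI[of _ "Q x"]) simp
    qed
    \<comment> \<open>On (0,1) the optimum coincides with the candidate by uniqueness of maximizers,
      so it has the same cost.\<close>
    moreover have "cost F w (candidate u F w l) = cost F w Q"
      unfolding cost_def by (rule ext_integral_cong) (use cand[OF max] in auto)
    moreover have "cost F w Q = ereal x0" using opt by (simp add: optimal_def \<Q>_def)
    ultimately show ?thesis using l by auto
  qed
  show ?thesis
  proof (intro conjI allI impI)
    assume wp: "well_posed (\<Q> F w x0) (expected_utility u)"
    show "(\<exists>Q. optimal (\<Q> F w x0) (expected_utility u) Q) \<longleftrightarrow>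
         (\<exists>l>0. candidate_defined u F w l \<and> cost F w (candidate u F w l) = ereal x0)"
      using part2[OF wp] part3[OF wp] by blast
  qed (use part1 part2 in blast)+
qed

end
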